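(* Let $n,m,d$ be integers with $n\ge6$, $3\le m\le n-2$ and $3\le d\le n-\lfloor\frac{m+1}{2}\rfloor$, let $\alpha=\frac{(n-d-\lfloor\frac{m+1}{2}\rfloor)\lfloor\frac m2\rfloor}{n-d-\frac12}$ and $\beta=\frac12(d-\lfloor\frac m2\rfloor)$. Consider the class $\mathbb U(n,m,d)$ of unicyclic graphs with $n$ vertices, girth $m$ and diameter $d$. (i) If $0<\alpha<1$ and $d-\lfloor\frac m2\rfloor$ is even, then $U^k_{n,m,d}(\beta,\beta)$, $k=0,1,\dots,\lfloor\frac m4\rfloor$, are the unique graphs in $\mathbb U(n,m,d)$ with minimum degree distance. (ii) If $\alpha=1$ and $d-\lfloor\frac m2\rfloor$ is even, then $U_{n,m,d}=U_{n,m,d}(\beta+1,\beta-1)$ and $U^k_{n,m,d}(\beta,\beta)$, $k=0,1,\dots,\lfloor\frac m4\rfloor$, are the unique graphs in $\mathbb U(n,m,d)$ with minimum degree distance. (iii) If $\alpha>1$ is an integer with parity different from that of $d-\lfloor\frac m2\rfloor$, then $U_{n,m,d}$ and $U_{n,m,d}(\gamma-1,\theta+1)$ are the unique graphs in $\mathbb U(n,m,d)$ with minimum degree distance. (iv) If $\alpha=0$, or $0<\alpha\le1$ and $d-\lfloor\frac m2\rfloor$ is odd, or $\alpha>1$ is either not an integer or an integer with the same parity as $d-\lfloor\frac m2\rfloor$, then $U_{n,m,d}$ is the unique graph in $\mathbb U(n,m,d)$ with minimum degree distance.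
   Context: All graphs are finite, simple and connected; uniqueness is up to isomorphism. For a graph $G$, $d_G(x,y)$ is the distance, $D_G(x)=\sum_{y}d_G(x,y)$, $d_G(x)$ the degree, and $D'(G)=\sum_{x}d_G(x)D_G(x)$ the degree distance. A unicyclic graph is a connected graph with exactly one cycle; its girth is the length of that cycle. Attaching a path $P_s$ ($s\ge1$) to $w$ means adding new vertices $w_1,\dots,w_s$ with edges $ww_1,w_1w_2,\dots,w_{s-1}w_s$ (nothing for $s=0$); attaching $h$ pendant vertices to $w$ means adding $h$ new vertices each joined only to $w$. Let $h=n-d-\lfloor\frac{m+1}{2}\rfloor$. For integers $a\ge b\ge0$ with $a\ge1$ and $a+b=d-\lfloor\frac m2\rfloor$, and $0\le k\le\lfloor\frac m4\rfloor$, $U^k_{n,m,d}(a,b)$ is the graph obtained from the cycle $C_m=v_0v_1\cdots v_{m-1}v_0$ by attaching a path $P_a$ to $v_0$, a path $P_b$ to $v_{\lfloor m/2\rfloor}$, and $h$ pendant vertices to $v_k$; $U_{n,m,d}(a,b)=U^0_{n,m,d}(a,b)$. Let $\gamma,\theta$ be nonnegative integers with $\gamma+\theta=d-\lfloor\frac m2\rfloor$ such that $\gamma-\theta$ is as large as possible subject to $\gamma-\theta\le\alpha+1$, and $U_{n,m,d}=U_{n,m,d}(\gamma,\theta)$.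
   Formalization: In (iii), U_{n,m,d}(γ-1,θ+1) is listed only when α+1 ≤ d-⌊m/2⌋; otherwise U_{n,m,d} alone is the minimizer. As stated (iii) fails there, e.g. for (n,m,d)=(26,12,9), where α=4, γ=3, θ=0 and U(2,1) is not minimal. *)

theory Defs
  imports Complex_Main "Graph_Theory.Graph_Theory"
begin

text \<open>
  Finite simple graphs are modelled by the locale \<^locale>\<open>pair_graph\<close>: an undirected edge
  \<open>{u, v}\<close> is the pair of arcs \<open>(u, v)\<close>, \<open>(v, u)\<close>. Hence the degree of a vertex is its
  \<^const>\<open>out_degree\<close>, and isomorphism is \<^const>\<open>digraph_iso\<close>.
\<close>

definition gdist :: "'a pair_pre_digraph \<Rightarrow> 'a \<Rightarrow> 'a \<Rightarrow> nat" where
  "gdist G x y = (LEAST l. \<exists>p. pre_digraph.awalk (with_proj G) x p y \<and> length p = l)"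

lemma (in pair_fin_digraph) gdist_eq_\<mu>:
  assumes "x \<rightarrow>\<^sup>*\<^bsub>with_proj G\<^esub> y"
  shows "ereal (real (gdist G x y)) = \<mu> (\<lambda>_. 1) x y"
proof -
  have cost: "awalk_cost (\<lambda>_. 1) p = real (length p)" for p :: "('a \<times> 'a) list"
    by (induction p) auto
  from assms obtain p0 where "awalk x p0 y"
    using reachable_awalk by auto
  then have "\<exists>l p. awalk x p y \<and> length p = l"
    by blast
  then have "\<exists>p. awalk x p y \<and> length p = gdist G x y"
    unfolding gdist_def by (rule LeastI_ex)
  then obtain p where p: "awalk x p y" "length p = gdist G x y"
    by blast
  have "gdist G x y \<le> length q" if "awalk x q y" for q
    unfolding gdist_def using that by (intro Least_le) blast
  then show ?thesis
    unfolding \<mu>_def cost using p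
    by (intro antisym INF_greatest INF_lower2[of p]) auto
qed

definition graph_diameter :: "'a pair_pre_digraph \<Rightarrow> nat" where
  "graph_diameter G = Max {gdist G x y | x y. x \<in> pverts G \<and> y \<in> pverts G}"

definition transmission :: "'a pair_pre_digraph \<Rightarrow> 'a \<Rightarrow> nat" where
  "transmission G x = (\<Sum>y \<in> pverts G. gdist G x y)"

definition degree_distance :: "'a pair_pre_digraph \<Rightarrow> nat" where
  "degree_distance G = (\<Sum>x \<in> pverts G. out_degree (with_proj G) x * transmission G x)"

text \<open>
  A cycle of an undirected graph is represented by its set of undirected edges, which
  abstracts from starting point and orientation. The length condition removes the
  closed walks \<open>u, v, u\<close>, which are cycles of the symmetric digraph.
\<close>

definition cycles :: "'a pair_pre_digraph \<Rightarrow> 'a set set set" where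
  "cycles G =
    {(\<lambda>(u, v). {u, v}) ` set p | p. pre_digraph.cycle (with_proj G) p \<and> 3 \<le> length p}"

definition unicyclic :: "'a pair_pre_digraph \<Rightarrow> bool" where
  "unicyclic G \<longleftrightarrow> pair_graph G \<and> connected (with_proj G) \<and> (\<exists>!C. C \<in> cycles G)"

definition unicyclic_girth :: "'a pair_pre_digraph \<Rightarrow> nat" where
  "unicyclic_girth G = card (THE C. C \<in> cycles G)"

definition unicyclic_class :: "nat \<Rightarrow> nat \<Rightarrow> nat \<Rightarrow> 'a pair_pre_digraph set" where
  "unicyclic_class n m d =
    {G. unicyclic G \<and> card (pverts G) = n \<and> unicyclic_girth G = m \<and> graph_diameter G = d}"

definition min_degree_distance :: "nat \<Rightarrow> nat \<Rightarrow> nat \<Rightarrow> 'a pair_pre_digraph \<Rightarrow> bool" where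
  "min_degree_distance n m d G \<longleftrightarrow>
    is_arg_min degree_distance (\<lambda>H. H \<in> unicyclic_class n m d) G"

text \<open>
  For \<open>ws = [w1, w2, \<dots>]\<close> these are the edges \<open>w w1\<close>, \<open>w1 w2\<close>, \<dots> of a path attached to \<open>w\<close>
  (one orientation each); there are none if \<open>ws\<close> is empty.
\<close>

definition attached_path :: "'a \<Rightarrow> 'a list \<Rightarrow> 'a rel" where
  "attached_path w ws = set (zip (w # ws) ws)"

text \<open>
  The graph \<open>U\<^sup>k(a, b)\<close> on the vertices \<open>0, 1, \<dots>\<close>: first the \<open>m\<close> cycle vertices, then the path
  attached to \<open>0\<close>, then the path attached to \<open>m div 2\<close>, then the pendant vertices at \<open>k\<close>.
  If \<open>a + b + m div 2 = d\<close> there are \<open>n\<close> vertices in total.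
\<close>

definition U_graph :: "nat \<Rightarrow> nat \<Rightarrow> nat \<Rightarrow> nat \<Rightarrow> nat \<Rightarrow> nat \<Rightarrow> nat pair_pre_digraph" where
  "U_graph n m d k a b =
    (let h = n - d - (m + 1) div 2;
         E = {(i, (i + 1) mod m) | i. i < m}
           \<union> attached_path 0 [m ..< m + a]
           \<union> attached_path (m div 2) [m + a ..< m + a + b]
           \<union> {k} \<times> {m + a + b ..< m + a + b + h}
     in \<lparr> pverts = {..< m + a + b + h}, parcs = E \<union> E\<inverse> \<rparr>)"

text \<open>
  \<open>is_U n m d k a b G\<close>: the parameters are among those for which \<open>U\<^sup>k(a, b)\<close> is
  defined, and \<open>G\<close> is a copy of that graph.
\<close>

definition is_U ::
  "nat \<Rightarrow> nat \<Rightarrow> nat \<Rightarrow> nat \<Rightarrow> nat \<Rightarrow> nat \<Rightarrow> 'a pair_pre_digraph \<Rightarrow> bool" where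
  "is_U n m d k a b G \<longleftrightarrow>
    b \<le> a \<and> 1 \<le> a \<and> a + b + m div 2 = d \<and> k \<le> m div 4 \<and>
    digraph_iso (with_proj G) (with_proj (U_graph n m d k a b))"

end

theory Submission
  imports Defs
begin

text \<open>
  Let \<open>C\<close> be the cycle. Pairing every vertex off \<open>C\<close> with the edge to its parent shows that the degree
  distance is \<open>2 F - n (n - m)\<close>, where \<open>F\<close> (called \<open>weight\<close>) is the sum of all distances over ordered
  pairs plus the sum of the distances to \<open>C\<close>; so \<open>F\<close> has to be minimised.

  Fix a diametral pair and let \<open>K\<close> be the union of \<open>C\<close> and the tree paths from both ends to \<open>C\<close>. Vertices
  outside \<open>K\<close> contribute least to \<open>F\<close> if and only if they are leaves at one common vertex of \<open>K\<close> of minimal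
  cost. Then \<open>F\<close> is a polynomial in a few lengths, and it decreases if leaves placed
  on one of the two paths are moved to its foot (balancing the path lengths), if a common stem of the two paths is
  contracted, and if the feet of the paths are moved apart along \<open>C\<close> while end vertices
  become leaves. For feet that are antipodal and path lengths \<open>a \<ge> b\<close>, up to a constant
  \<open>F = N / 4 * ((a - b) - \<alpha>)\<^sup>2\<close> with \<open>N = 2 (n - d) - 1\<close>, so \<open>a - b\<close> has to be as close to \<open>\<alpha>\<close> as its
  parity allows. Ties between two such values, and between positions of the leaves if \<open>a = b\<close>, give the
  exceptional cases.
\<close>

section \<open>Distances in connected graphs\<close>

text \<open>The moves named above are not carried out on graphs: they are identities between
  polynomials in the lengths, whose right sides have a visible sign. Two difficulties shape the
  proof. First, for a fixed diametral core the leaves need not be cheapest at a foot: if one path is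
  much longer than the other, a vertex high on it can cost less. Hence the comparison is with a
  configuration whose path lengths are rebalanced, and lower bounds are needed for all pairs of
  lengths with the same sum and no smaller minimum. Second, moving the feet into antipodal position
  uses up vertices of the paths. The diameter supplies them: the cycle vertex opposite to a foot is
  no further from the end of its path than the other end is, so the other path is long enough. The
  same argument makes both paths long enough when they share a stem, which contracts to feet at
  distance 0.\<close>

locale connected_graph = pair_graph G for G :: "'a pair_pre_digraph" +
  assumes conn: "connected (with_proj G)"
begin

lemma reach: "u \<in> pverts G \<Longrightarrow> v \<in> pverts G \<Longrightarrow> u \<rightarrow>\<^sup>*\<^bsub>with_proj G\<^esub> v"
  using conn reachable_mk_symmetric_eq[OF sym_arcs]
  by (auto simp: connected_def strongly_connected_def mk_symmetric_def)

lemma gdist_walk: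
  assumes "u \<in> pverts G" "v \<in> pverts G"
  obtains p where "awalk u p v" "length p = gdist G u v"
proof -
  obtain p where "awalk u p v"
    using reach[OF assms] reachable_awalk by auto
  then have "\<exists>l p. awalk u p v \<and> length p = l" by blast
  then have "\<exists>p. awalk u p v \<and> length p = gdist G u v"
    unfolding gdist_def by (rule LeastI_ex)
  then show ?thesis using that by blast
qed

lemma gdist_le: "awalk u p v \<Longrightarrow> gdist G u v \<le> length p"
  unfolding gdist_def by (rule Least_le) blast

lemma gdist_refl [simp]: "u \<in> pverts G \<Longrightarrow> gdist G u u = 0"
  using gdist_le[of u "[]" u] by (simp add: awalk_Nil_iff)

lemma gdist_triangle:
  assumes "u \<in> pverts G" "v \<in> pverts G" "w \<in> pverts G"
  shows "gdist G u w \<le> gdist G u v + gdist G v w"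
proof -
  obtain p where p: "awalk u p v" "length p = gdist G u v"
    using assms gdist_walk by blast
  obtain q where q: "awalk v q w" "length q = gdist G v w"
    using assms gdist_walk by blast
  from awalk_appendI[OF p(1) q(1)] have "gdist G u w \<le> length (p @ q)"
    by (rule gdist_le)
  then show ?thesis using p q by simp
qed

lemma gdist_sym:
  assumes "u \<in> pverts G" "v \<in> pverts G"
  shows "gdist G u v = gdist G v u"
proof -
  have len: "length (rev_path p) = length p" for p :: "('a \<times> 'a) list"
    by (induction p) auto
  have "gdist G x y \<le> gdist G y x" if xy: "x \<in> pverts G" "y \<in> pverts G" for x y
  proof -
    obtain p where p: "awalk y p x" "length p = gdist G y x"
      using xy gdist_walk by blast
    then have "awalk x (rev_path p) y" by simp
    from gdist_le[OF this] show ?thesis using p len by simp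
  qed
  from this[OF assms] this[OF assms(2,1)] show ?thesis by simp
qed

lemma gdist_arc: "(u, v) \<in> parcs G \<Longrightarrow> gdist G u v \<le> 1"
  using gdist_le[of u "[(u, v)]" v] by (auto simp: awalk_simps wellformed')

lemma gdist_eq_0: "u \<in> pverts G \<Longrightarrow> v \<in> pverts G \<Longrightarrow> gdist G u v = 0 \<longleftrightarrow> u = v"
  by (metis gdist_walk awalk_empty_ends gdist_refl length_0_conv)

lemma gdist_eq_1:
  assumes "u \<in> pverts G" "v \<in> pverts G" "gdist G u v = 1"
  shows "(u, v) \<in> parcs G"
proof -
  obtain p where p: "awalk u p v" "length p = 1"
    using assms gdist_walk by metis
  then obtain e where "p = [e]" by (cases p) auto
  with p show ?thesis by (cases e) (auto simp: awalk_simps)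
qed

lemma gdist_closer:
  assumes "u \<in> pverts G" "v \<in> pverts G" "u \<noteq> v"
  obtains w where "(u, w) \<in> parcs G" "gdist G u v = Suc (gdist G w v)"
proof -
  obtain p where p: "awalk u p v" "length p = gdist G u v"
    using assms gdist_walk by blast
  then obtain e es where es: "p = e # es"
    using assms by (cases p) (auto simp: awalk_simps)
  obtain w where e: "e = (u, w)"
    using p es by (cases e) (auto simp: awalk_simps)
  have a: "(u, w) \<in> parcs G" "awalk w es v"
    using p es e by (auto simp: awalk_simps)
  have "gdist G w v \<le> length es" using a by (simp add: gdist_le)
  moreover have "gdist G u v \<le> gdist G u w + gdist G w v"
    using gdist_triangle[of u w v] a assms wellformed' by blast
  ultimately show ?thesis using that[OF a(1)] gdist_arc[OF a(1)] p(2) es by simp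
qed

text \<open>The main source of lower bounds on distances: a potential that rises by at most one
  along every arc rises along a walk by at most its length. Each use consists in finding the right
  potential.\<close>

lemma gdist_ge_lipschitz:
  fixes f :: "'a \<Rightarrow> int"
  assumes lip: "\<And>x y. (x, y) \<in> parcs G \<Longrightarrow> f y - f x \<le> 1"
    and "u \<in> pverts G" "v \<in> pverts G"
  shows "f v - f u \<le> int (gdist G u v)"
proof -
  have "f b - f a \<le> int (length p)" if "awalk a p b" for a p b
    using that
  proof (induction p arbitrary: a)
    case Nil
    then show ?case by (simp add: awalk_simps)
  next
    case (Cons e es)
    obtain x y where e: "e = (x, y)" by (cases e)
    with Cons.prems have "(a, y) \<in> parcs G" "awalk y es b"
      by (auto simp: awalk_simps)
    then have "f b - f y \<le> int (length es)" "f y - f a \<le> 1"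
      using Cons.IH lip by blast+
    then show ?case by simp
  qed
  then show ?thesis using assms gdist_walk by metis
qed

lemma gdist_Lip:
  assumes "(x, y) \<in> parcs G" "u \<in> pverts G"
  shows "gdist G u y \<le> gdist G u x + 1" "gdist G y u \<le> gdist G x u + 1"
  using gdist_triangle[of u x y] gdist_triangle[of y x u] gdist_arc[OF assms(1)]
    gdist_arc[OF arcs_symmetric[OF assms(1)]] assms wellformed'[OF assms(1)] by force+

end

lemma connected_graphI_walks:
  assumes "pair_graph G" "r \<in> pverts G"
    and "\<And>x. x \<in> pverts G \<Longrightarrow> x \<rightarrow>\<^sup>*\<^bsub>with_proj G\<^esub> r"
  shows "connected_graph G"
proof -
  interpret pair_graph G by fact
  have "x \<rightarrow>\<^sup>*\<^bsub>with_proj G\<^esub> y" if "x \<in> pverts G" "y \<in> pverts G" for x y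
    using assms(3)[OF that(1)] assms(3)[OF that(2)]
    by (meson reachable_trans symmetric_reachable[OF sym_arcs])
  then have "connected (with_proj G)"
    using assms(2) reachable_mk_symmetric_eq[OF sym_arcs]
    by (auto simp: connected_def strongly_connected_def mk_symmetric_def)
  then show ?thesis by unfold_locales
qed

section \<open>Distances on a cycle\<close>

text \<open>The shorter of the two arcs between vertices of an \<open>m\<close>-cycle whose indices
  differ by \<open>k\<close>. Residues make it a function on all integers, invariant under shifts by
  \<open>m\<close> and under reflection.\<close>

definition cyc_dist :: "nat \<Rightarrow> int \<Rightarrow> int" where
  "cyc_dist m k = min (k mod int m) ((- k) mod int m)"

lemma cyc_dist_cong: "i mod int m = j mod int m \<Longrightarrow> cyc_dist m i = cyc_dist m j"
  unfolding cyc_dist_def by (metis mod_minus_eq)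

lemma cyc_dist_minus: "cyc_dist m (- k) = cyc_dist m k"
  unfolding cyc_dist_def by (simp add: min.commute)

lemma cyc_dist_eq:
  assumes "0 \<le> k" "k \<le> int m" "0 < m"
  shows "cyc_dist m k = min k (int m - k)"
proof (cases "k = 0 \<or> k = int m")
  case True
  then show ?thesis using assms by (auto simp: cyc_dist_def)
next
  case False
  then have "k mod int m = k" "(- k) mod int m = int m - k"
    using assms by (auto simp: zmod_zminus1_eq_if)
  then show ?thesis by (simp add: cyc_dist_def)
qed

lemma cyc_dist_Suc:
  assumes "0 < m"
  shows "cyc_dist m (k + 1) - cyc_dist m k \<le> 1" "cyc_dist m k - cyc_dist m (k + 1) \<le> 1"
proof -
  define r where "r = k mod int m"
  have r: "0 \<le> r" "r < int m" using assms by (auto simp: r_def)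
  have "cyc_dist m k = cyc_dist m r" "cyc_dist m (k + 1) = cyc_dist m (r + 1)"
    by (rule cyc_dist_cong, simp add: r_def mod_add_left_eq)+
  then show "cyc_dist m (k + 1) - cyc_dist m k \<le> 1" "cyc_dist m k - cyc_dist m (k + 1) \<le> 1"
    using cyc_dist_eq[of r m] cyc_dist_eq[of "r + 1" m] r by auto
qed

text \<open>After dropping \<open>k = 0\<close> and shifting the index, each term for
  \<open>l + 2\<close> is one more than a term for \<open>l\<close>. Steps of two keep the parity of
  \<open>m\<close>.\<close>

lemma sum_min_cycle: "(\<Sum>k<m. min k (m - k)) = m div 2 * ((m + 1) div 2)" for m :: nat
proof (induction m rule: less_induct)
  case (less m)
  show ?case
  proof (cases "m \<le> 1")
    case True
    then have "m = 0 \<or> m = 1" by auto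
    then show ?thesis by auto
  next
    case False
    then obtain l where m: "m = Suc (Suc l)" by (metis One_nat_def Suc_n_not_le_n bot_nat_0.extremum not0_implies_Suc not_less_eq_eq)
    have "(\<Sum>k<m. min k (m - k)) = (\<Sum>k<Suc l. 1 + min k (l - k))"
      unfolding m sum.lessThan_Suc_shift[of _ "Suc l"]
      by (auto intro!: sum.cong)
    also have "\<dots> = Suc l + (\<Sum>k<l. min k (l - k))"
      by (simp only: sum.distrib) simp
    also have "\<dots> = m div 2 * ((m + 1) div 2)"
      using less.IH[of l] unfolding m
      by (cases "even l") (auto elim!: evenE oddE simp: algebra_simps)
    finally show ?thesis .
  qed
qed

section \<open>Rooted trees on a cycle\<close>

text \<open>
  The cycle is traversed by a periodic sequence \<open>v\<close> indexed by the integers, so that rotations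
  and reflections are index shifts; \<open>par\<close> and \<open>dep\<close> are the parent and the depth of a vertex
  in the forest of trees rooted on the cycle.
\<close>

locale sun =
  fixes G :: "'a pair_pre_digraph" and m :: nat and v :: "int \<Rightarrow> 'a"
    and par :: "'a \<Rightarrow> 'a" and dep :: "'a \<Rightarrow> nat"
  assumes fin: "finite (pverts G)"
    and m3: "3 \<le> m"
    and v_eq: "v i = v j \<longleftrightarrow> i mod int m = j mod int m"
    and v_in: "v i \<in> pverts G"
    and dep_0: "x \<in> pverts G \<Longrightarrow> dep x = 0 \<longleftrightarrow> x \<in> range v"
    and par_in: "x \<in> pverts G \<Longrightarrow> 0 < dep x \<Longrightarrow> par x \<in> pverts G"
    and dep_par: "x \<in> pverts G \<Longrightarrow> 0 < dep x \<Longrightarrow> dep x = Suc (dep (par x))"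
    and arcs_eq: "parcs G = {(v i, v (i + 1)) | i. True} \<union> {(v (i + 1), v i) | i. True}
      \<union> {(x, par x) | x. x \<in> pverts G \<and> 0 < dep x} \<union> {(par x, x) | x. x \<in> pverts G \<and> 0 < dep x}"
begin

lemma dep_v [simp]: "dep (v i) = 0"
  using dep_0 v_in by blast

lemma v_Suc_neq: "v (i + 1) \<noteq> v i"
proof
  assume "v (i + 1) = v i"
  then have "(i + 1) mod int m = i mod int m" by (simp add: v_eq)
  then have "int m dvd (i + 1) - i" by (rule mod_eq_dvd_iff[THEN iffD1])
  then show False using m3 zdvd_imp_le[of "int m" 1] by auto
qed

lemma arc_cases [consumes 1]:
  assumes "(x, y) \<in> parcs G"
  obtains (cyc) i where "x = v i" "y = v (i + 1)"
    | (cyc') i where "x = v (i + 1)" "y = v i"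
    | (tree) "y = par x" "x \<in> pverts G" "0 < dep x"
    | (tree') "x = par y" "y \<in> pverts G" "0 < dep y"
  using assms that unfolding arcs_eq by auto

lemma arc_cyc: "(v i, v (i + 1)) \<in> parcs G" "(v (i + 1), v i) \<in> parcs G"
  unfolding arcs_eq by (intro UnI1 CollectI exI[of _ i] conjI refl TrueI,
    intro UnI1 UnI2 CollectI exI[of _ i] conjI refl TrueI)

lemma arc_par: "x \<in> pverts G \<Longrightarrow> 0 < dep x \<Longrightarrow> (x, par x) \<in> parcs G"
  by (simp add: arcs_eq)

lemma dep_induct [consumes 1, case_names root step]:
  assumes "x \<in> pverts G"
    and "\<And>i. P (v i)"
    and "\<And>x. x \<in> pverts G \<Longrightarrow> 0 < dep x \<Longrightarrow> P (par x) \<Longrightarrow> P x"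
  shows "P x"
  using assms(1)
proof (induction "dep x" arbitrary: x)
  case 0
  then show ?case using dep_0 assms(2) by force
next
  case (Suc k)
  then show ?case using assms(3) dep_par par_in by (metis Suc_inject zero_less_Suc)
qed

lemma graph: "pair_graph G"
proof -
  have wf: "x \<in> pverts G \<and> y \<in> pverts G" if "(x, y) \<in> parcs G" for x y
    using that v_in par_in by (cases rule: arc_cases) auto
  have "finite (pverts G \<times> pverts G)" using fin by simp
  then have "finite (parcs G)" by (rule rev_finite_subset) (use wf in auto)
  moreover have "symmetric (with_proj G)"
    unfolding symmetric_def by (rule symI) (auto simp: arcs_eq)
  moreover have "x \<noteq> y" if "(x, y) \<in> parcs G" for x y
    using that v_Suc_neq dep_par by (cases rule: arc_cases) (metis n_not_Suc_n)+
  ultimately show ?thesis using wf fin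
    by unfold_locales auto
qed

end

sublocale sun \<subseteq> connected_graph G
proof -
  interpret pair_graph G by (rule graph)
  have nat: "v (int k) \<rightarrow>\<^sup>*\<^bsub>with_proj G\<^esub> v 0" for k
  proof (induction k)
    case 0
    then show ?case using v_in by simp
  next
    case (Suc k)
    have "(v (int (Suc k)), v (int k)) \<in> parcs G"
      using arc_cyc(2)[of "int k"] by (simp add: add.commute)
    then show ?case using Suc by (auto intro: adj_reachable_trans)
  qed
  have "x \<rightarrow>\<^sup>*\<^bsub>with_proj G\<^esub> v 0" if "x \<in> pverts G" for x
    using that
  proof (induction rule: dep_induct)
    case (root i)
    have "v i = v (int (nat (i mod int m)))"
      using m3 by (simp add: v_eq)
    then show ?case using nat by metis
  next
    case (step x)
    then show ?case using arc_par by (auto intro: adj_reachable_trans)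
  qed
  then show "connected_graph G"
    by (rule connected_graphI_walks[OF graph v_in])
qed

context sun
begin

lemma range_v: "range v = v ` {i..<i + int m}"
proof -
  have "v j \<in> v ` {i..<i + int m}" for j
  proof
    show "v j = v (i + (j - i) mod int m)"
      by (simp add: v_eq mod_add_right_eq)
    show "i + (j - i) mod int m \<in> {i..<i + int m}" using m3 by simp
  qed
  then show ?thesis by auto
qed

lemma inj_v: "inj_on v {i..<i + int m}"
proof (rule inj_onI)
  fix a b assume *: "a \<in> {i..<i + int m}" "b \<in> {i..<i + int m}" "v a = v b"
  then have "int m dvd a - b" by (simp add: v_eq mod_eq_dvd_iff)
  moreover have "\<bar>a - b\<bar> < int m" using * by auto
  ultimately show "a = b" using dvd_imp_le_int[of "a - b" "int m"] by auto
qed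

lemma card_range_v: "card (range v) = m"
  unfolding range_v[of 0] card_image[OF inj_v] by simp

lemma finite_range_v [simp]: "finite (range v)"
  unfolding range_v[of 0] by simp

lemma range_v_subset: "range v \<subseteq> pverts G"
  using v_in by blast

definition root :: "'a \<Rightarrow> 'a" where "root x = (par ^^ dep x) x"

lemma root_v [simp]: "root (v i) = v i"
  by (simp add: root_def)

lemma root_par: "x \<in> pverts G \<Longrightarrow> 0 < dep x \<Longrightarrow> root (par x) = root x"
  using dep_par[of x] unfolding root_def by (simp add: funpow_swap1)

lemma root_range: "x \<in> pverts G \<Longrightarrow> root x \<in> range v"
  by (induction rule: dep_induct) (auto simp: root_par)

lemma root_in: "x \<in> pverts G \<Longrightarrow> root x \<in> pverts G"
  using root_range range_v_subset by blast

text \<open>An arbitrary choice: only the residue modulo \<open>m\<close> is determined, and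
  \<open>cyc_dist\<close> sees nothing else.\<close>

definition index :: "'a \<Rightarrow> int" where "index x = (SOME i. v i = x)"

lemma v_index: "x \<in> range v \<Longrightarrow> v (index x) = x"
  unfolding index_def by (rule someI_ex) auto

lemma cyc_dist_index: "cyc_dist m (index (v i) - j) = cyc_dist m (i - j)"
proof (rule cyc_dist_cong)
  have "index (v i) mod int m = i mod int m"
    using v_index[of "v i"] by (simp add: v_eq)
  then show "(index (v i) - j) mod int m = (i - j) mod int m"
    by (metis mod_diff_left_eq)
qed

lemma gdist_v_le: "gdist G (v i) (v (i + int k)) \<le> k"
proof (induction k)
  case (Suc k)
  have "gdist G (v i) (v (i + int k + 1)) \<le> gdist G (v i) (v (i + int k)) + 1"
    using gdist_Lip(1)[OF arc_cyc(1) v_in] by simp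
  then show ?case using Suc by (simp add: add.commute add.left_commute)
qed (simp add: v_in)

text \<open>The trees offer no shortcut. Passing to roots is constant along tree edges and changes
  by one step along cycle edges, so the cycle distance between the root of a vertex and the root of
  \<open>x\<close> is an admissible potential.\<close>

lemma gdist_root_ge:
  assumes "x \<in> pverts G" "y \<in> pverts G"
  shows "cyc_dist m (index (root y) - index (root x)) \<le> int (gdist G x y)"
proof -
  define f where "f u = cyc_dist m (index (root u) - index (root x))" for u
  have f_v: "f (v i) = cyc_dist m (i - index (root x))" for i
    by (simp add: f_def cyc_dist_index)
  have "f w - f u \<le> 1" if "(u, w) \<in> parcs G" for u w
    using that
  proof (cases rule: arc_cases)
    case (cyc i)
    then show ?thesis using f_v[of i] f_v[of "i + 1"] cyc_dist_Suc(1)[of m "i - index (root x)"] m3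
      by (simp add: diff_add_eq)
  next
    case (cyc' i)
    then show ?thesis using f_v[of i] f_v[of "i + 1"] cyc_dist_Suc(2)[of m "i - index (root x)"] m3
      by (simp add: diff_add_eq)
  qed (auto simp: f_def root_par)
  then have "f y - f x \<le> int (gdist G x y)"
    by (rule gdist_ge_lipschitz) (use assms in auto)
  then show ?thesis by (simp add: f_def cyc_dist_def)
qed

lemma gdist_v: "int (gdist G (v i) (v j)) = cyc_dist m (j - i)"
proof (rule antisym)
  have "int (gdist G (v a) (v b)) \<le> (b - a) mod int m" for a b
  proof -
    have "v b = v (a + int (nat ((b - a) mod int m)))"
      using m3 by (simp add: v_eq mod_add_right_eq)
    then have "gdist G (v a) (v b) \<le> nat ((b - a) mod int m)"
      using gdist_v_le by metis
    moreover have "0 \<le> (b - a) mod int m" using m3 by simp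
    ultimately show ?thesis by linarith
  qed
  from this[of i j] this[of j i] show "int (gdist G (v i) (v j)) \<le> cyc_dist m (j - i)"
    using gdist_sym[OF v_in v_in, of i j] by (simp add: cyc_dist_def)
  have "cyc_dist m (index (v j) - index (v i)) = cyc_dist m (j - i)"
    by (metis cyc_dist_index cyc_dist_minus minus_diff_eq)
  then show "cyc_dist m (j - i) \<le> int (gdist G (v i) (v j))"
    using gdist_root_ge[of "v i" "v j"] v_in by simp
qed

lemma sum_gdist_v: "(\<Sum>y\<in>range v. gdist G (v i) y) = m div 2 * ((m + 1) div 2)"
proof -
  have "(\<Sum>y\<in>range v. gdist G (v i) y) = (\<Sum>j\<in>{i..<i + int m}. gdist G (v i) (v j))"
    unfolding range_v[of i] by (rule sum.reindex_cong[OF inj_v]) auto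
  also have "\<dots> = (\<Sum>k<m. gdist G (v i) (v (i + int k)))"
    by (rule sum.reindex_bij_witness[of _ "\<lambda>k. i + int k" "\<lambda>j. nat (j - i)"]) auto
  also have "\<dots> = (\<Sum>k<m. min k (m - k))"
  proof (rule sum.cong[OF refl])
    fix k assume "k \<in> {..<m}"
    then have "int (gdist G (v i) (v (i + int k))) = min (int k) (int m - int k)"
      "int (min k (m - k)) = min (int k) (int m - int k)"
      using cyc_dist_eq[of "int k" m] by (simp_all add: gdist_v of_nat_diff)
    then show "gdist G (v i) (v (i + int k)) = min k (m - k)" by linarith
  qed
  finally show ?thesis by (simp add: sum_min_cycle)
qed

text \<open>Contains \<open>y\<close> itself but not its root, so that it has \<open>dep y\<close>
  elements and is empty for cycle vertices.\<close>

definition anc :: "'a \<Rightarrow> 'a set" where "anc y = (\<lambda>k. (par ^^ k) y) ` {..<dep y}"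

lemma anc_root [simp]: "dep y = 0 \<Longrightarrow> anc y = {}"
  by (simp add: anc_def)

lemma anc_step: "y \<in> pverts G \<Longrightarrow> 0 < dep y \<Longrightarrow> anc y = insert y (anc (par y))"
  using dep_par[of y] unfolding anc_def
  by (simp add: lessThan_Suc_eq_insert_0 image_image funpow_swap1)

lemma anc_finite [simp]: "finite (anc y)"
  by (simp add: anc_def)

lemma anc_subset: "y \<in> pverts G \<Longrightarrow> x \<in> anc y \<Longrightarrow> x \<in> pverts G \<and> 0 < dep x \<and> dep x \<le> dep y"
proof (induction rule: dep_induct)
  case (step y)
  then show ?case using anc_step[of y] dep_par[of y] by auto
qed simp

lemma anc_self_iff: "y \<in> pverts G \<Longrightarrow> y \<in> anc y \<longleftrightarrow> 0 < dep y"
  using anc_step[of y] by (cases "dep y = 0") auto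

lemma notin_anc_par: "y \<in> pverts G \<Longrightarrow> 0 < dep y \<Longrightarrow> y \<notin> anc (par y)"
  using anc_subset[of "par y" y] par_in dep_par[of y] by force

lemma card_anc: "y \<in> pverts G \<Longrightarrow> card (anc y) = dep y"
proof (induction rule: dep_induct)
  case (step y)
  then show ?case using anc_step[of y] notin_anc_par[of y] dep_par[of y] by simp
qed simp

lemma anc_trans: "y \<in> pverts G \<Longrightarrow> x \<in> anc y \<Longrightarrow> anc x \<subseteq> anc y"
proof (induction rule: dep_induct)
  case (step y)
  then show ?case using anc_step[of y] by auto
qed simp

lemma anc_par_closed:
  assumes "y \<in> pverts G" "x \<in> anc y" "0 < dep (par x)"
  shows "par x \<in> anc y"
proof -
  have x: "x \<in> pverts G" "0 < dep x" using anc_subset[OF assms(1,2)] by auto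
  have "par x \<in> anc (par x)" using anc_self_iff[OF par_in[OF x]] assms(3) by simp
  then have "par x \<in> anc x" using anc_step[OF x] by simp
  then show ?thesis using anc_trans[OF assms(1,2)] by (rule subsetD[rotated])
qed

lemma gdist_anc:
  assumes "y \<in> pverts G" "x \<in> anc y"
  shows "gdist G x y + dep x = dep y"
proof -
  have x: "x \<in> pverts G" "dep x \<le> dep y" using assms anc_subset by auto
  have "gdist G x y + dep x \<le> dep y" using assms
  proof (induction rule: dep_induct)
    case (step y)
    show ?case
    proof (cases "x = y")
      case False
      then have xa: "x \<in> anc (par y)" using step anc_step[of y] by auto
      then have "x \<in> pverts G" using anc_subset par_in step by blast
      then have "gdist G x y \<le> gdist G x (par y) + 1"
        using gdist_Lip(1)[of "par y" y x] arc_par[of y] step arcs_symmetric by blast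
      then show ?thesis using step xa dep_par[of y] by force
    qed (use step in simp)
  qed simp
  moreover have "int (dep y) - int (dep x) \<le> int (gdist G x y)"
  proof (rule gdist_ge_lipschitz)
    fix a b assume "(a, b) \<in> parcs G"
    then show "int (dep b) - int (dep a) \<le> 1"
      by (cases rule: arc_cases) (auto dest: dep_par)
  qed (use assms x in auto)
  ultimately show ?thesis by linarith
qed

lemma gdist_dep_root:
  assumes "y \<in> pverts G"
  shows "gdist G (root y) y = dep y"
proof (rule antisym)
  show "gdist G (root y) y \<le> dep y" using assms
  proof (induction rule: dep_induct)
    case (step y)
    then have "gdist G (root y) y \<le> gdist G (root y) (par y) + 1"
      using gdist_Lip(1)[of "par y" y "root y"] arc_par[of y] arcs_symmetric root_in by blast
    then show ?case using step root_par dep_par by force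
  qed (simp add: v_in)
  have "int (dep y) - int (dep (root y)) \<le> int (gdist G (root y) y)"
  proof (rule gdist_ge_lipschitz)
    fix a b assume "(a, b) \<in> parcs G"
    then show "int (dep b) - int (dep a) \<le> 1"
      by (cases rule: arc_cases) (auto dest: dep_par)
  qed (use assms root_in in auto)
  moreover have "dep (root y) = 0" using assms root_range by force
  ultimately show "dep y \<le> gdist G (root y) y" by simp
qed

text \<open>The edge from \<open>x\<close> to its parent is a bridge, and \<open>y\<close> lies on
  the parent's side because \<open>x\<close> is not among its ancestors.\<close>

lemma gdist_par:
  assumes x: "x \<in> pverts G" "0 < dep x" and y: "y \<in> pverts G" "x \<notin> anc y"
  shows "gdist G x y = Suc (gdist G (par x) y)"
proof (rule antisym)
  show "gdist G x y \<le> Suc (gdist G (par x) y)"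
    using gdist_Lip(2)[OF arcs_symmetric[OF arc_par[OF x]] y(1)] by simp
  \<comment> \<open>The distance from \<open>par x\<close> on the parent's side, continued below
    \<open>x\<close> by falling one unit per level from the value \<open>-1\<close> at
    \<open>x\<close>. The bridge is the only edge between the two sides, and there the potential
    rises from \<open>-1\<close> to \<open>0\<close>.\<close>
  define f where "f u = (if x \<in> anc u then int (dep x) - int (dep u) - 1
    else int (gdist G (par x) u))" for u
  have lip_tree: "\<bar>f u - f (par u)\<bar> \<le> 1" if u: "u \<in> pverts G" "0 < dep u" for u
  proof (cases "u = x")
    case True
    then show ?thesis using notin_anc_par[OF x] anc_self_iff[OF x(1)] x par_in
      by (simp add: f_def)
  next
    case False
    then have "x \<in> anc u \<longleftrightarrow> x \<in> anc (par u)" using anc_step[OF u] by auto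
    then show ?thesis
      using gdist_Lip(1)[OF arc_par[OF u] par_in[OF x]] gdist_Lip(1)[OF arcs_symmetric[OF arc_par[OF u]] par_in[OF x]]
        dep_par[OF u] by (auto simp: f_def)
  qed
  have "f b - f a \<le> 1" if "(a, b) \<in> parcs G" for a b
    using that
  proof (cases rule: arc_cases)
    case (cyc i)
    then show ?thesis using gdist_Lip(1)[OF that par_in[OF x]] by (simp add: f_def)
  next
    case (cyc' i)
    then show ?thesis using gdist_Lip(1)[OF that par_in[OF x]] by (simp add: f_def)
  next
    case tree
    then show ?thesis using lip_tree[of a] by simp
  next
    case tree'
    then show ?thesis using lip_tree[of b] by simp
  qed
  then have "f y - f x \<le> int (gdist G x y)"
    by (rule gdist_ge_lipschitz) (use x y in auto)
  then show "Suc (gdist G (par x) y) \<le> gdist G x y"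
    using x y anc_self_iff[OF x(1)] by (simp add: f_def)
qed

lemma gdist_par_anc:
  assumes y: "y \<in> pverts G" and x: "x \<in> anc y"
  shows "gdist G (par x) y = Suc (gdist G x y)"
proof -
  have x': "x \<in> pverts G" "0 < dep x" using anc_subset[OF y x] by auto
  have d: "gdist G x y + dep x = dep y" by (rule gdist_anc[OF y x])
  have "gdist G (par x) y + dep (par x) = dep y"
  proof (cases "dep (par x) = 0")
    case True
    then have "par x = root x" using x' dep_par[of x] by (simp add: root_def)
    also have "root x = root y" using y x
    proof (induction rule: dep_induct)
      case (step y)
      then show ?case using anc_step[of y] root_par[of y] by auto
    qed simp
    finally show ?thesis using gdist_dep_root[OF y] True by simp
  next
    case False
    then show ?thesis using gdist_anc[OF y] anc_par_closed[OF y x] by simp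
  qed
  then show ?thesis using d dep_par[OF x'] by simp
qed

end

section \<open>The degree distance of a sun\<close>

context sun
begin

lemma v_mod: "v (i mod int m) = v i" "v (i mod int m + 1) = v (i + 1)" "v (i mod int m - 1) = v (i - 1)"
  by (simp_all add: v_eq mod_add_left_eq mod_diff_left_eq)

lemma v_step_neq: "v (i + 1) \<noteq> v (i - 1)"
proof
  assume "v (i + 1) = v (i - 1)"
  then have "int m dvd (i + 1) - (i - 1)" by (simp only: v_eq mod_eq_dvd_iff)
  then show False using m3 zdvd_imp_le[of "int m" 2] by auto
qed

lemma sum_range_v: "(\<Sum>c\<in>range v. g c) = (\<Sum>i\<in>{0..<int m}. g (v i))"
  unfolding range_v[of 0] using sum.reindex[OF inj_v[of 0], of g] by simp

lemma off_cycle: "x \<in> pverts G - range v \<longleftrightarrow> x \<in> pverts G \<and> 0 < dep x"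
  using dep_0 by auto

lemma sum_parcs:
  fixes g :: "'a \<Rightarrow> nat"
  shows "(\<Sum>e\<in>parcs G. g (fst e)) =
    2 * (\<Sum>c\<in>range v. g c) + (\<Sum>x\<in>pverts G - range v. g x + g (par x))"
proof -
  let ?I = "{0..<int m}" and ?T = "pverts G - range v"
  let ?A1 = "(\<lambda>i. (v i, v (i + 1))) ` ?I" and ?A2 = "(\<lambda>i. (v i, v (i - 1))) ` ?I"
  let ?A3 = "(\<lambda>x. (x, par x)) ` ?T" and ?A4 = "(\<lambda>x. (par x, x)) ` ?T"
  have mod_I: "i mod int m \<in> ?I" for i using m3 by simp
  have eq: "parcs G = (?A1 \<union> ?A2) \<union> (?A3 \<union> ?A4)"
  proof (rule set_eqI, rule iffI)
    fix e assume "e \<in> parcs G"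
    then have "(fst e, snd e) \<in> parcs G" by simp
    then show "e \<in> (?A1 \<union> ?A2) \<union> (?A3 \<union> ?A4)"
    proof (cases rule: arc_cases)
      case (cyc i)
      then have "e = (\<lambda>i. (v i, v (i + 1))) (i mod int m)" by (simp add: v_mod prod_eq_iff)
      then show ?thesis using mod_I by blast
    next
      case (cyc' i)
      then have "e = (\<lambda>i. (v i, v (i - 1))) ((i + 1) mod int m)" by (simp add: v_mod prod_eq_iff)
      then show ?thesis using mod_I by blast
    next
      case tree
      then have "e = (\<lambda>x. (x, par x)) (fst e)" "fst e \<in> ?T"
        using off_cycle[of "fst e"] by (simp_all add: prod_eq_iff)
      then show ?thesis by blast
    next
      case tree'
      then have "e = (\<lambda>x. (par x, x)) (snd e)" "snd e \<in> ?T"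
        using off_cycle[of "snd e"] by (simp_all add: prod_eq_iff)
      then show ?thesis by blast
    qed
  next
    fix e assume "e \<in> (?A1 \<union> ?A2) \<union> (?A3 \<union> ?A4)"
    moreover have "(v i, v (i - 1)) \<in> parcs G" for i using arc_cyc(2)[of "i - 1"] by simp
    ultimately show "e \<in> parcs G"
      using arc_cyc(1) arc_par arcs_symmetric off_cycle[THEN iffD1] by blast
  qed
  have inj: "inj_on (\<lambda>i. (v i, v (i + 1))) ?I" "inj_on (\<lambda>i. (v i, v (i - 1))) ?I"
    "inj_on (\<lambda>x. (x, par x)) ?T" "inj_on (\<lambda>x. (par x, x)) ?T"
    using inj_v[of 0] by (auto simp: inj_on_def)
  have d12: "?A1 \<inter> ?A2 = {}"
  proof (rule ccontr)
    assume "?A1 \<inter> ?A2 \<noteq> {}"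
    then obtain i j where ij: "v i = v j" "v (i + 1) = v (j - 1)" by auto
    then have "v (i + 1) = v (j + 1)" by (metis v_eq v_mod(2))
    then show False using ij v_step_neq[of j] by simp
  qed
  have d34: "?A3 \<inter> ?A4 = {}"
  proof (rule ccontr)
    assume "?A3 \<inter> ?A4 \<noteq> {}"
    then obtain x y where "x \<in> ?T" "y \<in> ?T" "x = par y" "par x = y" by auto
    then have "dep x = Suc (dep y)" "dep y = Suc (dep x)"
      using dep_par off_cycle by metis+
    then show False by simp
  qed
  have d: "(?A1 \<union> ?A2) \<inter> (?A3 \<union> ?A4) = {}" by auto
  have fT: "finite ?T" using fin by simp
  have s: "(\<Sum>e\<in>?A1. g (fst e)) = (\<Sum>c\<in>range v. g c)"
    "(\<Sum>e\<in>?A2. g (fst e)) = (\<Sum>c\<in>range v. g c)"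
    "(\<Sum>e\<in>?A3. g (fst e)) = (\<Sum>x\<in>?T. g x)"
    "(\<Sum>e\<in>?A4. g (fst e)) = (\<Sum>x\<in>?T. g (par x))"
    unfolding sum_range_v by (subst sum.reindex, use inj in auto)+
  have f1: "finite ?A1" "finite ?A2" by simp_all
  have f3: "finite ?A3" "finite ?A4" using fT by simp_all
  have "(\<Sum>e\<in>parcs G. g (fst e)) = ((\<Sum>e\<in>?A1. g (fst e)) + (\<Sum>e\<in>?A2. g (fst e)))
      + ((\<Sum>e\<in>?A3. g (fst e)) + (\<Sum>e\<in>?A4. g (fst e)))"
    unfolding eq sum.union_disjoint[OF finite_UnI[OF f1] finite_UnI[OF f3] d]
      sum.union_disjoint[OF f1 d12] sum.union_disjoint[OF f3 d34] by (rule refl)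
  then show ?thesis unfolding s by (simp only: sum.distrib mult_2)
qed

definition dist_sum :: "'a set \<Rightarrow> 'a \<Rightarrow> nat" where
  "dist_sum K x = (\<Sum>y\<in>K. gdist G x y)"

text \<open>For \<open>K = pverts G\<close> this is the quantity \<open>F\<close> of the overview.
  It is defined for subsets so that it can be computed by enlarging cores.\<close>

definition weight :: "'a set \<Rightarrow> nat" where
  "weight K = (\<Sum>x\<in>K. dist_sum K x + dep x)"

lemma transmission_eq: "transmission G x = dist_sum (pverts G) x"
  by (simp add: transmission_def dist_sum_def)

text \<open>Weighting by degrees means summing the transmission of the tail over all arcs;
  \<open>sum_parcs\<close> splits this into the cycle and the parent edges. Stepping from
  \<open>x\<close> to its parent brings every vertex one unit closer except the descendants of
  \<open>x\<close>, which become one unit more distant. Counting pairs of a vertex and a descendant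
  the other way round gives the sum of all depths.\<close>

lemma degree_distance_weight:
  "int (degree_distance G) =
    2 * int (weight (pverts G)) - int (card (pverts G)) * (int (card (pverts G)) - int m)"
proof -
  let ?V = "pverts G" and ?T = "pverts G - range v"
  let ?t = "dist_sum (pverts G)"
  have "degree_distance G = (\<Sum>x\<in>?V. \<Sum>e\<in>{e \<in> parcs G. fst e = x}. ?t (fst e))"
    unfolding degree_distance_def transmission_eq
    by (rule sum.cong[OF refl]) (simp add: out_degree_def out_arcs_def)
  also have "\<dots> = (\<Sum>e\<in>parcs G. ?t (fst e))"
    by (rule sum.group) (use fin pair_finite_arcs wellformed' in auto)
  also have "\<dots> = 2 * (\<Sum>c\<in>range v. ?t c) + (\<Sum>x\<in>?T. ?t x + ?t (par x))"
    by (rule sum_parcs)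
  finally have *: "int (degree_distance G) =
      2 * (\<Sum>c\<in>range v. int (?t c)) + (\<Sum>x\<in>?T. int (?t x) + int (?t (par x)))"
    by simp
  have par: "int (?t (par x)) = int (?t x) - int (card ?V) + 2 * int (card {y \<in> ?V. x \<in> anc y})"
    if x: "x \<in> ?V" "0 < dep x" for x
  proof -
    have "int (?t (par x)) = (\<Sum>y\<in>?V. int (gdist G x y) - 1 + 2 * (if x \<in> anc y then 1 else 0))"
      unfolding dist_sum_def of_nat_sum
      by (rule sum.cong[OF refl]) (use gdist_par[OF x] gdist_par_anc in auto)
    also have "\<dots> = int (?t x) - int (card ?V) + 2 * int (card {y \<in> ?V. x \<in> anc y})"
      unfolding sum.distrib sum_subtractf sum_distrib_left[symmetric] dist_sum_def
      using fin by (simp add: sum.If_cases Int_def)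
    finally show ?thesis .
  qed
  have T: "(\<Sum>x\<in>?T. int (card {y \<in> ?V. x \<in> anc y})) = (\<Sum>y\<in>?V. int (dep y))"
  proof -
    have "(\<Sum>x\<in>?T. card {y \<in> ?V. x \<in> anc y}) = (\<Sum>y\<in>?V. card {x \<in> ?T. x \<in> anc y})"
      using sum_multicount_gen[of ?T ?V "\<lambda>x y. x \<in> anc y" "\<lambda>y. card {x \<in> ?T. x \<in> anc y}"] fin
      by simp
    also have "\<dots> = (\<Sum>y\<in>?V. dep y)"
    proof (rule sum.cong[OF refl])
      fix y assume y: "y \<in> ?V"
      then have "{x \<in> ?T. x \<in> anc y} = anc y" using anc_subset[OF y] off_cycle by blast
      then show "card {x \<in> ?T. x \<in> anc y} = dep y" using card_anc[OF y] by simp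
    qed
    finally have "int (\<Sum>x\<in>?T. card {y \<in> ?V. x \<in> anc y}) = int (\<Sum>y\<in>?V. dep y)"
      by simp
    then show ?thesis by simp
  qed
  have cT: "int (card ?T) = int (card ?V) - int m"
    using card_Diff_subset[OF finite_range_v range_v_subset] card_range_v
      card_mono[OF fin range_v_subset] by simp
  have "(\<Sum>x\<in>?T. int (?t x) + int (?t (par x))) =
      (\<Sum>x\<in>?T. 2 * int (?t x) - int (card ?V) + 2 * int (card {y \<in> ?V. x \<in> anc y}))"
    by (rule sum.cong[OF refl]) (use par off_cycle in simp)
  also have "\<dots> = 2 * (\<Sum>x\<in>?T. int (?t x)) - int (card ?T) * int (card ?V)
      + 2 * (\<Sum>x\<in>?T. int (card {y \<in> ?V. x \<in> anc y}))"
    by (simp add: sum.distrib sum_subtractf sum_distrib_left)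
  finally have "int (degree_distance G) =
      2 * ((\<Sum>c\<in>range v. int (?t c)) + (\<Sum>x\<in>?T. int (?t x))) - int (card ?T) * int (card ?V)
      + 2 * (\<Sum>y\<in>?V. int (dep y))"
    using * T by simp
  also have "(\<Sum>c\<in>range v. int (?t c)) + (\<Sum>x\<in>?T. int (?t x)) = (\<Sum>x\<in>?V. int (?t x))"
    using sum.subset_diff[OF range_v_subset fin, of "\<lambda>x. int (?t x)"] by simp
  finally show ?thesis
    using cT by (simp add: weight_def sum.distrib algebra_simps)
qed

end

section \<open>Cycles of a sun\<close>

lemma pcas_nth:
  assumes "pcas u p w"
  shows "Suc k < length p \<Longrightarrow> snd (p ! k) = fst (p ! Suc k)"
    and "p \<noteq> [] \<Longrightarrow> fst (p ! 0) = u" and "p \<noteq> [] \<Longrightarrow> snd (p ! (length p - 1)) = w"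
proof -
  show "Suc k < length p \<Longrightarrow> snd (p ! k) = fst (p ! Suc k)"
    using assms
  proof (induction p arbitrary: u k)
    case (Cons e es)
    then show ?case by (cases k; cases es) auto
  qed simp
  show "p \<noteq> [] \<Longrightarrow> fst (p ! 0) = u" using assms by (cases p) auto
  show "p \<noteq> [] \<Longrightarrow> snd (p ! (length p - 1)) = w" using assms
  proof (induction p arbitrary: u)
    case (Cons e es)
    then show ?case by (cases es) auto
  qed simp
qed

lemma tl_pawalk_verts: "pcas u p w \<Longrightarrow> tl (pawalk_verts u p) = map snd p"
proof (induction p arbitrary: u)
  case (Cons e es)
  then show ?case by (cases es) auto
qed simp

lemma (in pair_wf_digraph) cycle_arcs: "cycle p \<Longrightarrow> e \<in> set p \<Longrightarrow> e \<in> parcs G"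
  unfolding cycle_def awalk_def by blast

text \<open>Indexing by the integers, as in the locale \<open>sun\<close>, makes predecessors and
  successors uniform: the place where the closed walk starts is no longer special.\<close>

lemma (in pair_wf_digraph) cycle_sequence:
  assumes "cycle p"
  obtains a :: "int \<Rightarrow> 'a"
  where "\<And>i j. a i = a j \<longleftrightarrow> i mod int (length p) = j mod int (length p)"
    and "set p = {(a i, a (i + 1)) | i. True}"
proof -
  let ?L = "int (length p)"
  obtain u where u: "awalk u p u" "distinct (tl (awalk_verts u p))" "p \<noteq> []"
    using assms by (auto simp: cycle_def)
  then have cas: "pcas u p u" by auto
  have dist: "distinct (map snd p)" using u tl_pawalk_verts[OF cas] by simp
  have L: "0 < ?L" using u by simp
  define b where "b k = snd (p ! k)" for k
  define a where "a i = b (nat (i mod ?L))" for i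
  have idx: "nat (i mod ?L) < length p" for i using L by (simp add: nat_less_iff)
  have a_eq: "a i = a j \<longleftrightarrow> i mod ?L = j mod ?L" for i j
  proof
    assume "a i = a j"
    then have "nat (i mod ?L) = nat (j mod ?L)"
      using dist idx[of i] idx[of j] by (simp add: a_def b_def distinct_conv_nth) metis
    then show "i mod ?L = j mod ?L"
      using pos_mod_sign[OF L, of i] pos_mod_sign[OF L, of j] by linarith
  qed (simp add: a_def)
  have fst_eq: "fst (p ! nat (i mod ?L)) = a (i - 1)" for i
  proof (cases "i mod ?L = 0")
    case True
    then have "(i - 1) mod ?L = ?L - 1"
      by (metis L diff_0 mod_diff_left_eq zmod_minus1)
    then have "a (i - 1) = b (length p - 1)"
      unfolding a_def by (metis nat_int nat_minus_as_int of_nat_1)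
    then show ?thesis using True pcas_nth(2,3)[OF cas u(3)] by (simp add: b_def)
  next
    case False
    then have pos: "0 < i mod ?L" using L by (simp add: order_less_le)
    have "(i - 1) mod ?L = (i mod ?L - 1) mod ?L" by (simp add: mod_diff_left_eq)
    also have "\<dots> = i mod ?L - 1" using pos L by (intro mod_pos_pos_trivial) (auto intro: less_trans[of _ "i mod ?L"])
    finally have *: "nat (i mod ?L) = Suc (nat ((i - 1) mod ?L))" using pos by simp
    then show ?thesis using pcas_nth(1)[OF cas, of "nat ((i - 1) mod ?L)"] idx[of i]
      by (simp add: a_def b_def)
  qed
  have elem: "p ! nat (i mod ?L) = (a (i - 1), a i)" for i
    using fst_eq[of i] by (simp add: prod_eq_iff a_def b_def)
  have "set p = {(a i, a (i + 1)) | i. True}"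
  proof (intro equalityI subsetI)
    fix e assume "e \<in> set p"
    then obtain k where "k < length p" "e = p ! k" by (metis in_set_conv_nth)
    then have "e = p ! nat (int k mod ?L)" by simp
    then have "e = (a (int k - 1), a (int k - 1 + 1))" using elem[of "int k"] by simp
    then show "e \<in> {(a i, a (i + 1)) | i. True}" by blast
  next
    fix e assume "e \<in> {(a i, a (i + 1)) | i. True}"
    then obtain i where "e = p ! nat ((i + 1) mod ?L)" using elem[of "_ + 1"] by auto
    then show "e \<in> set p" using idx nth_mem by blast
  qed
  with a_eq show ?thesis using that by blast
qed

text \<open>A maximum of \<open>f\<close> along a cycle has two distinct cycle neighbours that are
  not larger. This is contradictory whenever \<open>f\<close> leaves room for only one, which is
  used for the depth and for a numbering of the cut cycle.\<close>

lemma (in pair_wf_digraph) cycle_max_vertex: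
  fixes f :: "'a \<Rightarrow> 'b :: linorder"
  assumes "cycle p" "3 \<le> length p"
  obtains x y z where "(y, x) \<in> set p" "(x, z) \<in> set p" "y \<noteq> z"
    and "\<forall>e\<in>set p. f (fst e) \<le> f x \<and> f (snd e) \<le> f x"
proof -
  obtain a where a: "\<And>i j. a i = a j \<longleftrightarrow> i mod int (length p) = j mod int (length p)"
    and p: "set p = {(a i, a (i + 1)) | i. True}"
    using cycle_sequence[OF assms(1)] by blast
  have "finite (range a)"
  proof -
    have "range a \<subseteq> fst ` set p" using p by force
    then show ?thesis by (rule finite_subset) simp
  qed
  then have fin: "finite (f ` range a)" by simp
  obtain i where i: "Max (f ` range a) = f (a i)"
    using Max_in[OF fin] by auto
  have max: "f (a j) \<le> f (a i)" for j
    using Max_ge[OF fin] i by auto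
  have "a (i - 1) \<noteq> a (i + 1)"
  proof
    assume "a (i - 1) = a (i + 1)"
    then have "int (length p) dvd (i + 1) - (i - 1)" using a mod_eq_dvd_iff by metis
    then show False using assms(2) zdvd_imp_le[of "int (length p)" 2] by auto
  qed
  moreover have "(a (i - 1), a (i - 1 + 1)) \<in> set p" "(a i, a (i + 1)) \<in> set p"
    using p by blast+
  ultimately show ?thesis using that[of "a (i - 1)" "a i" "a (i + 1)"] max p by force
qed

context sun
begin

definition cycle_edges :: "'a set set" where
  "cycle_edges = range (\<lambda>i. {v i, v (i + 1)})"

text \<open>At a deepest vertex of positive depth both neighbours on the cycle would have to be its
  parent.\<close>

lemma cycle_on_range:
  assumes "cycle p" "3 \<le> length p" "e \<in> set p"
  shows "dep (fst e) = 0 \<and> dep (snd e) = 0"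
proof -
  obtain x y z where x: "(y, x) \<in> set p" "(x, z) \<in> set p" "y \<noteq> z"
    and "\<forall>e\<in>set p. dep (fst e) \<le> dep x \<and> dep (snd e) \<le> dep x"
    using cycle_max_vertex[OF assms(1,2), of dep thesis] by metis
  note max = this(4)[rule_format]
  have arcs: "(y, x) \<in> parcs G" "(x, z) \<in> parcs G"
    using cycle_arcs[OF assms(1)] x by blast+
  have "dep x = 0"
  proof (rule ccontr)
    assume "dep x \<noteq> 0"
    have "y = par x" using arcs(1)
      by (cases rule: arc_cases) (use \<open>dep x \<noteq> 0\<close> max[OF x(1)] dep_par[of y] in auto)
    moreover have "z = par x" using arcs(2)
      by (cases rule: arc_cases) (use \<open>dep x \<noteq> 0\<close> max[OF x(2)] dep_par[of z] in auto)
    ultimately show False using x(3) by simp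
  qed
  then show ?thesis using max[OF assms(3)] by simp
qed

lemma cycle_edges_eq:
  assumes "cycle p" "3 \<le> length p"
  shows "(\<lambda>(x, y). {x, y}) ` set p = cycle_edges"
proof (intro equalityI subsetI)
  fix E assume "E \<in> (\<lambda>(x, y). {x, y}) ` set p"
  then obtain x y where xy: "(x, y) \<in> set p" "E = {x, y}" by auto
  then have "(x, y) \<in> parcs G" using cycle_arcs[OF assms(1)] by blast
  then show "E \<in> cycle_edges"
    by (cases rule: arc_cases)
      (use xy cycle_on_range[OF assms xy(1)] in \<open>auto simp: cycle_edges_def insert_commute\<close>)
next
  fix E assume "E \<in> cycle_edges"
  then obtain i where E: "E = {v i, v (i + 1)}" by (auto simp: cycle_edges_def)
  show "E \<in> (\<lambda>(x, y). {x, y}) ` set p"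
  proof (rule ccontr)
    assume E': "E \<notin> (\<lambda>(x, y). {x, y}) ` set p"
    \<comment> \<open>If the edge between \<open>v i\<close> and \<open>v (i + 1)\<close> is
      avoided, the cycle can be cut there; \<open>f\<close> numbers the resulting path from
      \<open>0\<close> at \<open>v (i + 1)\<close> to \<open>m - 1\<close> at \<open>v i\<close>. At
      a vertex \<open>v j\<close> of \<open>p\<close> maximal for \<open>f\<close>, both neighbours
      on \<open>p\<close> would be \<open>v (j - 1)\<close>.\<close>
    define f where "f x = (index x - (i + 1)) mod int m" for x
    have L: "0 < int m" using m3 by simp
    have f_v: "f (v j) = (j - (i + 1)) mod int m" for j
    proof -
      have "index (v j) mod int m = j mod int m" using v_index[of "v j"] by (simp add: v_eq)
      then show ?thesis unfolding f_def by (metis mod_diff_left_eq)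
    qed
    have f_Suc: "f (v (j + 1)) = f (v j) + 1" if "v j \<noteq> v i" for j
    proof -
      have "f (v j) \<noteq> int m - 1"
      proof
        assume "f (v j) = int m - 1"
        then have "(j - (i + 1)) mod int m = (-1) mod int m"
          using m3 by (simp add: f_v zmod_minus1)
        then have "int m dvd (j - (i + 1)) - (-1)" by (simp only: mod_eq_dvd_iff)
        then have "j mod int m = i mod int m" by (simp add: mod_eq_dvd_iff)
        then show False using that by (simp add: v_eq)
      qed
      then have b: "0 \<le> f (v j)" "f (v j) + 1 < int m"
        using L pos_mod_bound[OF L, of "j - (i + 1)"] unfolding f_v by (auto simp del: pos_mod_bound)
      have "f (v (j + 1)) = (j - (i + 1) + 1) mod int m"
        by (simp add: f_v)
      also have "\<dots> = (f (v j) + 1) mod int m"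
        unfolding f_v by (simp only: mod_add_left_eq)
      also have "\<dots> = f (v j) + 1" using b by (intro mod_pos_pos_trivial) auto
      finally show ?thesis .
    qed
    obtain x y z where x: "(y, x) \<in> set p" "(x, z) \<in> set p" "y \<noteq> z"
      and "\<forall>e\<in>set p. f (fst e) \<le> f x \<and> f (snd e) \<le> f x"
      using cycle_max_vertex[OF assms, of f thesis] by metis
    note max = this(4)[rule_format]
    have arcs: "(y, x) \<in> parcs G" "(x, z) \<in> parcs G"
      using cycle_arcs[OF assms(1)] x by blast+
    have "x \<in> range v" using cycle_on_range[OF assms x(1)] dep_0 arcs(1) wellformed' by auto
    then obtain j where j: "x = v j" by blast
    have nb: "w = v (j - 1)" if w: "(w, x) \<in> set p \<or> (x, w) \<in> set p" for w
    proof -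
      have d: "dep w = 0" "f w \<le> f x" "{w, x} \<noteq> E"
        using w max cycle_on_range[OF assms] E' by (fastforce simp: insert_commute)+
      have "(w, x) \<in> parcs G" using w cycle_arcs[OF assms(1)] arcs_symmetric by blast
      then show ?thesis
      proof (cases rule: arc_cases)
        case (cyc k)
        then show ?thesis using j v_mod(3) by (metis add_diff_cancel_right' v_eq)
      next
        case (cyc' k)
        then have w: "w = v (j + 1)" using j v_mod(2) by (metis v_eq)
        show ?thesis
        proof (cases "v j = v i")
          case True
          then have "v (j + 1) = v (i + 1)" by (metis v_mod(2) v_eq)
          then show ?thesis using True d(3) E w j by (simp add: insert_commute)
        next
          case False
          then show ?thesis using f_Suc d(2) w j by simp
        qed
      qed (use d j in auto)
    qed
    show False using nb[of y] nb[of z] x by simp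
  qed
qed

lemma cycle_exists: "\<exists>p. cycle p \<and> length p = m"
proof -
  define p where "p k = map (\<lambda>k. (v (int k), v (int k + 1))) [0..<k]" for k
  have walk: "awalk (v 0) (p k) (v (int k))" for k
  proof (induction k)
    case (Suc k)
    have "awalk (v (int k)) [(v (int k), v (int k + 1))] (v (int (Suc k)))"
      using arc_cyc(1)[of "int k"] v_in by (simp add: awalk_simps add.commute)
    with Suc show ?case unfolding p_def by (auto intro: awalk_appendI)
  qed (simp add: p_def awalk_simps v_in)
  have "v (int m) = v 0" by (simp add: v_eq)
  then have w: "awalk (v 0) (p m) (v 0)" using walk[of m] by simp
  have "tl (awalk_verts (v 0) (p m)) = map snd (p m)"
    using w by (intro tl_pawalk_verts) auto
  moreover have "distinct (map snd (p m))"
    using inj_v[of 1] by (fastforce simp: p_def distinct_map comp_def inj_on_def)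
  ultimately have "cycle (p m)" using w m3 by (auto simp: cycle_def p_def)
  moreover have "length (p m) = m" by (simp add: p_def)
  ultimately show ?thesis by blast
qed

lemma cycles_eq: "cycles G = {cycle_edges}"
  using cycle_edges_eq cycle_exists m3 unfolding cycles_def by blast

lemma card_cycle_edges: "card cycle_edges = m"
proof -
  have "cycle_edges = (\<lambda>i. {v i, v (i + 1)}) ` {0..<int m}"
  proof (intro equalityI subsetI)
    fix E assume "E \<in> cycle_edges"
    then obtain i where "E = {v i, v (i + 1)}" by (auto simp: cycle_edges_def)
    then have "E = (\<lambda>i. {v i, v (i + 1)}) (i mod int m)" by (simp add: v_mod)
    moreover have "i mod int m \<in> {0..<int m}" using m3 by simp
    ultimately show "E \<in> (\<lambda>i. {v i, v (i + 1)}) ` {0..<int m}" by blast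
  qed (auto simp: cycle_edges_def)
  moreover have "inj_on (\<lambda>i. {v i, v (i + 1)}) {0..<int m}"
  proof (rule inj_onI)
    fix i j assume ij: "i \<in> {0..<int m}" "j \<in> {0..<int m}" "{v i, v (i + 1)} = {v j, v (j + 1)}"
    have "v i = v j"
    proof (rule ccontr)
      assume "v i \<noteq> v j"
      then have "v i = v (j + 1)" "v (i + 1) = v j" using ij(3) by (auto simp: doubleton_eq_iff)
      then have "v (j + 1 + 1) = v (i + 1)" by (metis v_mod(2) v_eq)
      then show False using \<open>v (i + 1) = v j\<close> v_step_neq[of "j + 1"] by simp
    qed
    then show "i = j" using ij inj_v[of 0] by (auto simp: inj_on_def)
  qed
  ultimately show ?thesis by (simp add: card_image)
qed

lemma unicyclic: "unicyclic G" and girth: "unicyclic_girth G = m"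
  using graph conn card_cycle_edges by (auto simp: unicyclic_def unicyclic_girth_def cycles_eq)

end

section \<open>Every unicyclic graph is a sun\<close>

lemma (in pair_wf_digraph) cycle_ConsI:
  assumes "(x, y) \<in> parcs G" "apath y q x"
  shows "cycle ((x, y) # q)"
proof -
  have "awalk x ((x, y) # q) x" "distinct (awalk_verts y q)"
    using assms by (auto simp: apath_def awalk_simps)
  then show ?thesis unfolding cycle_def by (intro exI[of _ x]) simp
qed

lemma apath_mono:
  assumes "pre_digraph.apath (with_proj H) u p w" "pverts H = pverts G" "parcs H \<subseteq> parcs G"
  shows "pre_digraph.apath (with_proj G) u p w"
  using assms
  by (auto simp: pre_digraph.apath_def pre_digraph.awalk_def cas_with_proj_eq awalk_verts_with_proj_eq)

text \<open>Take the distance to the cycle as depth and any neighbour one step closer as parent. The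
  cycle together with the parent edges forms a spanning sun \<open>H\<close>, which is connected. A
  further edge of \<open>G\<close>, closed up by a path of \<open>H\<close>, would yield a second
  cycle.\<close>

theorem unicyclic_sun:
  assumes "unicyclic G"
  obtains v par dep where "sun G (unicyclic_girth G) v par dep"
proof -
  have pg: "pair_graph G" and conn: "connected (with_proj G)" and uni: "\<exists>!C. C \<in> cycles G"
    using assms by (auto simp: unicyclic_def)
  interpret pair_graph G by (rule pg)
  interpret connected_graph G by unfold_locales (rule conn)
  obtain p where p: "cycle p" "3 \<le> length p"
    using uni unfolding cycles_def by blast
  let ?m = "length p"
  obtain v where v_eq: "\<And>i j. v i = v j \<longleftrightarrow> i mod int ?m = j mod int ?m"
    and set_p: "set p = {(v i, v (i + 1)) | i. True}"
    using cycle_sequence[OF p(1)] by blast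
  have arc_v: "(v i, v (i + 1)) \<in> parcs G" for i
    using cycle_arcs[OF p(1)] set_p by blast
  have v_in: "v i \<in> pverts G" for i using arc_v[of i] wellformed' by blast
  define dep where "dep x = (LEAST k. \<exists>i. gdist G x (v i) = k)" for x
  have dep_ex: "\<exists>i. gdist G x (v i) = dep x" for x
    unfolding dep_def by (rule LeastI_ex) blast
  have dep_le: "dep x \<le> gdist G x (v i)" for x i
    unfolding dep_def by (rule Least_le) blast
  have dep_0: "dep x = 0 \<longleftrightarrow> x \<in> range v" if "x \<in> pverts G" for x
  proof
    assume "dep x = 0"
    then obtain i where "gdist G x (v i) = 0" using dep_ex[of x] by auto
    then show "x \<in> range v" using gdist_eq_0[OF that v_in] by blast
  next
    assume "x \<in> range v"
    then show "dep x = 0" using dep_le gdist_refl[OF that] by (metis le_zero_eq rangeE)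
  qed
  have par_ex: "\<exists>w. (x, w) \<in> parcs G \<and> dep x = Suc (dep w)" if x: "x \<in> pverts G" "0 < dep x" for x
  proof -
    obtain i where i: "gdist G x (v i) = dep x" using dep_ex by blast
    then have "x \<noteq> v i" using x gdist_refl by force
    then obtain w where w: "(x, w) \<in> parcs G" "gdist G x (v i) = Suc (gdist G w (v i))"
      using gdist_closer[OF x(1) v_in] by metis
    obtain j where j: "gdist G w (v j) = dep w" using dep_ex by blast
    have "dep w \<le> gdist G w (v i)" by (rule dep_le)
    moreover have "dep x \<le> gdist G w (v j) + 1"
      using dep_le[of x j] gdist_Lip(2)[OF arcs_symmetric[OF w(1)] v_in, of j] by linarith
    ultimately show ?thesis using w i j by force
  qed
  define par where "par x = (SOME w. (x, w) \<in> parcs G \<and> dep x = Suc (dep w))" for x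
  have par: "(x, par x) \<in> parcs G" "dep x = Suc (dep (par x))" if "x \<in> pverts G" "0 < dep x" for x
    using someI_ex[OF par_ex[OF that]] by (auto simp: par_def)
  define A where "A = {(v i, v (i + 1)) | i. True} \<union> {(v (i + 1), v i) | i. True}
      \<union> {(x, par x) | x. x \<in> pverts G \<and> 0 < dep x} \<union> {(par x, x) | x. x \<in> pverts G \<and> 0 < dep x}"
  define H where "H = \<lparr> pverts = pverts G, parcs = A \<rparr>"
  have H: "pverts H = pverts G" "parcs H = A" by (simp_all add: H_def)
  have A_sym: "(x, y) \<in> A \<Longrightarrow> (y, x) \<in> A" for x y unfolding A_def by auto
  have A_sub: "A \<subseteq> parcs G"
    unfolding A_def using arc_v par(1) arcs_symmetric by blast
  interpret H: sun H ?m v par dep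
  proof
    show "parcs H = {(v i, v (i + 1)) | i. True} \<union> {(v (i + 1), v i) | i. True}
      \<union> {(x, par x) | x. x \<in> pverts H \<and> 0 < dep x} \<union> {(par x, x) | x. x \<in> pverts H \<and> 0 < dep x}"
      unfolding H A_def by (rule refl)
    show "par x \<in> pverts H" if "x \<in> pverts H" "0 < dep x" for x
      using in_arcsD2[OF par(1)[of x]] that unfolding H by simp
    show "dep x = Suc (dep (par x))" if "x \<in> pverts H" "0 < dep x" for x
      using par(2)[of x] that unfolding H by simp
    show "dep x = 0 \<longleftrightarrow> x \<in> range v" if "x \<in> pverts H" for x
      using dep_0[of x] that unfolding H by simp
    show "v i = v j \<longleftrightarrow> i mod int ?m = j mod int ?m" for i j
      by (rule v_eq)
    show "finite (pverts H)" "v i \<in> pverts H" for i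
      using pair_finite_verts v_in[of i] unfolding H by simp_all
  qed (rule p(2))
  have "parcs G \<subseteq> A"
  proof (rule subrelI, rule ccontr)
    fix x y assume xy: "(x, y) \<in> parcs G" "(x, y) \<notin> A"
    have "x \<in> pverts H" "y \<in> pverts H" using in_arcsD1[OF xy(1)] in_arcsD2[OF xy(1)] H(1) by simp_all
    then obtain q where q: "H.apath y q x"
      using H.reach[of y x] H.reachable_apath[of y x] by blast
    then have "apath y q x" using apath_mono[OF _ H(1)] H(2) A_sub by simp
    then have cyc: "cycle ((x, y) # q)" by (rule cycle_ConsI[OF xy(1)])
    \<comment> \<open>With the new arc the closed walk then has at least three arcs, as
      \<open>cycles\<close> demands. An empty \<open>q\<close> would make the arc a loop, and a
      single arc would be its reverse, which lies in \<open>A\<close>.\<close>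
    have "2 \<le> length q"
    proof (rule ccontr)
      assume "\<not> 2 \<le> length q"
      then have "q = [] \<or> (\<exists>e. q = [e])" by (cases q) (auto simp: Suc_le_eq)
      then show False
      proof
        assume "q = []"
        then have "x = y" using q by (simp add: H.apath_Nil_iff)
        then show False using no_loops'[OF xy(1)] by simp
      next
        assume "\<exists>e. q = [e]"
        then obtain e where "q = [e]" by blast
        then have "(y, x) \<in> A" using q H(2) by (cases e) (simp add: H.apath_simps)
        then show False using xy A_sym by blast
      qed
    qed
    then have "(\<lambda>(u, w). {u, w}) ` set ((x, y) # q) \<in> cycles G"
      using cyc unfolding cycles_def by fastforce
    moreover have "(\<lambda>(u, w). {u, w}) ` set p \<in> cycles G"
      using p unfolding cycles_def by fastforce
    ultimately have "(\<lambda>(u, w). {u, w}) ` set ((x, y) # q) = (\<lambda>(u, w). {u, w}) ` set p"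
      using uni by blast
    then have "{x, y} \<in> (\<lambda>(u, w). {u, w}) ` set p" by auto
    then obtain i where "{x, y} = {v i, v (i + 1)}" unfolding set_p by auto
    then have "(x, y) \<in> A" unfolding A_def by (auto simp: doubleton_eq_iff)
    then show False using xy by blast
  qed
  then have "parcs H = parcs G" using A_sub H by blast
  then have "H = G" using H by (cases G; cases H) simp
  then have sun: "sun G ?m v par dep" using H.sun_axioms by simp
  then have "unicyclic_girth G = ?m" by (rule sun.girth)
  then show ?thesis using that sun by simp
qed

section \<open>Weights of ancestor-closed vertex sets\<close>

context sun
begin

text \<open>Closure under parents ensures that the way from an outside vertex to any vertex of
  \<open>K\<close> starts with the step to the parent (\<open>gdist_outside\<close>).\<close>

definition core :: "'a set \<Rightarrow> bool" where
  "core K \<longleftrightarrow> range v \<subseteq> K \<and> K \<subseteq> pverts G \<and> (\<forall>x\<in>K. 0 < dep x \<longrightarrow> par x \<in> K)"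

text \<open>For \<open>x\<close> outside a core this is the growth of the weight when
  \<open>x\<close> joins it (\<open>weight_insert\<close>): distances count in both orders, the
  depth once. For \<open>x\<close> in \<open>K\<close> it measures how expensive \<open>x\<close> is
  as the parent of a leaf.\<close>

definition cost :: "'a set \<Rightarrow> 'a \<Rightarrow> nat" where
  "cost K x = 2 * dist_sum K x + dep x"

lemma core_range: "core (range v)"
  using v_in by (auto simp: core_def)

lemma core_finite: "core K \<Longrightarrow> finite K"
  using finite_subset[OF _ fin] by (simp add: core_def)

lemma core_card: "core K \<Longrightarrow> m \<le> card K"
  using card_mono[OF core_finite, of K "range v"] card_range_v by (simp add: core_def)

lemma core_in: "core K \<Longrightarrow> x \<in> K \<Longrightarrow> x \<in> pverts G"
  by (auto simp: core_def)

lemma core_anc: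
  assumes "core K" "x \<in> K"
  shows "anc x \<subseteq> K"
  using core_in[OF assms] assms(2)
proof (induction rule: dep_induct)
  case (step x)
  then have "par x \<in> K" using assms(1) by (simp add: core_def)
  then show ?case using step anc_step[of x] by simp
qed simp

lemma core_dep: "core K \<Longrightarrow> x \<in> pverts G - K \<Longrightarrow> 0 < dep x"
  using dep_0[of x] by (auto simp: core_def)

lemma core_anc_disjoint: "core K \<Longrightarrow> x \<notin> K \<Longrightarrow> y \<in> K \<Longrightarrow> x \<notin> anc y"
  using core_anc by blast

lemma gdist_outside:
  assumes "core K" "x \<in> pverts G - K" "y \<in> K"
  shows "gdist G x y = Suc (gdist G (par x) y)"
  using gdist_par[of x y] core_dep[OF assms(1,2)] core_in[OF assms(1,3)]
    core_anc_disjoint[OF assms(1) _ assms(3)] assms(2) by simp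

lemma dist_sum_outside:
  assumes "core K" "x \<in> pverts G - K"
  shows "dist_sum K x = dist_sum K (par x) + card K"
proof -
  have "dist_sum K x = (\<Sum>y\<in>K. gdist G (par x) y + 1)"
    unfolding dist_sum_def by (rule sum.cong[OF refl]) (simp add: gdist_outside[OF assms])
  then show ?thesis unfolding dist_sum_def by (simp only: sum.distrib sum_constant) simp
qed

lemma cost_outside:
  assumes "core K" "x \<in> pverts G - K"
  shows "cost K x = cost K (par x) + (2 * card K + 1)"
  using dist_sum_outside[OF assms] dep_par[of x] core_dep[OF assms] assms(2)
  by (simp add: cost_def)

lemma dist_sum_Un:
  "finite K \<Longrightarrow> finite L \<Longrightarrow> K \<inter> L = {} \<Longrightarrow> dist_sum (K \<union> L) x = dist_sum K x + dist_sum L x"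
  unfolding dist_sum_def by (rule sum.union_disjoint)

lemma weight_Un:
  assumes "finite K" "finite L" "K \<inter> L = {}" "K \<subseteq> pverts G" "L \<subseteq> pverts G"
  shows "weight (K \<union> L) = weight K + (\<Sum>x\<in>L. cost K x) + (\<Sum>x\<in>L. dist_sum L x)"
proof -
  have "(\<Sum>x\<in>K. dist_sum L x) = (\<Sum>x\<in>L. \<Sum>y\<in>K. gdist G y x)"
    unfolding dist_sum_def by (rule sum.swap)
  also have "\<dots> = (\<Sum>x\<in>L. dist_sum K x)"
    unfolding dist_sum_def
    by (intro sum.cong refl gdist_sym) (use assms in blast)+
  finally show ?thesis
    using assms by (simp add: weight_def sum.union_disjoint dist_sum_Un sum.distrib cost_def sum_distrib_left[symmetric])
qed

lemma weight_core:
  assumes "core K"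
  shows "weight (pverts G) = weight K + (\<Sum>x\<in>pverts G - K. cost K x)
    + (\<Sum>x\<in>pverts G - K. dist_sum (pverts G - K) x)"
proof -
  have "K \<subseteq> pverts G" using assms by (simp add: core_def)
  then have "K \<union> (pverts G - K) = pverts G" by blast
  then show ?thesis
    using weight_Un[of K "pverts G - K"] core_finite[OF assms] fin \<open>K \<subseteq> pverts G\<close> by simp
qed

lemma cost_outside_ge:
  assumes K: "core K" and \<kappa>: "\<And>w. w \<in> K \<Longrightarrow> \<kappa> \<le> cost K w" and x: "x \<in> pverts G" "x \<notin> K"
  shows "\<kappa> + (2 * card K + 1) + (if par x \<in> K then 0 else 2 * card K + 1) \<le> cost K x"
  using x
proof (induction rule: dep_induct)
  case (root i)
  then show ?case using K by (auto simp: core_def)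
next
  case (step x)
  then show ?case using cost_outside[OF K, of x] \<kappa>[of "par x"] by auto
qed

lemma gdist_outside_ge:
  assumes K: "core K" and x: "x \<in> pverts G - K" and y: "y \<in> pverts G - K"
  shows "2 \<le> gdist G x y + (if x = y then 2 else 0)
    + (if y = par x then 1 else 0) + (if x = par y then 1 else 0)"
proof (cases "x = y")
  case False
  then have "gdist G x y \<noteq> 0" using gdist_eq_0 x y by blast
  moreover have "y = par x \<or> x = par y" if "gdist G x y = 1"
  proof -
    have "(x, y) \<in> parcs G" using gdist_eq_1 that x y by blast
    then show ?thesis
      by (cases rule: arc_cases) (use core_dep[OF K x] core_dep[OF K y] in auto)
  qed
  ultimately show ?thesis by force
qed simp

lemma sum_pairs_lower:
  fixes P :: "'a \<Rightarrow> 'a"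
  assumes "finite L"
  shows "(\<Sum>x\<in>L. \<Sum>y\<in>L. (2::int) - (if x = y then 2 else 0) - (if y = P x then 1 else 0) - (if x = P y then 1 else 0))
    = 2 * int (card L) * (int (card L) - 1) - 2 * (\<Sum>x\<in>L. if P x \<in> L then 1 else 0)"
proof -
  have a: "(\<Sum>x\<in>L. \<Sum>y\<in>L. (if y = P x then 1 else (0::int))) = (\<Sum>x\<in>L. if P x \<in> L then 1 else 0)"
    using assms by simp
  have b: "(\<Sum>x\<in>L. \<Sum>y\<in>L. (if x = P y then 1 else (0::int))) = (\<Sum>x\<in>L. if P x \<in> L then 1 else 0)"
    by (subst sum.swap) (rule a)
  have c: "(\<Sum>x\<in>L. \<Sum>y\<in>L. (if x = y then 2 else (0::int))) = 2 * int (card L)"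
    using assms by simp
  show ?thesis
    unfolding sum_subtractf a b c by (simp add: algebra_simps)
qed

text \<open>
  Two vertices outside \<open>K\<close> have distance at least 2 unless one is the parent of the other, and
  then the cost of the child exceeds the minimum by more than the missing units.
\<close>

proposition weight_lower_bound:
  assumes K: "core K" and \<kappa>: "\<And>w. w \<in> K \<Longrightarrow> \<kappa> \<le> cost K w"
  defines "h \<equiv> int (card (pverts G - K))"
  defines "B \<equiv> int (weight K) + h * (int \<kappa> + 2 * int (card K) + 1) + 2 * h * (h - 1)"
  shows "B \<le> int (weight (pverts G))"
    and "int (weight (pverts G)) = B \<Longrightarrow> x \<in> pverts G - K \<Longrightarrow> par x \<in> K \<and> cost K (par x) = \<kappa>"
    and "int (weight (pverts G)) = B \<Longrightarrow> x \<in> pverts G - K \<Longrightarrow> y \<in> pverts G - K \<Longrightarrow> par x = par y"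
proof -
  let ?L = "pverts G - K"
  \<comment> \<open>\<open>s\<close> and \<open>t\<close> are the slacks in the costs and in the
    mutual distances. A parent and child outside \<open>K\<close> are at distance 1 instead of 2, in
    both orders; these two units are charged to the child, whose cost exceeds that of a vertex
    hanging on \<open>K\<close> by at least \<open>2 * card K + 1\<close>, hence by at least
    7.\<close>
  define s where "s x = int (cost K x) - (int \<kappa> + 2 * int (card K) + 1) - 2 * (if par x \<in> ?L then 1 else 0)" for x
  define t where "t x y = int (gdist G x y) - (2 - (if x = y then 2 else 0)
      - (if y = par x then 1 else 0) - (if x = par y then 1 else 0))" for x y
  have fL: "finite ?L" using fin by simp
  have "(\<Sum>x\<in>?L. s x) = (\<Sum>x\<in>?L. int (cost K x)) - h * (int \<kappa> + 2 * int (card K) + 1)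
      - 2 * (\<Sum>x\<in>?L. if par x \<in> ?L then 1 else 0)"
    unfolding s_def sum_subtractf sum_distrib_left[symmetric] by (simp add: h_def)
  moreover have "(\<Sum>x\<in>?L. \<Sum>y\<in>?L. t x y) = (\<Sum>x\<in>?L. int (dist_sum ?L x))
      - (2 * h * (h - 1) - 2 * (\<Sum>x\<in>?L. if par x \<in> ?L then 1 else 0))"
    unfolding t_def sum_subtractf[of "\<lambda>y. int (gdist G _ y)"] sum_subtractf[of "\<lambda>x. (\<Sum>y\<in>?L. int (gdist G x y))"]
      sum_pairs_lower[OF fL] by (simp add: h_def dist_sum_def)
  ultimately have split: "int (weight (pverts G)) - B = (\<Sum>x\<in>?L. s x) + (\<Sum>x\<in>?L. \<Sum>y\<in>?L. t x y)"
    unfolding B_def weight_core[OF K] by simp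
  have s_eq: "par x \<in> K \<and> s x = int (cost K (par x)) - int \<kappa> \<or> par x \<notin> K \<and> 0 < s x"
    if "x \<in> ?L" for x
    using cost_outside_ge[OF K \<kappa>, of x] cost_outside[OF K that] that core_card[OF K] m3
    by (auto simp: s_def)
  then have s_ge: "0 \<le> s x" if "x \<in> ?L" for x
    using that \<kappa> by (fastforce simp: s_def)
  have t_ge: "0 \<le> t x y" if "x \<in> ?L" "y \<in> ?L" for x y
    using gdist_outside_ge[OF K that] by (auto simp: t_def)
  have ss: "0 \<le> (\<Sum>x\<in>?L. s x)" using s_ge by (rule sum_nonneg)
  have tt: "0 \<le> (\<Sum>y\<in>?L. t x y)" if "x \<in> ?L" for x using t_ge that by (intro sum_nonneg) auto
  have ttt: "0 \<le> (\<Sum>x\<in>?L. \<Sum>y\<in>?L. t x y)" using tt by (rule sum_nonneg)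
  show "B \<le> int (weight (pverts G))" using split ss ttt by linarith
  show par: "par x \<in> K \<and> cost K (par x) = \<kappa>" if eq: "int (weight (pverts G)) = B" and x: "x \<in> ?L" for x
  proof -
    have "(\<Sum>x\<in>?L. s x) = 0" using split ss ttt eq by linarith
    then have "s x = 0" using sum_nonneg_eq_0_iff[OF fL, of s] s_ge x by blast
    then show ?thesis using s_eq[OF x] by auto
  qed
  show "par x = par y" if eq: "int (weight (pverts G)) = B" and x: "x \<in> ?L" and y: "y \<in> ?L"
  proof (cases "x = y")
    case False
    have px: "par x \<in> K" and py: "par y \<in> K" using par[OF eq] x y by auto
    have "(\<Sum>x\<in>?L. \<Sum>y\<in>?L. t x y) = 0" using split ss ttt eq by linarith
    then have "(\<Sum>y\<in>?L. t x y) = 0"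
      using sum_nonneg_eq_0_iff[OF fL, of "\<lambda>x. \<Sum>y\<in>?L. t x y"] tt x by blast
    then have "t x y = 0" using sum_nonneg_eq_0_iff[OF fL, of "t x"] t_ge x y by blast
    moreover have "y \<noteq> par x" "x \<noteq> par y" using px py x y by auto
    ultimately have d: "gdist G x y = 2" using False by (simp add: t_def)
    \<comment> \<open>Both vertices hang directly on \<open>K\<close>, so their distance 2 is
      already used up by the steps to their parents.\<close>
    have "x \<notin> anc y"
      using anc_step[of y] core_dep[OF K y] y x core_anc_disjoint[OF K _ py] False by auto
    then have "gdist G x y = Suc (gdist G (par x) y)"
      using gdist_par[of x y] core_dep[OF K x] x y by simp
    also have "gdist G (par x) y = gdist G y (par x)"
      using gdist_sym core_in[OF K px] y by blast
    also have "\<dots> = Suc (gdist G (par y) (par x))"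
      using gdist_outside[OF K y px] .
    finally have "gdist G (par y) (par x) = 0" using d by simp
    then show ?thesis using gdist_eq_0 core_in[OF K] px py by metis
  qed simp
qed

lemma gdist_siblings:
  assumes K: "core K" and w: "w \<in> K" and x: "x \<in> pverts G - K" "par x = w"
    and y: "y \<in> pverts G - K" "par y = w" and "x \<noteq> y"
  shows "gdist G x y = 2"
proof -
  have "x \<notin> anc y"
    using anc_step[of y] core_dep[OF K y(1)] y x core_anc_disjoint[OF K _ w] \<open>x \<noteq> y\<close> by auto
  then have "gdist G x y = Suc (gdist G w y)"
    using gdist_par[of x y] core_dep[OF K x(1)] x y by simp
  also have "gdist G w y = gdist G y w"
    using gdist_sym core_in[OF K w] y by blast
  also have "\<dots> = Suc (gdist G w w)"
    using gdist_outside[OF K y(1) w] y by simp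
  finally show ?thesis using core_in[OF K w] by simp
qed

text \<open>The lower bound of \<open>weight_lower_bound\<close> as an exact value, with the cost of
  the common parent in place of the minimum.\<close>

lemma weight_star:
  assumes K: "core K" and w: "w \<in> K" and star: "\<And>x. x \<in> pverts G - K \<Longrightarrow> par x = w"
  defines "h \<equiv> int (card (pverts G - K))"
  shows "int (weight (pverts G)) =
    int (weight K) + h * (int (cost K w) + 2 * int (card K) + 1) + 2 * h * (h - 1)"
proof -
  let ?L = "pverts G - K"
  have fL: "finite ?L" using fin by simp
  have "(\<Sum>x\<in>?L. int (cost K x)) = (\<Sum>x\<in>?L. int (cost K w) + 2 * int (card K) + 1)"
    by (rule sum.cong[OF refl]) (use cost_outside[OF K] star in simp)
  moreover have "(\<Sum>x\<in>?L. int (dist_sum ?L x)) = (\<Sum>x\<in>?L. 2 * (h - 1))"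
  proof (rule sum.cong[OF refl])
    fix x assume x: "x \<in> ?L"
    have "int (dist_sum ?L x) = (\<Sum>y\<in>?L. 2 - (if x = y then 2 else 0))"
      unfolding dist_sum_def of_nat_sum
    proof (rule sum.cong[OF refl])
      fix y assume y: "y \<in> ?L"
      show "int (gdist G x y) = 2 - (if x = y then 2 else 0)"
        using gdist_siblings[OF K w x star[OF x] y star[OF y]] x by auto
    qed
    also have "\<dots> = 2 * h - 2" using fL x by (simp add: sum_subtractf h_def)
    finally show "int (dist_sum ?L x) = 2 * (h - 1)" by simp
  qed
  ultimately show ?thesis unfolding weight_core[OF K] by (simp add: h_def algebra_simps)
qed

end

section \<open>Chains of ancestors\<close>

context sun
begin

text \<open>The first vertex of \<open>K\<close> on the way from \<open>y\<close> to the cycle;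
  \<open>chain\<close> collects the vertices passed before it.\<close>

definition attach :: "'a set \<Rightarrow> 'a \<Rightarrow> 'a" where
  "attach K y = (par ^^ (LEAST k. (par ^^ k) y \<in> K)) y"

definition chain :: "'a set \<Rightarrow> 'a \<Rightarrow> 'a set" where
  "chain K y = anc y - K"

definition chain_len :: "'a set \<Rightarrow> 'a \<Rightarrow> nat" where
  "chain_len K y = card (chain K y)"

lemma chain_finite [simp]: "finite (chain K y)"
  by (simp add: chain_def)

lemma attach_in: "y \<in> K \<Longrightarrow> attach K y = y"
  by (simp add: attach_def Least_eq_0)

lemma core_induct [consumes 2, case_names inside outside]:
  assumes K: "core K" and "y \<in> pverts G"
    and inside: "\<And>y. y \<in> K \<Longrightarrow> P y"
    and outside: "\<And>y. y \<in> pverts G - K \<Longrightarrow> P (par y) \<Longrightarrow> P y"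
  shows "P y"
  using assms(2)
proof (induction rule: dep_induct)
  case (root i)
  then show ?case using K inside by (auto simp: core_def)
next
  case (step x)
  then show ?case using inside outside by blast
qed

lemma reaches_core:
  assumes K: "core K" and "y \<in> pverts G"
  shows "\<exists>k. (par ^^ k) y \<in> K"
  using assms
proof (induction rule: core_induct)
  case (inside y)
  then show ?case by (intro exI[of _ 0]) simp
next
  case (outside y)
  then obtain k where "(par ^^ k) (par y) \<in> K" by blast
  then show ?case by (intro exI[of _ "Suc k"]) (simp add: funpow_swap1)
qed

lemma attach_outside:
  assumes K: "core K" and y: "y \<in> pverts G - K"
  shows "attach K y = attach K (par y)"
proof -
  obtain k where "(par ^^ k) y \<in> K" using reaches_core[OF K, of y] y by blast
  then have "(LEAST k. (par ^^ k) y \<in> K) = Suc (LEAST k. (par ^^ Suc k) y \<in> K)"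
    by (rule Least_Suc) (use y in simp)
  then show ?thesis unfolding attach_def by (simp add: funpow_swap1)
qed

lemma attach_core:
  assumes K: "core K" and "y \<in> pverts G"
  shows "attach K y \<in> K"
  using assms by (induction rule: core_induct) (simp_all add: attach_in attach_outside[OF K])

lemma chain_inside: "core K \<Longrightarrow> y \<in> K \<Longrightarrow> chain K y = {}"
  using core_anc by (auto simp: chain_def)

lemma chain_outside:
  assumes "core K" "y \<in> pverts G - K"
  shows "chain K y = insert y (chain K (par y))" "y \<notin> chain K (par y)"
  using anc_step[of y] core_dep[OF assms] notin_anc_par[of y] assms(2) by (auto simp: chain_def)

lemma chain_len_inside: "core K \<Longrightarrow> y \<in> K \<Longrightarrow> chain_len K y = 0"
  by (simp add: chain_len_def chain_inside)

lemma chain_len_outside: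
  "core K \<Longrightarrow> y \<in> pverts G - K \<Longrightarrow> chain_len K y = Suc (chain_len K (par y))"
  using chain_outside[of K y] by (simp add: chain_len_def)

lemma par_in_verts: "core K \<Longrightarrow> y \<in> pverts G - K \<Longrightarrow> par y \<in> pverts G"
  using par_in core_dep by blast

lemma dep_chain:
  assumes K: "core K" and "y \<in> pverts G"
  shows "dep y = dep (attach K y) + chain_len K y"
  using assms
proof (induction rule: core_induct)
  case (outside y)
  then show ?case
    using dep_par[of y] core_dep[OF K] attach_outside[OF K] chain_len_outside[OF K] by simp
qed (simp add: attach_in chain_len_inside[OF K])

lemma gdist_chain:
  assumes K: "core K" and "y \<in> pverts G" and w: "w \<in> K"
  shows "gdist G w y = gdist G w (attach K y) + chain_len K y"
  using assms(1,2)
proof (induction rule: core_induct)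
  case (outside y)
  have "gdist G w y = gdist G y w" "gdist G (par y) w = gdist G w (par y)"
    using gdist_sym core_in[OF K w] outside par_in_verts[OF K] by blast+
  then show ?case
    using outside gdist_outside[OF K _ w, of y] attach_outside[OF K, of y]
      chain_len_outside[OF K, of y] by simp
qed (simp add: attach_in chain_len_inside[OF K])

lemma dist_sum_attach:
  assumes K: "core K" and "y \<in> pverts G"
  shows "dist_sum K y = dist_sum K (attach K y) + chain_len K y * card K"
  using assms
proof (induction rule: core_induct)
  case (outside y)
  then show ?case
    using dist_sum_outside[OF K] attach_outside[OF K] chain_len_outside[OF K] by simp
qed (simp add: attach_in chain_len_inside[OF K])

lemma chain_elem:
  assumes "core K" "y \<in> pverts G" "x \<in> chain K y"
  shows "x \<in> pverts G - K \<and> attach K x = attach K y \<and> 1 \<le> chain_len K x \<and> chain_len K x \<le> chain_len K y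
    \<and> (chain_len K x = chain_len K y \<longrightarrow> x = y)"
  using assms
proof (induction rule: core_induct)
  case (outside y)
  show ?case
  proof (cases "x = y")
    case False
    then have "x \<in> chain K (par y)" using outside chain_outside[OF assms(1), of y] by auto
    then show ?thesis using outside attach_outside[OF assms(1), of y]
        chain_len_outside[OF assms(1), of y] by auto
  qed (use outside chain_len_outside[OF assms(1), of y] in auto)
qed (simp add: chain_inside[OF assms(1)])

lemma core_chain:
  assumes K: "core K" and y: "y \<in> pverts G"
  shows "core (K \<union> chain K y)"
  unfolding core_def
proof (intro conjI ballI impI)
  show "range v \<subseteq> K \<union> chain K y" "K \<union> chain K y \<subseteq> pverts G"
    using K chain_elem[OF K y] by (auto simp: core_def)
  fix x assume x: "x \<in> K \<union> chain K y" "0 < dep x"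
  show "par x \<in> K \<union> chain K y"
  proof (cases "x \<in> K")
    case True
    then show ?thesis using K x by (auto simp: core_def)
  next
    case False
    then have "x \<in> anc y" using x by (auto simp: chain_def)
    show ?thesis
    proof (cases "dep (par x) = 0")
      case True
      then show ?thesis using dep_0 par_in anc_subset[OF y \<open>x \<in> anc y\<close>] K by (auto simp: core_def)
    next
      case False
      then show ?thesis using anc_par_closed[OF y \<open>x \<in> anc y\<close>] by (auto simp: chain_def)
    qed
  qed
qed

lemma card_core_chain: "core K \<Longrightarrow> card (K \<union> chain K y) = card K + chain_len K y"
  unfolding chain_len_def by (rule card_Un_disjoint) (auto simp: core_finite chain_def)

lemma dist_sum_core_chain:
  "core K \<Longrightarrow> dist_sum (K \<union> chain K y) x = dist_sum K x + dist_sum (chain K y) x"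
  by (rule dist_sum_Un) (auto simp: core_finite chain_def)

lemma dist_sum_insert: "finite L \<Longrightarrow> y \<notin> L \<Longrightarrow> dist_sum (insert y L) x = gdist G x y + dist_sum L x"
  by (simp add: dist_sum_def)

lemma dist_sum_chain_inside:
  assumes K: "core K" and y: "y \<in> pverts G" and w: "w \<in> K"
  shows "real (dist_sum (chain K y) w)
    = real (chain_len K y) * real (gdist G w (attach K y)) + real (chain_len K y) * (real (chain_len K y) + 1) / 2"
  using K y
proof (induction rule: core_induct)
  case (outside y)
  then show ?case
    using gdist_chain[OF K _ w, of y] chain_outside[OF K, of y] attach_outside[OF K, of y]
      chain_len_outside[OF K, of y]
    by (simp add: dist_sum_insert field_simps)
qed (simp add: chain_inside[OF K] chain_len_inside[OF K] dist_sum_def)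

lemma gdist_chain_chain:
  assumes K: "core K" and y: "y \<in> pverts G" and x: "x \<in> chain K y"
  shows "real (gdist G x y) = real (chain_len K y) - real (chain_len K x)"
proof -
  have "x \<in> anc y" using x by (simp add: chain_def)
  then have "gdist G x y + dep x = dep y" by (rule gdist_anc[OF y])
  then show ?thesis
    using dep_chain[OF K y] dep_chain[OF K, of x] chain_elem[OF K y x] by simp
qed

lemma dist_sum_chain_end:
  assumes K: "core K" and y: "y \<in> pverts G"
  shows "real (dist_sum (chain K y) y) = real (chain_len K y) * (real (chain_len K y) - 1) / 2"
  using K y
proof (induction rule: core_induct)
  case (outside y)
  have "real (dist_sum (chain K (par y)) y) = real (dist_sum (chain K (par y)) (par y)) + real (chain_len K (par y))"
  proof -
    have "real (dist_sum (chain K (par y)) y) = (\<Sum>x\<in>chain K (par y). real (gdist G (par y) x) + 1)"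
      unfolding dist_sum_def of_nat_sum
    proof (rule sum.cong[OF refl])
      fix x assume x: "x \<in> chain K (par y)"
      then have x': "x \<in> pverts G" using chain_elem[OF K par_in_verts[OF K outside(1)]] by blast
      have "y \<notin> anc x"
        using chain_outside(2)[OF K outside(1)] x anc_trans[OF par_in_verts[OF K outside(1)], of x] outside(1)
        by (auto simp: chain_def)
      then have "gdist G y x = Suc (gdist G (par y) x)"
        using gdist_par[of y x] outside(1) core_dep[OF K outside(1)] x' by blast
      then show "real (gdist G y x) = real (gdist G (par y) x) + 1" by simp
    qed
    then show ?thesis by (simp add: sum.distrib dist_sum_def chain_len_def)
  qed
  then show ?case
    using outside chain_outside[OF K outside(1)] chain_len_outside[OF K outside(1)]
    by (simp add: dist_sum_insert field_simps)
qed (simp add: chain_inside[OF K] chain_len_inside[OF K] dist_sum_def)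

text \<open>Below height \<open>t\<close> there are \<open>t - 1\<close> chain vertices and above it
  \<open>a - t\<close>, in both directions at distances 1, 2 and so on.\<close>

lemma dist_sum_chain:
  assumes K: "core K" and y: "y \<in> pverts G" and x: "x \<in> chain K y"
  defines "a \<equiv> real (chain_len K y)" and "t \<equiv> real (chain_len K x)"
  shows "real (dist_sum (chain K y) x) = t * (t - 1) / 2 + (a - t) * (a - t + 1) / 2"
  unfolding a_def t_def
  using K y x
proof (induction rule: core_induct)
  case (outside y)
  show ?case
  proof (cases "x = y")
    case True
    then show ?thesis using dist_sum_chain_end[OF K, of y] outside by simp
  next
    case False
    then have x: "x \<in> chain K (par y)" using outside chain_outside[OF K outside(1)] by auto
    have "real (gdist G x y) = real (chain_len K y) - real (chain_len K x)"
      using gdist_chain_chain[OF K] outside by blast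
    then show ?thesis
      using outside(2)[OF x] chain_outside[OF K outside(1)] chain_len_outside[OF K outside(1)]
      by (simp add: dist_sum_insert field_simps)
  qed
qed (simp add: chain_inside[OF K])

lemma weight_insert:
  assumes K: "core K" and x: "x \<in> pverts G - K"
  shows "weight (insert x K) = weight K + cost K x"
  using weight_Un[of K "{x}"] core_finite[OF K] core_in[OF K] x by (auto simp: dist_sum_def)

text \<open>The vertices of the chain are added from the foot upwards. The one at height
  \<open>i\<close> costs what the foot costs in \<open>K\<close>, plus \<open>i\<close> times
  \<open>2 * card K + 1\<close>, plus \<open>i * (i - 1)\<close> for the chain below it; the last
  two terms sum to the quadratic and the cubic expression.\<close>

lemma weight_chain:
  assumes K: "core K" and y: "y \<in> pverts G"
  defines "a \<equiv> real (chain_len K y)"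
  shows "real (weight (K \<union> chain K y)) = real (weight K) + a * real (cost K (attach K y))
    + (2 * real (card K) + 1) * a * (a + 1) / 2 + (a - 1) * a * (a + 1) / 3"
  unfolding a_def
  using K y
proof (induction rule: core_induct)
  case (outside y)
  let ?K' = "K \<union> chain K (par y)" and ?a = "real (chain_len K (par y))"
  note py = par_in_verts[OF K outside(1)]
  have y': "y \<in> pverts G - ?K'" using outside(1) chain_outside(2)[OF K outside(1)] by blast
  have core': "core ?K'" by (rule core_chain[OF K py])
  have "real (dist_sum ?K' y) = real (dist_sum ?K' (par y)) + real (card K) + ?a"
    using dist_sum_outside[OF core' y'] card_core_chain[OF K] by simp
  also have "real (dist_sum ?K' (par y)) = real (dist_sum K (par y)) + ?a * (?a - 1) / 2"
    using dist_sum_core_chain[OF K] dist_sum_chain_end[OF K py] by simp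
  also have "real (dist_sum K (par y)) = real (dist_sum K (attach K y)) + ?a * real (card K)"
    using dist_sum_attach[OF K py] attach_outside[OF K outside(1)] by simp
  finally have D: "real (dist_sum ?K' y) = real (dist_sum K (attach K y)) + (?a + 1) * real (card K) + ?a * (?a + 1) / 2"
    by (simp add: field_simps)
  have "real (dep y) = real (dep (attach K y)) + ?a + 1"
    using dep_chain[OF K, of y] chain_len_outside[OF K outside(1)] outside(1) by simp
  with D have c: "real (cost ?K' y) = real (cost K (attach K y)) + (2 * real (card K) + 1) * (?a + 1) + ?a * (?a + 1)"
    unfolding cost_def by (simp add: field_simps)
  have "K \<union> chain K y = insert y ?K'" using chain_outside(1)[OF K outside(1)] by blast
  then have "real (weight (K \<union> chain K y)) = real (weight ?K') + real (cost ?K' y)"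
    using weight_insert[OF core' y'] by simp
  then show ?case
    using outside(2) c attach_outside[OF K outside(1)] chain_len_outside[OF K outside(1)]
    by (simp add: field_simps)
qed (simp add: chain_inside[OF K] chain_len_inside[OF K])

lemma dist_sum_range_v: "dist_sum (range v) (v i) = m div 2 * ((m + 1) div 2)"
  using sum_gdist_v by (simp add: dist_sum_def)

lemma weight_range_v: "weight (range v) = m * (m div 2 * ((m + 1) div 2))"
proof -
  have "weight (range v) = (\<Sum>x\<in>range v. m div 2 * ((m + 1) div 2))"
    unfolding weight_def by (rule sum.cong[OF refl]) (auto simp: dist_sum_range_v)
  then show ?thesis using card_range_v by simp
qed

end

section \<open>The numerical optimisation\<close>

text \<open>
  \<open>core_weight p q c a b\<close> is the weight of a cycle of length \<open>p + q\<close> with paths of lengths \<open>a\<close>, \<open>b\<close> attached at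
  distance \<open>c\<close>, and \<open>config_weight p q c a b h\<close> the weight after attaching \<open>h\<close> further pendant vertices
  at the foot of the first path. \<open>stem_weight p q e a b\<close> is the weight of the core in which
  both paths start at the end of a stem of length \<open>e\<close>.
\<close>

definition core_weight :: "real \<Rightarrow> real \<Rightarrow> real \<Rightarrow> real \<Rightarrow> real \<Rightarrow> real" where
  "core_weight p q c a b = (p + q) * (p * q) + a * (2 * (p * q)) + (2 * (p + q) + 1) * a * (a + 1) / 2
     + (a - 1) * a * (a + 1) / 3
     + b * (2 * (p * q + a * c + a * (a + 1) / 2)) + (2 * (p + q + a) + 1) * b * (b + 1) / 2
     + (b - 1) * b * (b + 1) / 3"

text \<open>The value of \<open>weight_star\<close> over the reals: a core of weight
  \<open>w\<close> with \<open>k\<close> vertices and \<open>h\<close> leaves at a vertex of cost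
  \<open>r\<close>.\<close>

definition star_weight :: "real \<Rightarrow> real \<Rightarrow> real \<Rightarrow> real \<Rightarrow> real" where
  "star_weight w k h r = w + h * (r + 2 * k + 1) + 2 * h * (h - 1)"

definition config_weight :: "real \<Rightarrow> real \<Rightarrow> real \<Rightarrow> real \<Rightarrow> real \<Rightarrow> real \<Rightarrow> real" where
  "config_weight p q c a b h = star_weight (core_weight p q c a b) (p + q + a + b) h
     (2 * (p * q + a * (a + 1) / 2 + b * c + b * (b + 1) / 2))"

definition stem_weight :: "real \<Rightarrow> real \<Rightarrow> real \<Rightarrow> real \<Rightarrow> real \<Rightarrow> real" where
  "stem_weight p q e a b = (p + q) * (p * q) + (a + e) * (2 * (p * q))
     + (2 * (p + q) + 1) * (a + e) * (a + e + 1) / 2 + (a + e - 1) * (a + e) * (a + e + 1) / 3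
     + b * (2 * (p * q + e * (p + q) + e * (e - 1) / 2 + a * (a + 1) / 2) + e)
     + (2 * (p + q + (a + e)) + 1) * b * (b + 1) / 2 + (b - 1) * b * (b + 1) / 3"

text \<open>
  The foot of the second path moves one step away from the other one, and the end of that path becomes a leaf.
\<close>

lemma config_weight_step:
  "config_weight p q c a b h - config_weight p q (c + 1) a (b - 1) (h + 1) =
    (b - 1) * (2 * (p + q) - 2 * c - 3) + 2 * a * c + 2 * h * c"
  unfolding config_weight_def core_weight_def star_weight_def by (simp add: field_simps)

text \<open>
  On the left the leaves sit at height \<open>t\<close> of the first path; on the right they sit at its foot, and
  the foot has moved up that path by \<open>t\<close>.
\<close>

lemma config_weight_shift:
  "config_weight p q c a b h + h * (t * (2 * (p + q + b - a) - 1 + 2 * t)) - config_weight p q c (a - t) (b + t) h =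
    (2 * (p + q - c) - 1) * t * (h + a - b - t)"
  unfolding config_weight_def core_weight_def star_weight_def by (simp add: field_simps)

text \<open>Of the two feet, that of the longer path is the better place for the leaves. For
  \<open>c = 0\<close> the feet coincide and the two paths may be exchanged.\<close>

lemma config_weight_swap: "config_weight p q c a b h - config_weight p q c b a h = 2 * h * c * (b - a)"
  unfolding config_weight_def core_weight_def star_weight_def by (simp add: field_simps)

text \<open>The origin of \<alpha>. With \<open>s = a + b\<close> and \<open>D = a - b\<close> one
  has \<open>4 * a * b = s^2 - D^2\<close> and \<open>2 * b = s - D\<close>, so up to a constant the
  weight is \<open>N / 4 * D^2 - h * p * D\<close> with \<open>N = 2 * (q + h) - 1\<close>.
  Completing the square gives the vertex \<open>2 * h * p / N\<close>, and \<open>q + h\<close> is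
  \<open>n - d\<close>.\<close>

lemma config_weight_antipodal_diff:
  assumes "a + b = a' + b'"
  shows "config_weight p q p a b h - config_weight p q p a' b' h
    = (2 * (q + h) - 1) * (a' * b' - a * b) + 2 * h * p * (b - b')"
proof -
  have a: "a = a' + b' - b" using assms by simp
  show ?thesis unfolding a config_weight_def core_weight_def star_weight_def by (simp add: field_simps)
qed

text \<open>Contraction of the stem: its \<open>e\<close> vertices become leaves at the common foot
  of the two paths, whence \<open>c = 0\<close>. For an integer \<open>e\<close> with
  \<open>1 \<le> e\<close> and the \<open>p\<close>, \<open>q\<close> of a cycle no term on the
  right is negative.\<close>

lemma stem_weight_diff:
  "stem_weight p q e a b - config_weight p q 0 a b e = (p + q - 3 / 2) * (e * (e - 1)) + 2 * (e * (a + b)) * (p + q - 1 / 2)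
     + (e - 1) * e * (e + 1) / 3 + (a + b) * (e * (e - 1))"
  unfolding stem_weight_def config_weight_def core_weight_def star_weight_def by (simp add: field_simps)

text \<open>Here \<open>e\<close> of the leaves are counted as vertices of the core; being adjacent
  to the foot, they raise its cost by \<open>2 * e\<close>.\<close>

lemma config_weight_add:
  "config_weight p q 0 a b (h + e) = star_weight (config_weight p q 0 a b e) (p + q + a + b + e) h
     (2 * (p * q + a * (a + 1) / 2 + b * (b + 1) / 2) + 2 * e)"
  unfolding config_weight_def star_weight_def by (simp add: field_simps)

text \<open>Iteration of \<open>config_weight_step\<close>. As long as \<open>c < p\<close> the
  factor \<open>2 * (p + q) - 2 * c - 3\<close> is positive. Strictness already comes from the first
  step, which leaves the weight unchanged if \<open>b = 1\<close> and \<open>c = 0\<close>.\<close>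

lemma config_weight_descend:
  fixes p q c a b h k :: nat
  assumes "k \<le> b" "c + k \<le> p" "1 \<le> q"
  shows "config_weight p q (c + k) a (real (b - k)) (h + k) \<le> config_weight p q c a b h"
    and "1 \<le> k \<Longrightarrow> 2 \<le> b \<or> 1 \<le> a \<and> 1 \<le> c
      \<Longrightarrow> config_weight p q (c + k) a (real (b - k)) (h + k) < config_weight p q c a b h"
proof -
  have step: "config_weight p q (c + 1) a (real (b - 1)) (h + 1) \<le> config_weight p q c a b h
      \<and> (2 \<le> b \<or> 1 \<le> a \<and> 1 \<le> c \<longrightarrow> config_weight p q (c + 1) a (real (b - 1)) (h + 1) < config_weight p q c a b h)"
    if "1 \<le> b" "c + 1 \<le> p" for b c h :: nat
  proof -
    let ?x = "2 * (real p + real q) - 2 * real c - 3"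
    have "real c + 1 \<le> real p" "1 \<le> real q" using that assms(3) by linarith+
    then have x: "0 < ?x" by simp
    have *: "config_weight p q c a b h - config_weight p q (c + 1) a (real (b - 1)) (h + 1)
        = (real b - 1) * ?x + 2 * real a * real c + 2 * real h * real c"
      using config_weight_step[of p q c a b h] that by (simp add: of_nat_diff add.commute)
    have nn: "0 \<le> (real b - 1) * ?x" "0 \<le> 2 * real a * real c" "0 \<le> 2 * real h * real c"
      using x that by (auto intro!: mult_nonneg_nonneg)
    have "0 < (real b - 1) * ?x" if "2 \<le> b" using x that by (intro mult_pos_pos) auto
    moreover have "0 < 2 * real a * real c" if "1 \<le> a \<and> 1 \<le> c" using that by simp
    ultimately show ?thesis using * nn by linarith
  qed
  have mono: "config_weight p q (c + k) a (real (b - k)) (h + k) \<le> config_weight p q c a b h"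
    if "k \<le> b" "c + k \<le> p" for k b c h :: nat
    using that
  proof (induction k arbitrary: b c h)
    case (Suc k)
    then have "config_weight p q (real (c + 1 + k)) a (real (b - 1 - k)) (real (h + 1 + k))
        \<le> config_weight p q (real (c + 1)) a (real (b - 1)) (real (h + 1))" by (intro Suc.IH) auto
    also have "\<dots> \<le> config_weight p q c a b h" using step[of b c h] Suc.prems by simp
    finally show ?case by (simp add: add_ac)
  qed simp
  show "config_weight p q (c + k) a (real (b - k)) (h + k) \<le> config_weight p q c a b h" using mono assms by blast
  assume k: "1 \<le> k" and s: "2 \<le> b \<or> 1 \<le> a \<and> 1 \<le> c"
  then obtain l where l: "k = Suc l" by (cases k) auto
  have "config_weight p q (real (c + 1 + l)) a (real (b - 1 - l)) (real (h + 1 + l))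
      \<le> config_weight p q (real (c + 1)) a (real (b - 1)) (real (h + 1))" using assms l by (intro mono) auto
  also have "\<dots> < config_weight p q c a b h" using step[of b c h] s assms l by auto
  finally show "config_weight p q (c + k) a (real (b - k)) (h + k) < config_weight p q c a b h"
    unfolding l by (simp add: add_ac)
qed

text \<open>A bound for the antipodal configurations with total path length \<open>s\<close>.
  Keeping \<open>x\<close> abstract separates the reduction to such configurations from the choice
  of the best lengths, which is made in \<open>optimum\<close>.\<close>

definition lower_value :: "nat \<Rightarrow> nat \<Rightarrow> nat \<Rightarrow> nat \<Rightarrow> real \<Rightarrow> bool" where
  "lower_value p q s h x \<longleftrightarrow> (\<forall>a b :: nat. a + b = s \<longrightarrow> x \<le> config_weight p q p a b h)"

text \<open>The exception to strictness, \<open>b = 1\<close> and \<open>c = 0\<close>, is removed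
  by exchanging the two paths: \<open>3 \<le> a + b\<close>, which will come from the diameter,
  makes the other one long enough.\<close>

lemma config_weight_below:
  fixes p q c a b h s H :: nat
  assumes x: "lower_value p q s H x" and cp: "c < p" and "1 \<le> q"
    and s: "a + b = s + (p - c)" and H: "H = h + (p - c)"
    and ab: "p - c \<le> a" "p - c \<le> b" and c0: "c = 0 \<Longrightarrow> 3 \<le> a + b"
  shows "x < config_weight p q c a b h"
proof -
  have main: "x < config_weight p q c a b h"
    if "p - c \<le> b" "2 \<le> b \<or> 1 \<le> a \<and> 1 \<le> c" "a + b = s + (p - c)" for a b
  proof -
    have "x \<le> config_weight p q p a (real (b - (p - c))) H"
      using x[unfolded lower_value_def, rule_format, of a "b - (p - c)"] that(1,3) by linarith
    also have "\<dots> < config_weight p q c a b h"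
      using config_weight_descend(2)[of "p - c" b c p q a h] that cp \<open>1 \<le> q\<close> H by (simp add: of_nat_diff)
    finally show ?thesis .
  qed
  show ?thesis
  proof (cases "2 \<le> b \<or> 1 \<le> a \<and> 1 \<le> c")
    case False
    then have c: "c = 0" using ab cp by auto
    then have "2 \<le> a" using False c0 by auto
    then have "x < config_weight p q c b a h" using s ab by (intro main) auto
    then show ?thesis using config_weight_swap[of p q c a b h] c by simp
  qed (use main ab s in blast)
qed

lemma config_weight_below_weak:
  fixes p q a b h s H :: nat
  assumes x: "lower_value p q s H x" and "1 \<le> q"
    and s: "a + b = s + p" and H: "H = h + p" and ab: "p \<le> b"
  shows "x \<le> config_weight p q 0 a b h"
proof -
  have "x \<le> config_weight p q p a (real (b - p)) H"
    using x[unfolded lower_value_def, rule_format, of a "b - p"] s ab by linarith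
  also have "\<dots> \<le> config_weight p q 0 a b h"
    using config_weight_descend(1)[of p b 0 p q a h] ab \<open>1 \<le> q\<close> H by simp
  finally show ?thesis .
qed

text \<open>
  Costs, with respect to the core of \<open>core_weight\<close>, of a vertex at height \<open>t\<close> on the path of length \<open>a\<close>
  and of a cycle vertex at distances \<open>i\<close>, \<open>j\<close> from the feet of the two paths.
\<close>

definition arm_cost :: "real \<Rightarrow> real \<Rightarrow> real \<Rightarrow> real \<Rightarrow> real \<Rightarrow> real \<Rightarrow> real" where
  "arm_cost p q c a b t = 2 * (p * q + t * (p + q) + t * (t - 1) / 2 + (a - t) * (a - t + 1) / 2
     + b * (t + c) + b * (b + 1) / 2) + t"

definition cyc_cost :: "real \<Rightarrow> real \<Rightarrow> real \<Rightarrow> real \<Rightarrow> real \<Rightarrow> real \<Rightarrow> real" where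
  "cyc_cost p q a b i j = 2 * (p * q + a * i + a * (a + 1) / 2 + b * j + b * (b + 1) / 2)"

lemma core_weight_sym: "core_weight p q c a b = core_weight p q c b a"
  unfolding core_weight_def by (simp add: field_simps)

lemma star_weight_arm:
  "star_weight (core_weight p q c a b) (p + q + a + b) h (arm_cost p q c a b t)
    = config_weight p q c a b h + h * (t * (2 * (p + q + b - a) - 1 + 2 * t))"
  unfolding config_weight_def star_weight_def arm_cost_def by (simp add: field_simps)

lemma star_weight_cyc:
  "star_weight (core_weight p q c a b) (p + q + a + b) h (cyc_cost p q a b i j)
    = config_weight p q c a b h + 2 * h * (a * i + b * j - b * c)"
  unfolding config_weight_def star_weight_def cyc_cost_def by (simp add: field_simps)

lemma cyc_foot:
  fixes a b i j c :: nat
  assumes "c \<le> i + j"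
  shows "min a b * c \<le> a * i + b * j"
proof -
  have "min a b * c \<le> min a b * i + min a b * j"
    using assms by (metis add_mult_distrib2 mult_le_mono2)
  also have "\<dots> \<le> a * i + b * j" by (intro add_mono mult_le_mono1) auto
  finally show ?thesis .
qed

text \<open>If \<open>t + b \<le> a\<close>, leaves at height \<open>t\<close> may be cheaper than
  leaves at the foot, and the comparison is with the path lengths \<open>a - t\<close> and
  \<open>b + t\<close> through \<open>config_weight_shift\<close>. Otherwise the excess over the
  foot is positive. In both cases neither length falls below \<open>min a b\<close>.\<close>

lemma arm_below:
  fixes p q c a b h t s H :: nat
  assumes x: "\<And>a' b' :: nat. a' + b' = a + b \<Longrightarrow> min a b \<le> b' \<Longrightarrow> min a b \<le> a' \<Longrightarrow> x \<le> config_weight p q c a' b' h"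
    and "c \<le> p" "1 \<le> q" "1 \<le> t" "t \<le> a" "1 \<le> h"
  shows "x < star_weight (core_weight p q c a b) (real p + q + a + b) h (arm_cost p q c a b t)"
proof (cases "t + b \<le> a")
  case True
  have "x \<le> config_weight p q c (real (a - t)) (real (b + t)) h" using True by (intro x) auto
  moreover have "real (a - t) = real a - real t" "real (b + t) = real b + real t"
    using True by (auto simp: of_nat_diff)
  moreover have "0 < (2 * (real p + q - c) - 1) * t * (real h + a - b - t)"
    using True assms by (intro mult_pos_pos) auto
  ultimately show ?thesis
    unfolding star_weight_arm using config_weight_shift[of p q c a b h t] by simp
next
  case False
  have "x \<le> config_weight p q c a b h" by (intro x) auto
  moreover have "0 < real h * (t * (2 * (real p + q + b - a) - 1 + 2 * t))"
  proof -
    have "real a + 1 \<le> real b + real t" "1 \<le> real q" "1 \<le> real t"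
      using False assms by linarith+
    then have "0 < 2 * (real p + q + b - a) - 1 + 2 * t" by simp
    then show ?thesis using assms by (intro mult_pos_pos) auto
  qed
  ultimately show ?thesis unfolding star_weight_arm by simp
qed

section \<open>The core spanned by the cycle and two vertices\<close>

locale sun_pair = sun +
  fixes x0 y0 :: 'a
  assumes x0: "x0 \<in> pverts G" and y0: "y0 \<in> pverts G"
begin

abbreviation C :: "'a set" where "C \<equiv> range v"
text \<open>\<open>p\<close> is the distance of opposite cycle vertices, and \<open>p * q\<close> is
  the sum of the distances on the cycle from any one of its vertices.\<close>

abbreviation p :: nat where "p \<equiv> m div 2"
abbreviation q :: nat where "q \<equiv> (m + 1) div 2"

definition foot :: 'a where "foot = attach C x0"
definition K1 :: "'a set" where "K1 = C \<union> chain C x0"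
text \<open>The second path is only followed until it meets the cycle or the first path.
  \<open>branch\<close> lies on the cycle exactly if there is no common stem; otherwise its height
  on the first path is the length of the stem.\<close>

definition branch :: 'a where "branch = attach K1 y0"
definition K2 :: "'a set" where "K2 = K1 \<union> chain K1 y0"
definition xlen :: nat where "xlen = chain_len C x0"
definition ylen :: nat where "ylen = chain_len K1 y0"

lemma m_nat: "m = p + q"
  by presburger

lemma m_eq: "real m = real p + real q"
  using m_nat of_nat_add by metis

lemma p_pos: "1 \<le> p" and q_pos: "1 \<le> q"
  using m3 by auto

lemma core_K1: "core K1"
  unfolding K1_def by (rule core_chain[OF core_range x0])

lemma core_K2: "core K2"
  unfolding K2_def by (rule core_chain[OF core_K1 y0])

lemma foot_in: "foot \<in> C"
  unfolding foot_def by (rule attach_core[OF core_range x0])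

lemma branch_in: "branch \<in> K1"
  unfolding branch_def by (rule attach_core[OF core_K1 y0])

lemma C_K1: "C \<subseteq> K1"
  by (auto simp: K1_def)

lemma C_verts: "w \<in> C \<Longrightarrow> w \<in> pverts G"
  using v_in by blast

lemma dist_sum_C: "w \<in> C \<Longrightarrow> real (dist_sum C w) = real p * real q"
  using dist_sum_range_v by (auto simp flip: of_nat_mult)

lemma dep_C: "w \<in> C \<Longrightarrow> dep w = 0"
  by auto

lemma card_K1: "card K1 = m + xlen"
  unfolding K1_def xlen_def using card_core_chain[OF core_range] card_range_v by simp

lemma card_K2: "card K2 = m + xlen + ylen"
  unfolding K2_def ylen_def using card_core_chain[OF core_K1] card_K1 by simp

lemma weight_K1:
  "real (weight K1) = (real p + q) * (real p * q) + real xlen * (2 * (real p * q))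
    + (2 * (real p + q) + 1) * xlen * (real xlen + 1) / 2 + (real xlen - 1) * xlen * (real xlen + 1) / 3"
proof -
  have "real (cost C foot) = 2 * (real p * q)"
    using dist_sum_C[OF foot_in] dep_C[OF foot_in] by (simp add: cost_def)
  moreover have "real (weight C) = (real p + q) * (real p * q)"
    unfolding weight_range_v of_nat_mult m_eq by (rule refl)
  ultimately show ?thesis
    using weight_chain[OF core_range x0] card_range_v m_eq
    unfolding K1_def xlen_def foot_def by simp
qed

lemma weight_K2:
  "real (weight K2) = real (weight K1) + real ylen * real (cost K1 branch)
    + (2 * (real p + q + xlen) + 1) * ylen * (real ylen + 1) / 2 + (real ylen - 1) * ylen * (real ylen + 1) / 3"
  using weight_chain[OF core_K1 y0] card_K1 m_eq
  unfolding K2_def ylen_def branch_def by simp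

lemma dist_sum_K1_C:
  assumes "w \<in> C"
  shows "real (dist_sum K1 w) = real p * q + real xlen * gdist G w foot + real xlen * (real xlen + 1) / 2"
  using dist_sum_core_chain[OF core_range, of x0 w] dist_sum_chain_inside[OF core_range x0 assms]
    dist_sum_C[OF assms] unfolding K1_def xlen_def foot_def by simp

lemma dist_sum_K1_chain:
  assumes "w \<in> chain C x0"
  defines "t \<equiv> real (chain_len C w)"
  shows "real (dist_sum K1 w) = real p * q + t * (real p + q) + t * (t - 1) / 2
    + (real xlen - t) * (real xlen - t + 1) / 2"
proof -
  have w: "w \<in> pverts G" "attach C w = foot"
    using chain_elem[OF core_range x0 assms(1)] by (auto simp: foot_def)
  have "real (dist_sum C w) = real p * q + t * (real p + q)"
    using dist_sum_attach[OF core_range w(1)] dist_sum_C[OF foot_in] w(2) card_range_v m_eq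
    by (simp add: t_def)
  then show ?thesis
    using dist_sum_core_chain[OF core_range, of x0 w] dist_sum_chain[OF core_range x0 assms(1)]
    unfolding K1_def xlen_def t_def by simp
qed

lemma gdist_chain_K1:
  assumes "w \<in> chain C x0" "u \<in> C"
  shows "gdist G w u = gdist G u foot + chain_len C w"
proof -
  have w: "w \<in> pverts G" "attach C w = foot"
    using chain_elem[OF core_range x0 assms(1)] by (auto simp: foot_def)
  then show ?thesis
    using gdist_chain[OF core_range w(1) assms(2)] gdist_sym[OF w(1) C_verts[OF assms(2)]] by simp
qed

lemma dist_sum_K2_K1:
  assumes "w \<in> K1"
  shows "real (dist_sum K2 w) = real (dist_sum K1 w) + real ylen * gdist G w branch + real ylen * (real ylen + 1) / 2"
  using dist_sum_core_chain[OF core_K1, of y0 w] dist_sum_chain_inside[OF core_K1 y0 assms]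
  unfolding K2_def ylen_def branch_def by simp

lemma dist_sum_K2_chain:
  assumes "w \<in> chain K1 y0"
  defines "t \<equiv> real (chain_len K1 w)"
  shows "real (dist_sum K2 w) = real (dist_sum K1 branch) + t * (real p + q + xlen) + t * (t - 1) / 2
    + (real ylen - t) * (real ylen - t + 1) / 2"
    and "dep w = dep branch + chain_len K1 w"
proof -
  have w: "w \<in> pverts G" "attach K1 w = branch"
    using chain_elem[OF core_K1 y0 assms(1)] by (auto simp: branch_def)
  have "real (dist_sum K1 w) = real (dist_sum K1 branch) + t * (real p + q + xlen)"
    using dist_sum_attach[OF core_K1 w(1)] w(2) card_K1 m_eq by (simp add: t_def)
  then show "real (dist_sum K2 w) = real (dist_sum K1 branch) + t * (real p + q + xlen) + t * (t - 1) / 2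
    + (real ylen - t) * (real ylen - t + 1) / 2"
    using dist_sum_core_chain[OF core_K1, of y0 w] dist_sum_chain[OF core_K1 y0 assms(1)]
    unfolding K2_def ylen_def t_def by simp
  show "dep w = dep branch + chain_len K1 w"
    using dep_chain[OF core_K1 w(1)] w(2) by simp
qed

lemma dep_chain_C: "w \<in> chain C x0 \<Longrightarrow> dep w = chain_len C w"
  using dep_chain[OF core_range, of w] chain_elem[OF core_range x0, of w] attach_core[OF core_range, of w]
  by (auto dest: dep_C)

lemma gdist_foot: "u \<in> C \<Longrightarrow> gdist G u x0 = gdist G u foot + xlen"
  using gdist_chain[OF core_range x0] unfolding foot_def xlen_def by blast

lemma gdist_branch: "w \<in> K1 \<Longrightarrow> gdist G w y0 = gdist G w branch + ylen"
  using gdist_chain[OF core_K1 y0] unfolding branch_def ylen_def by blast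

lemma x0_K1: "x0 \<in> K1"
  using x0 anc_self_iff[OF x0] dep_0[OF x0] by (auto simp: K1_def chain_def)

lemma gdist_C_le:
  assumes "u \<in> C" "w \<in> C"
  shows "gdist G u w \<le> p"
proof -
  obtain i j where ij: "u = v i" "w = v j" using assms by auto
  define k where "k = (j - i) mod int m"
  have k: "0 \<le> k" "k \<le> int m" using m3 by (auto simp: k_def intro: less_imp_le)
  have "int (gdist G u w) = cyc_dist m k"
    unfolding ij gdist_v by (rule cyc_dist_cong) (simp add: k_def)
  also have "\<dots> = min k (int m - k)" using cyc_dist_eq[OF k] m3 by simp
  also have "\<dots> \<le> int p" by presburger
  finally show ?thesis by simp
qed

lemma antipode_ex:
  assumes "w \<in> C"
  shows "\<exists>u\<in>C. gdist G u w = p"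
proof -
  obtain j where j: "w = v j" using assms by auto
  have "int (gdist G (v (j - int p)) w) = cyc_dist m (int p)"
    unfolding j gdist_v by simp
  also have "\<dots> = int p" using cyc_dist_eq[of "int p" m] m3 by (simp add: min_def)
  finally show ?thesis by (intro bexI[of _ "v (j - int p)"]) simp_all
qed

lemma cost_K2_C:
  assumes "w \<in> C"
  shows "real (cost K2 w) = 2 * (real p * q + real xlen * gdist G w foot + real xlen * (real xlen + 1) / 2
    + real ylen * gdist G w branch + real ylen * (real ylen + 1) / 2)"
  using dist_sum_K2_K1[of w] dist_sum_K1_C[OF assms] dep_C[OF assms] assms C_K1
  by (auto simp: cost_def)

lemma cost_K2_chain:
  assumes "w \<in> chain C x0"
  defines "t \<equiv> real (chain_len C w)"
  shows "real (cost K2 w) = 2 * (real p * q + t * (real p + q) + t * (t - 1) / 2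
    + (real xlen - t) * (real xlen - t + 1) / 2
    + real ylen * gdist G w branch + real ylen * (real ylen + 1) / 2) + t"
  using dist_sum_K2_K1[of w] dist_sum_K1_chain[OF assms(1)] dep_chain_C[OF assms(1)] assms
  by (simp add: cost_def K1_def)

context
  assumes branch_C: "branch \<in> C"
begin

abbreviation sep :: nat where "sep \<equiv> gdist G foot branch"

lemma sep_sym: "gdist G branch foot = sep"
  using gdist_sym C_verts foot_in branch_C by blast

lemma gdist_x0_y0: "gdist G x0 y0 = xlen + ylen + sep"
  using gdist_branch[OF x0_K1] gdist_foot[OF branch_C] gdist_sym[OF x0 C_verts[OF branch_C]] sep_sym
  by simp

lemma cost_K1_branch: "real (cost K1 branch) = 2 * (real p * q + real xlen * sep + real xlen * (real xlen + 1) / 2)"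
  using dist_sum_K1_C[OF branch_C] dep_C[OF branch_C] sep_sym by (simp add: cost_def)

lemma weight_K2_core: "real (weight K2) = core_weight p q sep xlen ylen"
  unfolding weight_K2 weight_K1 cost_K1_branch core_weight_def by (rule refl)

lemma cost_cyc: "w \<in> C \<Longrightarrow> real (cost K2 w) = cyc_cost p q xlen ylen (gdist G w foot) (gdist G w branch)"
  using cost_K2_C by (simp add: cyc_cost_def)

lemma cost_arm1: "w \<in> chain C x0 \<Longrightarrow> real (cost K2 w) = arm_cost p q sep xlen ylen (chain_len C w)"
  using cost_K2_chain gdist_chain_K1[OF _ branch_C] sep_sym by (simp add: arm_cost_def)

lemma cost_arm2:
  assumes "w \<in> chain K1 y0"
  shows "real (cost K2 w) = arm_cost p q sep ylen xlen (chain_len K1 w)"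
  using dist_sum_K2_chain[OF assms] dist_sum_K1_C[OF branch_C] sep_sym dep_C[OF branch_C]
  by (simp add: cost_def arm_cost_def algebra_simps)

lemma K2_cases:
  assumes "w \<in> K2"
  obtains "w \<in> C" | "w \<in> chain C x0" "1 \<le> chain_len C w" "chain_len C w \<le> xlen"
    | "w \<in> chain K1 y0" "1 \<le> chain_len K1 w" "chain_len K1 w \<le> ylen"
  using assms chain_elem[OF core_range x0] chain_elem[OF core_K1 y0]
  unfolding K2_def K1_def xlen_def ylen_def by blast

end

end

section \<open>Comparison of a core and its leaves with the numerical configurations\<close>

lemma stem_weight_sym: "stem_weight p q e a b = stem_weight p q e b a"
  unfolding stem_weight_def by (simp add: field_simps)

text \<open>\<open>arm_below\<close> with \<open>x\<close> taken to be the weight with leaves on the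
  path: if no admissible configuration were below it, it would be smaller than itself.\<close>

lemma arm_ex:
  fixes p q c a b h t :: nat
  assumes "c \<le> p" "1 \<le> q" "1 \<le> t" "t \<le> a" "1 \<le> h"
  shows "\<exists>a' b' :: nat. a' + b' = a + b \<and> min a b \<le> a' \<and> min a b \<le> b' \<and>
    config_weight p q c a' b' h < star_weight (core_weight p q c a b) (real p + q + a + b) h (arm_cost p q c a b t)"
proof (rule ccontr)
  assume no: "\<not> ?thesis"
  have "star_weight (core_weight p q c a b) (real p + q + a + b) h (arm_cost p q c a b t)
      < star_weight (core_weight p q c a b) (real p + q + a + b) h (arm_cost p q c a b t)"
    by (rule arm_below[OF _ assms]) (use no in force)
  then show False by simp
qed

text \<open>The last term is nonnegative by \<open>cyc_foot\<close> and its vanishing locates the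
  leaves: for \<open>a \<noteq> b\<close> at the foot of the longer path, for equal positive lengths
  anywhere on a shortest path between the feet.\<close>

lemma cyc_total:
  fixes a b i j c h :: nat
  shows "star_weight (core_weight p q c a b) (p + q + a + b) h (cyc_cost p q a b i j)
    = config_weight p q c (max a b) (min a b) h + 2 * real h * (real (a * i + b * j) - real (min a b * c))"
proof (cases "b \<le> a")
  case True
  then show ?thesis unfolding star_weight_cyc by (simp add: max_def min_def)
next
  case False
  then show ?thesis unfolding star_weight_cyc using config_weight_swap[of p q c a b h]
    by (simp add: max_def min_def algebra_simps)
qed

text \<open>First the stem is contracted. \<open>\<delta>\<close> is the excess in cost of a vertex
  at height \<open>t\<close> above the stem over the contracted foot; as in \<open>arm_below\<close>
  it may be negative, and then \<open>config_weight_shift\<close> is applied to all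
  \<open>h + e\<close> leaves.\<close>

lemma stem_below:
  fixes p q e a b h :: nat
  assumes x: "\<And>a' b' :: nat. a' + b' = a + b \<Longrightarrow> min a b \<le> b' \<Longrightarrow> x \<le> config_weight p q 0 a' b' (h + e)"
    and pos: "1 \<le> p" "1 \<le> q" "1 \<le> e" "1 \<le> a + b"
    and r: "2 * (real p * q + real a * (real a + 1) / 2 + real b * (real b + 1) / 2) + 2 * real e + \<delta> \<le> r"
    and \<delta>: "\<delta> = 0 \<or> (\<exists>t. 1 \<le> t \<and> t \<le> a \<and> \<delta> = real t * (2 * (real p + q + b - a) - 1 + 2 * t))"
  shows "x < star_weight (stem_weight p q e a b) (real p + q + a + b + e) h r"
proof -
  let ?r = "2 * (real p * q + real a * (real a + 1) / 2 + real b * (real b + 1) / 2) + 2 * real e"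
  let ?k = "real p + q + a + b + e"
  have "0 < stem_weight p q e a b - config_weight p q 0 a b e"
  proof -
    have "1 \<le> real p" "1 \<le> real q" "1 \<le> real e" "1 \<le> real a + b" using pos by linarith+
    then have "0 \<le> (real p + q - 3 / 2) * (real e * (real e - 1))"
      "0 < 2 * (real e * (real a + b)) * (real p + q - 1 / 2)"
      "0 \<le> (real e - 1) * e * (real e + 1) / 3" "0 \<le> (real a + b) * (real e * (real e - 1))"
      by (simp_all add: mult_nonneg_nonneg)
    then show ?thesis unfolding stem_weight_diff by linarith
  qed
  moreover have "star_weight (stem_weight p q e a b) ?k h r - config_weight p q 0 a b (real h + e)
      = (stem_weight p q e a b - config_weight p q 0 a b e) + h * (r - ?r)"
    unfolding config_weight_add star_weight_def by (simp add: algebra_simps)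
  moreover have "real h * \<delta> \<le> h * (r - ?r)" using r by (intro mult_left_mono) auto
  ultimately have T: "config_weight p q 0 a b (real h + e) + h * \<delta> < star_weight (stem_weight p q e a b) ?k h r"
    by linarith
  have x0: "x \<le> config_weight p q 0 a b (real h + e)" using x[of a b] by simp
  consider (up) "0 \<le> \<delta>" | (down) t where "1 \<le> t" "t \<le> a" "t + b \<le> a"
    "\<delta> = real t * (2 * (real p + q + b - a) - 1 + 2 * t)"
  proof -
    have "0 \<le> \<delta>" if "1 \<le> t" "\<not> t + b \<le> a" "\<delta> = real t * (2 * (real p + q + b - a) - 1 + 2 * t)" for t
    proof -
      have "real a \<le> real b + real t" "1 \<le> real q" "1 \<le> real t" using that pos by linarith+
      then have "0 \<le> 2 * (real p + q + b - a) - 1 + 2 * t" by simp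
      then show ?thesis using that by simp
    qed
    then show ?thesis using \<delta> that by fastforce
  qed
  then show ?thesis
  proof cases
    case up
    then show ?thesis using T x0 by (smt (verit) mult_nonneg_nonneg of_nat_0_le_iff)
  next
    case (down t)
    have "real (a - t) = real a - real t" "real (b + t) = real b + real t"
      using down by (auto simp: of_nat_diff)
    then have "x \<le> config_weight p q 0 (real a - t) (real b + t) (real h + e)"
      using x[of "a - t" "b + t"] down by simp
    moreover have "(real h + e) * \<delta> + config_weight p q 0 a b (real h + e) - config_weight p q 0 (real a - t) (real b + t) (real h + e)
        = (2 * (real p + q - 0) - 1) * t * (real h + e + a - b - t)"
      using config_weight_shift[of p q 0 a b "real h + e" t] down by simp
    \<comment> \<open>The shift identity charges \<open>\<delta>\<close> to \<open>h + e\<close>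
      leaves, but the \<open>e\<close> former stem vertices are not at height \<open>t\<close>.
      Their share \<open>e * \<delta>\<close> is taken off the gain, and what remains is still
      nonnegative.\<close>
    moreover have "(2 * (real p + q - 0) - 1) * t * (real h + e + a - b - t) - e * \<delta>
        = 2 * e * t * (real a - b - t) + (2 * (real p + q) - 1) * t * (real h + a - b - t)"
      unfolding down(4) by (simp add: algebra_simps)
    moreover have "0 \<le> 2 * e * t * (real a - b - t)" using down by (intro mult_nonneg_nonneg) auto
    moreover have "0 \<le> (2 * (real p + q) - 1) * t * (real h + a - b - t)"
      using down pos by (intro mult_nonneg_nonneg) auto
    ultimately show ?thesis using T by (simp add: distrib_right)
  qed
qed

context sun_pair
begin

definition rest :: nat where "rest = card (pverts G - K2)"

lemma card_verts: "card (pverts G) = m + xlen + ylen + rest"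
proof -
  have "K2 \<subseteq> pverts G" using core_K2 by (simp add: core_def)
  then show ?thesis
    using card_K2 card_Diff_subset[OF core_finite[OF core_K2], of "pverts G"] card_mono[OF fin, of K2]
    unfolding rest_def by linarith
qed

lemma weight_ge_total:
  obtains w where "w \<in> K2"
    and "star_weight (weight K2) (real p + q + xlen + ylen) rest (cost K2 w) \<le> weight (pverts G)"
    and "weight (pverts G) = star_weight (weight K2) (real p + q + xlen + ylen) rest (cost K2 w) \<longrightarrow>
      (\<forall>u\<in>pverts G - K2. par u \<in> K2 \<and> cost K2 (par u) = cost K2 w \<and>
        (\<forall>u'\<in>pverts G - K2. par u = par u'))"
proof -
  define w where "w = arg_min_on (cost K2) K2"
  have ne: "K2 \<noteq> {}" using branch_in by (auto simp: K2_def)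
  have w: "w \<in> K2" "\<And>u. u \<in> K2 \<Longrightarrow> cost K2 w \<le> cost K2 u"
    unfolding w_def using arg_min_if_finite(1)[OF core_finite[OF core_K2] ne]
      arg_min_least[OF core_finite[OF core_K2] ne] by blast+
  have t: "star_weight (weight K2) (real p + q + xlen + ylen) rest (cost K2 w) =
      real_of_int (int (weight K2) + int rest * (int (cost K2 w) + 2 * int (card K2) + 1) + 2 * int rest * (int rest - 1))"
    unfolding star_weight_def card_K2 using m_eq by simp
  note lb = weight_lower_bound[OF core_K2 w(2), folded rest_def]
  have "star_weight (weight K2) (real p + q + xlen + ylen) rest (cost K2 w) \<le> real_of_int (int (weight (pverts G)))"
    unfolding t of_int_le_iff by (rule lb(1))
  then have A: "star_weight (weight K2) (real p + q + xlen + ylen) rest (cost K2 w) \<le> weight (pverts G)"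
    by simp
  have B: "\<forall>u\<in>pverts G - K2. par u \<in> K2 \<and> cost K2 (par u) = cost K2 w \<and> (\<forall>u'\<in>pverts G - K2. par u = par u')"
    if "weight (pverts G) = star_weight (weight K2) (real p + q + xlen + ylen) rest (cost K2 w)"
  proof -
    have "real_of_int (int (weight (pverts G))) =
        real_of_int (int (weight K2) + int rest * (int (cost K2 w) + 2 * int (card K2) + 1) + 2 * int rest * (int rest - 1))"
      using that t by simp
    then have eq: "int (weight (pverts G)) =
        int (weight K2) + int rest * (int (cost K2 w) + 2 * int (card K2) + 1) + 2 * int rest * (int rest - 1)"
      by (simp only: of_int_eq_iff)
    show ?thesis
    proof (intro ballI conjI)
      fix u assume u: "u \<in> pverts G - K2"
      show "par u \<in> K2" "cost K2 (par u) = cost K2 w" using lb(2)[OF _ eq u] by blast+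
      show "par u = par u'" if "u' \<in> pverts G - K2" for u' by (rule lb(3)[OF _ eq u that])
    qed
  qed
  show ?thesis by (rule that[OF w(1) A]) (use B in blast)
qed

text \<open>The case without a stem, for any possible parent \<open>w\<close> of the leaves. Neither
  length of the comparison pair falls below the smaller actual one, so the bounds of
  \<open>arms_ge\<close> survive; if there are leaves, a tie is possible only for \<open>w\<close>
  on the cycle.\<close>

lemma total_ex:
  assumes branch_C: "branch \<in> C" and w: "w \<in> K2"
  defines "T \<equiv> star_weight (weight K2) (real p + q + xlen + ylen) rest (cost K2 w)"
  shows "\<exists>a b. a + b = xlen + ylen \<and> min xlen ylen \<le> a \<and> min xlen ylen \<le> b
    \<and> config_weight p q (gdist G foot branch) a b rest \<le> T
    \<and> (rest = 0 \<longrightarrow> a = xlen \<and> b = ylen)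
    \<and> (1 \<le> rest \<longrightarrow> T = config_weight p q (gdist G foot branch) a b rest \<longrightarrow> w \<in> C \<and> a = max xlen ylen \<and> b = min xlen ylen
       \<and> xlen * gdist G w foot + ylen * gdist G w branch = min xlen ylen * gdist G foot branch)"
proof (cases "rest = 0")
  case True
  then have "T = config_weight p q (gdist G foot branch) xlen ylen rest"
    unfolding T_def weight_K2_core[OF branch_C] config_weight_def star_weight_def by simp
  then show ?thesis using True by (intro exI[of _ xlen] exI[of _ ylen]) auto
next
  case False
  then have r: "1 \<le> rest" by simp
  have sep: "gdist G foot branch \<le> p" by (rule gdist_C_le[OF foot_in branch_C])
  show ?thesis
    using K2_cases[OF branch_C w]
  proof cases
    case 1
    have tri: "gdist G foot branch \<le> gdist G w foot + gdist G w branch"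
      using gdist_triangle[of foot w branch] gdist_sym[of foot w] C_verts foot_in 1 branch_C by simp
    let ?l = "xlen * gdist G w foot + ylen * gdist G w branch" and ?r = "min xlen ylen * gdist G foot branch"
    have T: "T = config_weight p q (gdist G foot branch) (max xlen ylen) (min xlen ylen) rest + 2 * real rest * (real ?l - real ?r)"
      unfolding T_def weight_K2_core[OF branch_C] cost_cyc[OF branch_C 1] by (rule cyc_total)
    have le: "?r \<le> ?l" by (rule cyc_foot[OF tri])
    then have "real ?r \<le> real ?l" by (simp only: of_nat_le_iff)
    then have nn: "0 \<le> 2 * real rest * (real ?l - real ?r)" by simp
    have eq: "?l = ?r" if "2 * real rest * (real ?l - real ?r) = 0"
    proof -
      have "real ?l = real ?r" using that False by simp
      then show ?thesis by (simp only: of_nat_eq_iff)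
    qed
    define A where "A = max xlen ylen"
    define B where "B = min xlen ylen"
    have AB: "A + B = xlen + ylen" "B \<le> A" by (simp_all add: A_def B_def max_def min_def)
    have le: "config_weight p q (gdist G foot branch) A B rest \<le> T"
      using T nn unfolding A_def B_def by linarith
    have eq': "?l = B * gdist G foot branch" if "T = config_weight p q (gdist G foot branch) A B rest"
      using T that unfolding A_def B_def by (intro eq) linarith
    show ?thesis unfolding A_def[symmetric] B_def[symmetric]
      by (intro exI[of _ A] exI[of _ B]) (use AB le eq' 1 r in simp)
  next
    case 2
    have "\<exists>a b. a + b = xlen + ylen \<and> min xlen ylen \<le> a \<and> min xlen ylen \<le> b \<and>
      config_weight p q (gdist G foot branch) a b rest < T"
      using arm_ex[OF sep q_pos 2(2,3) r] unfolding T_def weight_K2_core[OF branch_C] cost_arm1[OF branch_C 2(1)] .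
    then obtain a b where ab: "a + b = xlen + ylen" "min xlen ylen \<le> a" "min xlen ylen \<le> b"
      "config_weight p q (gdist G foot branch) a b rest < T" by (elim exE conjE)
    show ?thesis
      by (intro exI[of _ a] exI[of _ b] conjI impI) (use ab r in simp_all)
  next
    case 3
    have *: "core_weight p q (gdist G foot branch) xlen ylen = core_weight p q (gdist G foot branch) ylen xlen"
      "real p + real q + real xlen + real ylen = real p + real q + real ylen + real xlen"
      by (rule core_weight_sym) simp
    have "\<exists>a b. a + b = ylen + xlen \<and> min ylen xlen \<le> a \<and> min ylen xlen \<le> b \<and>
      config_weight p q (gdist G foot branch) a b rest < T"
      using arm_ex[OF sep q_pos 3(2,3) r]
      unfolding T_def weight_K2_core[OF branch_C] cost_arm2[OF branch_C 3(1)] * .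
    then have "\<exists>a b. a + b = xlen + ylen \<and> min xlen ylen \<le> a \<and> min xlen ylen \<le> b \<and>
      config_weight p q (gdist G foot branch) a b rest < T"
      by (simp only: add.commute min.commute)
    then obtain a b where ab: "a + b = xlen + ylen" "min xlen ylen \<le> a" "min xlen ylen \<le> b"
      "config_weight p q (gdist G foot branch) a b rest < T" by (elim exE conjE)
    show ?thesis
      by (intro exI[of _ a] exI[of _ b] conjI impI) (use ab r in simp_all)
  qed
qed

end

section \<open>Lower bound for the weight from a diametral pair\<close>

locale sun_diam = sun_pair +
  fixes s H :: nat and x :: real
  assumes far: "\<And>u w. u \<in> pverts G \<Longrightarrow> w \<in> pverts G \<Longrightarrow> gdist G u w \<le> gdist G x0 y0"
    and d3: "3 \<le> gdist G x0 y0"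
    and d_eq: "gdist G x0 y0 = m div 2 + s"
    and n_eq: "card (pverts G) = m + s + H"
    and x: "lower_value (m div 2) ((m + 1) div 2) s H x"
begin

text \<open>The cycle vertex opposite to a foot has distance \<open>p\<close> plus the path length
  from the end of that path, which is at most the diameter. Hence each path is long enough to give
  up the \<open>p - c\<close> vertices needed to bring feet at distance \<open>c\<close> into
  antipodal position.\<close>

lemma arms_ge:
  assumes branch_C: "branch \<in> C"
  shows "p \<le> ylen + gdist G foot branch" "p \<le> xlen + gdist G foot branch"
proof -
  have d: "gdist G x0 y0 = xlen + ylen + gdist G foot branch" by (rule gdist_x0_y0[OF branch_C])
  obtain u where u: "u \<in> C" "gdist G u foot = p" using antipode_ex[OF foot_in] by blast
  show "p \<le> ylen + gdist G foot branch"
    using far[OF C_verts[OF u(1)] x0] gdist_foot[OF u(1)] u(2) d by simp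
  obtain w where w: "w \<in> C" "gdist G w branch = p" using antipode_ex[OF branch_C] by blast
  then have "w \<in> K1" using C_K1 by blast
  then show "p \<le> xlen + gdist G foot branch"
    using far[OF C_verts[OF w(1)] y0] gdist_branch[of w] w(2) d by simp
qed

lemma weight_not_antipodal:
  assumes branch_C: "branch \<in> C" and c: "gdist G foot branch < p"
  shows "x < weight (pverts G)"
proof -
  let ?c = "gdist G foot branch"
  have d: "gdist G x0 y0 = xlen + ylen + ?c" by (rule gdist_x0_y0[OF branch_C])
  obtain w where w: "w \<in> K2"
    "star_weight (weight K2) (real p + q + xlen + ylen) rest (cost K2 w) \<le> weight (pverts G)"
    by (rule weight_ge_total)
  obtain a b where ab: "a + b = xlen + ylen" "min xlen ylen \<le> a" "min xlen ylen \<le> b"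
    "config_weight p q ?c a b rest \<le> star_weight (weight K2) (real p + q + xlen + ylen) rest (cost K2 w)"
    using total_ex[OF branch_C w(1)] by (elim exE conjE)
  have "x < config_weight p q ?c a b rest"
  proof (rule config_weight_below[OF x c q_pos])
    \<comment> \<open>Order and diameter fix the target: each step of a foot turns one path vertex
      into a leaf.\<close>
    show "a + b = s + (p - ?c)" using ab(1) d d_eq c by simp
    show "H = rest + (p - ?c)" using card_verts n_eq d d_eq c by simp
    show "p - ?c \<le> a" "p - ?c \<le> b" using arms_ge[OF branch_C] ab(2,3) by linarith+
    show "3 \<le> a + b" if "?c = 0" using that ab(1) d d3 by simp
  qed
  then show ?thesis using ab(4) w(2) by linarith
qed

lemma weight_antipodal:
  assumes branch_C: "branch \<in> C" and c: "gdist G foot branch = p"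
  shows "x \<le> weight (pverts G)" and "xlen + ylen = s" and "rest = H"
    and "weight (pverts G) = x \<Longrightarrow> config_weight p q p (max xlen ylen) (min xlen ylen) H = x
      \<and> (\<exists>w\<in>C. (\<forall>u\<in>pverts G - K2. par u = w) \<and>
        (H = 0 \<or> xlen * gdist G w foot + ylen * gdist G w branch = min xlen ylen * p))"
proof -
  have d: "gdist G x0 y0 = xlen + ylen + p" using gdist_x0_y0[OF branch_C] c by simp
  show s: "xlen + ylen = s" using d d_eq by simp
  show H: "rest = H" using card_verts n_eq s by simp
  let ?T = "\<lambda>w. star_weight (weight K2) (real p + q + xlen + ylen) rest (cost K2 w)"
  obtain w where w: "w \<in> K2" "?T w \<le> weight (pverts G)"
    and eq: "weight (pverts G) = ?T w \<longrightarrow> (\<forall>u\<in>pverts G - K2. par u \<in> K2 \<and> cost K2 (par u) = cost K2 w \<and>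
        (\<forall>u'\<in>pverts G - K2. par u = par u'))"
    by (rule weight_ge_total)
  have x_le: "x \<le> config_weight p q p a b H" if "a + b = xlen + ylen" for a b :: nat
    using x s that by (simp add: lower_value_def)
  note ex = total_ex[OF branch_C, unfolded c H]
  obtain a b where ab: "a + b = xlen + ylen"
    "config_weight p q p a b H \<le> star_weight (weight K2) (real p + q + xlen + ylen) H (cost K2 w)"
    "H = 0 \<longrightarrow> a = xlen \<and> b = ylen"
    using ex[OF w(1)] by (elim exE conjE)
  show "x \<le> weight (pverts G)" using x_le[OF ab(1)] ab(2) w(2) H by simp
  assume wx: "weight (pverts G) = x"
  have T: "star_weight (weight K2) (real p + q + xlen + ylen) H (cost K2 w) = x" "config_weight p q p a b H = x"
    using x_le[OF ab(1)] ab(2) w(2) H wx by simp_all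
  have eq: "\<forall>u\<in>pverts G - K2. par u \<in> K2 \<and> cost K2 (par u) = cost K2 w \<and>
        (\<forall>u'\<in>pverts G - K2. par u = par u')"
    by (rule eq[THEN mp]) (use wx T H in simp)
  show "config_weight p q p (max xlen ylen) (min xlen ylen) H = x
      \<and> (\<exists>w\<in>C. (\<forall>u\<in>pverts G - K2. par u = w) \<and>
        (H = 0 \<or> xlen * gdist G w foot + ylen * gdist G w branch = min xlen ylen * p))"
  proof (cases "H = 0")
    case True
    have "finite (pverts G - K2)" using fin by simp
    then have "pverts G - K2 = {}" using H True unfolding rest_def by simp
    moreover have "config_weight p q p (max xlen ylen) (min xlen ylen) H = x"
      using T(2) ab(3) True config_weight_swap[of p q p xlen ylen 0] by (cases "xlen \<le> ylen") auto
    ultimately show ?thesis using True foot_in by blast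
  next
    case False
    then have "pverts G - K2 \<noteq> {}" using H unfolding rest_def by (metis card.empty)
    then obtain u where u: "u \<in> pverts G - K2" by blast
    then have pu: "par u \<in> K2" "cost K2 (par u) = cost K2 w" "\<forall>u'\<in>pverts G - K2. par u = par u'"
      using eq by blast+
    \<comment> \<open>The common parent of the leaves has the same minimal cost as \<open>w\<close>,
      so the tie condition of \<open>total_ex\<close> may be applied to it and locates it.\<close>
    obtain a' b' where ab': "a' + b' = xlen + ylen"
      "config_weight p q p a' b' H \<le> star_weight (weight K2) (real p + q + xlen + ylen) H (cost K2 (par u))"
      "1 \<le> H \<longrightarrow> star_weight (weight K2) (real p + q + xlen + ylen) H (cost K2 (par u)) = config_weight p q p a' b' H \<longrightarrow>
        par u \<in> C \<and> a' = max xlen ylen \<and> b' = min xlen ylen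
         \<and> xlen * gdist G (par u) foot + ylen * gdist G (par u) branch = min xlen ylen * p"
      using ex[OF pu(1)] by (elim exE conjE)
    have "config_weight p q p a' b' H = x"
      using x_le[OF ab'(1)] ab'(2) T(1) pu(2) by simp
    moreover have "par u \<in> C \<and> a' = max xlen ylen \<and> b' = min xlen ylen
         \<and> xlen * gdist G (par u) foot + ylen * gdist G (par u) branch = min xlen ylen * p"
      using ab'(3) False T(1) pu(2) calculation by simp
    ultimately show ?thesis using pu(3) by (intro conjI bexI[of _ "par u"]) auto
  qed
qed

lemma gdist_dep: "u \<in> pverts G \<Longrightarrow> w \<in> pverts G \<Longrightarrow> \<bar>int (dep u) - int (dep w)\<bar> \<le> int (gdist G u w)"
proof -
  assume uw: "u \<in> pverts G" "w \<in> pverts G"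
  have "int (dep w) - int (dep u) \<le> int (gdist G u w)" if "u \<in> pverts G" "w \<in> pverts G" for u w
  proof (rule gdist_ge_lipschitz)
    fix a b assume "(a, b) \<in> parcs G"
    then show "int (dep b) - int (dep a) \<le> 1"
      by (cases rule: arc_cases) (auto dest: dep_par)
  qed (use that in auto)
  from this[OF uw] this[OF uw(2,1)] gdist_sym[OF uw] show ?thesis by linarith
qed

end

text \<open>A parent on the stem costs at least as much as the foot after contraction. The last
  assumption carries the integrality of \<open>e - \<tau>\<close> over to the reals; it yields
  \<open>u \<le> u * u\<close>.\<close>

lemma stem_cost:
  fixes p q a b e \<tau> g :: real
  assumes "3 \<le> p + q" "1 \<le> \<tau>" "\<tau> \<le> e" "0 \<le> a" "0 \<le> b" "0 \<le> g" "e - \<tau> = 0 \<or> 1 \<le> e - \<tau>"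
  shows "2 * (p * q + a * (a + 1) / 2 + b * (b + 1) / 2) + 2 * e
    \<le> 2 * (p * q + \<tau> * (p + q) + \<tau> * (\<tau> - 1) / 2 + (a + e - \<tau>) * (a + e - \<tau> + 1) / 2 + b * g + b * (b + 1) / 2) + \<tau>"
proof -
  define u where "u = e - \<tau>"
  have e: "e = u + \<tau>" and u: "0 \<le> u" using assms by (simp_all add: u_def)
  have "\<tau> * 1 \<le> \<tau> * (p + q)" using assms by (intro mult_left_mono) auto
  moreover have "0 \<le> \<tau> * (\<tau> - 1)" "0 \<le> b * g" "0 \<le> u * a" using assms u by simp_all
  moreover have "u \<le> u * u" using assms(7) u mult_left_mono[of 1 u u] unfolding u_def[symmetric] by auto
  moreover have "(a + e - \<tau>) * (a + e - \<tau> + 1) = a * (a + 1) + 2 * (u * a) + u * u + u"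
    unfolding e by (simp add: algebra_simps)
  ultimately show ?thesis using assms(2) e unfolding distrib_left[of 2] by linarith
qed

context sun_diam
begin

text \<open>With the stem removed, both paths have length at least \<open>p\<close>: otherwise the
  cycle vertex opposite to the foot would be too far from one of their ends. So after contraction to
  \<open>c = 0\<close>, \<open>p\<close> vertices of a path can be spent on moving the feet
  apart.\<close>

lemma weight_stem:
  assumes branch: "branch \<notin> C"
  shows "x < weight (pverts G)"
proof -
  have bc: "branch \<in> chain C x0" using branch branch_in by (auto simp: K1_def)
  note bel = chain_elem[OF core_range x0 bc]
  define e where "e = chain_len C branch"
  define a where "a = xlen - e"
  have e: "1 \<le> e" "xlen = a + e" using bel by (auto simp: e_def a_def xlen_def)
  have bV: "branch \<in> pverts G" using bel by blast
  have dep_b: "dep branch = e" using dep_chain_C[OF bc] by (simp add: e_def)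
  have real_x: "real xlen = real a + real e" using e by simp
  have x0_len: "x0 \<in> chain C x0"
    using bc x0 anc_self_iff[OF x0] dep_0[OF x0] by (cases "dep x0 = 0") (auto simp: chain_def)
  have g_x0: "gdist G x0 branch = a"
  proof -
    have "gdist G branch x0 + dep branch = dep x0" using bc gdist_anc[OF x0] by (auto simp: chain_def)
    then show ?thesis using dep_b dep_chain_C[OF x0_len] e gdist_sym[OF x0 bV] by (simp add: xlen_def)
  qed
  then have d: "gdist G x0 y0 = a + ylen" using gdist_branch[OF x0_K1] by simp
  have g_C: "gdist G u branch = gdist G u foot + e" if "u \<in> C" for u
    using gdist_chain_K1[OF bc that] gdist_sym[OF bV C_verts[OF that]] by (simp add: e_def)
  obtain u where u: "u \<in> C" "gdist G u foot = p" using antipode_ex[OF foot_in] by blast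
  have "p + xlen \<le> a + ylen" using far[OF C_verts[OF u(1)] x0] gdist_foot[OF u(1)] u(2) d by simp
  then have b_ge: "p \<le> ylen" using e by simp
  have "u \<in> K1" using u C_K1 by blast
  then have "p + e + ylen \<le> a + ylen"
    using far[OF C_verts[OF u(1)] y0] gdist_branch[of u] g_C[OF u(1)] u(2) d by simp
  then have a_ge: "p \<le> a" by simp
  have s: "a + ylen = s + p" using d d_eq by simp
  have H: "H = (rest + e) + p" using card_verts n_eq s e by simp
  have D1: "real (dist_sum K1 branch) = real p * q + real e * (real p + q) + real e * (real e - 1) / 2 + real a * (real a + 1) / 2"
    using dist_sum_K1_chain[OF bc] real_x unfolding e_def[symmetric] by simp
  have wK2: "real (weight K2) = stem_weight p q e a ylen"
    unfolding weight_K2 weight_K1 real_x stem_weight_def cost_def using D1 dep_b by simp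
  \<comment> \<open>The cost of the common foot after contraction, with the \<open>e\<close> stem
    vertices hanging on it as leaves.\<close>
  define r where "r = 2 * (real p * q + real a * (real a + 1) / 2 + real ylen * (real ylen + 1) / 2) + 2 * real e"
  have pq3: "3 \<le> real p + real q" using m3 m_eq by simp
  have cost_low: "r \<le> cost K2 w \<or>
      (\<exists>t. 1 \<le> t \<and> t \<le> a \<and> r + real t * (2 * (real p + q + ylen - a) - 1 + 2 * t) \<le> cost K2 w) \<or>
      (\<exists>t. 1 \<le> t \<and> t \<le> ylen \<and> r + real t * (2 * (real p + q + a - ylen) - 1 + 2 * t) \<le> cost K2 w)"
    if w: "w \<in> K2" for w
  proof -
    consider "w \<in> C" | "w \<in> chain C x0" | "w \<in> chain K1 y0"
      using w unfolding K2_def K1_def by blast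
    then show ?thesis
    proof cases
      case 1
      have "real (cost K2 w) = 2 * (real p * q + (real a + e) * gdist G w foot + (real a + e) * (real a + e + 1) / 2
          + real ylen * (real (gdist G w foot) + e) + real ylen * (real ylen + 1) / 2)"
        using cost_K2_C[OF 1] g_C[OF 1] real_x by simp
      moreover have "0 \<le> (real a + e) * gdist G w foot" "0 \<le> real ylen * (real (gdist G w foot) + e)"
        by simp_all
      moreover have "real a * (real a + 1) + 2 * real e \<le> (real a + e) * (real a + e + 1)"
      proof -
        have "real e * 1 \<le> real e * e" using e by (intro mult_left_mono) auto
        moreover have "0 \<le> real a * e" by simp
        moreover have "(real a + e) * (real a + e + 1) = real a * (real a + 1) + 2 * (real a * e) + real e * e + e"
          by (simp add: algebra_simps)
        ultimately show ?thesis by linarith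
      qed
      ultimately have "r \<le> cost K2 w" unfolding r_def distrib_left[of 2] by linarith
      then show ?thesis by simp
    next
      case 2
      define \<tau> where "\<tau> = chain_len C w"
      note wel = chain_elem[OF core_range x0 2]
      have \<tau>: "1 \<le> \<tau>" "\<tau> \<le> xlen" using wel by (auto simp: \<tau>_def xlen_def)
      have g: "\<bar>int \<tau> - int e\<bar> \<le> int (gdist G w branch)"
        using gdist_dep[of w branch] wel bV dep_b dep_chain_C[OF 2] by (simp add: \<tau>_def)
      have c: "real (cost K2 w) = 2 * (real p * q + \<tau> * (real p + q) + \<tau> * (real \<tau> - 1) / 2
          + (real a + e - \<tau>) * (real a + e - \<tau> + 1) / 2
          + real ylen * gdist G w branch + real ylen * (real ylen + 1) / 2) + \<tau>"
        using cost_K2_chain[OF 2] real_x by (simp add: \<tau>_def)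
      show ?thesis
      proof (cases "\<tau> \<le> e")
        case True
        then have "r \<le> cost K2 w" unfolding r_def c
          by (intro stem_cost pq3) (use \<tau> in auto)
        then show ?thesis by simp
      next
        case False
        define t where "t = \<tau> - e"
        have t: "\<tau> = e + t" "1 \<le> t" "t \<le> a" "t \<le> gdist G w branch"
          using False \<tau> g e by (auto simp: t_def)
        have "real ylen * t \<le> real ylen * gdist G w branch" using t by (intro mult_left_mono) auto
        moreover have "real e * 1 \<le> real e * (real p + q)" "real e * 1 \<le> real e * e"
          using pq3 e by (auto intro!: mult_left_mono)
        moreover have "real e * 1 \<le> real e * t" using t by (intro mult_left_mono) auto
        ultimately have "r + real t * (2 * (real p + q + ylen - a) - 1 + 2 * t) \<le> cost K2 w"
          unfolding r_def c t(1) by (simp add: field_simps)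
        then show ?thesis using t by blast
      qed
    next
      case 3
      note wel = chain_elem[OF core_K1 y0 3]
      define t where "t = chain_len K1 w"
      have t: "1 \<le> t" "t \<le> ylen" using wel by (auto simp: t_def ylen_def)
      have "real (cost K2 w) = 2 * (real (dist_sum K1 branch) + t * (real p + q + (a + e)) + t * (real t - 1) / 2
          + (real ylen - t) * (real ylen - t + 1) / 2) + e + t"
        using dist_sum_K2_chain[OF 3] real_x dep_b by (simp add: cost_def t_def)
      moreover have "real e * 1 \<le> real e * (real p + q)" "real e * 1 \<le> real e * e"
        using pq3 e by (auto intro!: mult_left_mono)
      moreover have "real e * 1 \<le> real e * t" using t by (intro mult_left_mono) auto
      ultimately have "r + real t * (2 * (real p + q + a - ylen) - 1 + 2 * t) \<le> cost K2 w"
        unfolding r_def D1 by (simp add: field_simps)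
      then show ?thesis using t by blast
    qed
  qed
  obtain w where w: "w \<in> K2"
    "star_weight (weight K2) (real p + q + xlen + ylen) rest (cost K2 w) \<le> weight (pverts G)"
    by (rule weight_ge_total)
  have k: "real p + q + xlen + ylen = real p + q + a + ylen + e"
    "real p + q + xlen + ylen = real p + q + ylen + a + e" using real_x by simp_all
  have x_le: "x \<le> config_weight p q 0 a' b' (rest + e)" if "a' + b' = a + ylen" "min a ylen \<le> b'" for a' b' :: nat
    using config_weight_below_weak[OF x q_pos _ H, of a' b'] that s a_ge b_ge by simp
  have pos: "1 \<le> a + ylen" using a_ge p_pos by simp
  have "x < star_weight (weight K2) (real p + q + xlen + ylen) rest (cost K2 w)"
    using cost_low[OF w(1)]
  proof (elim disjE exE conjE)
    assume "r \<le> cost K2 w"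
    then show ?thesis unfolding wK2 k(1)
      by (intro stem_below[where \<delta> = 0] x_le p_pos q_pos e(1) pos) (simp_all add: r_def)
  next
    fix t assume "1 \<le> t" "t \<le> a" "r + real t * (2 * (real p + q + ylen - a) - 1 + 2 * t) \<le> cost K2 w"
    then show ?thesis unfolding wK2 k(1)
      by (intro stem_below[where \<delta> = "real t * (2 * (real p + q + ylen - a) - 1 + 2 * t)"] x_le p_pos q_pos e(1) pos)
        (auto simp: r_def)
  next
    fix t assume "1 \<le> t" "t \<le> ylen" "r + real t * (2 * (real p + q + a - ylen) - 1 + 2 * t) \<le> cost K2 w"
    then show ?thesis unfolding wK2 k(2) stem_weight_sym[of p q e a ylen]
      by (intro stem_below[where \<delta> = "real t * (2 * (real p + q + a - ylen) - 1 + 2 * t)"] p_pos q_pos e(1))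
        (use pos x_le in \<open>auto simp: r_def add.commute min.commute\<close>)
  qed
  then show ?thesis using w(2) by linarith
qed

proposition weight_ge: "x \<le> weight (pverts G)"
  and weight_eqD: "weight (pverts G) = x \<Longrightarrow> branch \<in> C \<and> gdist G foot branch = p \<and> xlen + ylen = s \<and> rest = H
    \<and> config_weight p q p (max xlen ylen) (min xlen ylen) H = x
    \<and> (\<exists>w\<in>C. (\<forall>u\<in>pverts G - K2. par u = w) \<and>
        (H = 0 \<or> xlen * gdist G w foot + ylen * gdist G w branch = min xlen ylen * p))"
proof -
  have strict: "x < weight (pverts G)" if "\<not> (branch \<in> C \<and> gdist G foot branch = p)"
    using that weight_stem weight_not_antipodal gdist_C_le[OF foot_in] by (meson le_neq_implies_less)
  show "x \<le> weight (pverts G)"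
    using strict weight_antipodal(1) by fastforce
  assume eq: "weight (pverts G) = x"
  then have b: "branch \<in> C" "gdist G foot branch = p" using strict by auto
  show "branch \<in> C \<and> gdist G foot branch = p \<and> xlen + ylen = s \<and> rest = H
    \<and> config_weight p q p (max xlen ylen) (min xlen ylen) H = x
    \<and> (\<exists>w\<in>C. (\<forall>u\<in>pverts G - K2. par u = w) \<and>
        (H = 0 \<or> xlen * gdist G w foot + ylen * gdist G w branch = min xlen ylen * p))"
    using b weight_antipodal(2-3)[OF b] weight_antipodal(4)[OF b eq] by (intro conjI) simp_all
qed

end

section \<open>Feet and path lengths as roots and depths; antipodal configurations\<close>

context sun
begin

lemma root_attach:
  assumes K: "core K" and "y \<in> pverts G"
  shows "root (attach K y) = root y"
  using assms
proof (induction rule: core_induct)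
  case (outside y)
  then show ?case using attach_outside[OF K] root_par[of y] core_dep[OF K] by simp
qed (simp add: attach_in)

lemma attach_range_v: "y \<in> pverts G \<Longrightarrow> attach (range v) y = root y"
  using root_attach[OF core_range, of y] attach_core[OF core_range, of y] by auto

lemma root_self: "y \<in> pverts G \<Longrightarrow> dep y = 0 \<Longrightarrow> root y = y"
  by (simp add: root_def)

lemma attach_anc:
  assumes K: "core K" and "y \<in> pverts G"
  shows "attach K y \<in> insert (root y) (anc y)"
  using assms
proof (induction rule: core_induct)
  case (inside y)
  then show ?case
    using attach_in[of y K] core_in[OF K] anc_self_iff[of y] root_self[of y] by auto
next
  case (outside y)
  then show ?case
    using attach_outside[OF K] anc_step[of y] root_par[of y] core_dep[OF K] by auto
qed

lemma root_anc:
  assumes "y \<in> pverts G" "x \<in> anc y"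
  shows "root x = root y"
  using assms
proof (induction rule: dep_induct)
  case (step y)
  then show ?case using anc_step[of y] root_par[of y] by auto
qed simp

end

context sun_pair
begin

lemma foot_root: "foot = root x0"
  unfolding foot_def by (rule attach_range_v[OF x0])

lemma xlen_dep: "xlen = dep x0"
  using dep_chain[OF core_range x0] dep_C[OF foot_in] unfolding xlen_def foot_def by simp

lemma branch_root: "branch \<in> C \<Longrightarrow> branch = root y0"
  using root_attach[OF core_K1 y0] unfolding branch_def[symmetric] by auto

lemma ylen_dep: "branch \<in> C \<Longrightarrow> ylen = dep y0"
  using dep_chain[OF core_K1 y0] dep_C[of branch] unfolding ylen_def branch_def[symmetric] by simp

lemma K2_anc: "K2 = C \<union> anc x0 \<union> anc y0"
  unfolding K2_def K1_def chain_def by blast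

text \<open>Off the cycle the branch vertex would be an ancestor of both ends, which would then have
  the same root.\<close>

lemma branch_antipodal:
  assumes "gdist G (root x0) (root y0) = p"
  shows "branch \<in> C"
proof (rule ccontr)
  assume n: "branch \<notin> C"
  have "branch \<in> anc x0" using branch_in n by (auto simp: K1_def chain_def)
  then have rx: "root branch = root x0" by (rule root_anc[OF x0])
  have "branch = root y0 \<or> branch \<in> anc y0"
    using attach_anc[OF core_K1 y0] unfolding branch_def by blast
  then have "branch \<in> anc y0" using n root_range[OF y0] by auto
  then have "root branch = root y0" by (rule root_anc[OF y0])
  then have "gdist G (root x0) (root y0) = 0" using rx root_in[OF x0] by simp
  then show False using assms p_pos by simp
qed

end

text \<open>The shape of the extremal graphs described inside a sun, without any numbering of
  vertices. For this shape weight and diameter are computed exactly.\<close>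

locale antipodal = sun_pair +
  fixes w0 :: 'a
  assumes anti: "gdist G (root x0) (root y0) = m div 2"
    and w0: "w0 \<in> range v"
    and star: "\<And>u. u \<in> pverts G - (range v \<union> anc x0 \<union> anc y0) \<Longrightarrow> par u = w0"
begin

lemma branch_C: "branch \<in> C"
  by (rule branch_antipodal[OF anti])

lemma sep_p: "gdist G foot branch = p"
  using anti foot_root branch_root[OF branch_C] by simp

lemma weight_antipodal_eq:
  "real (weight (pverts G)) = config_weight p q p (max (dep x0) (dep y0)) (min (dep x0) (dep y0)) rest
    + 2 * real rest * (real (dep x0 * gdist G w0 (root x0) + dep y0 * gdist G w0 (root y0))
      - real (min (dep x0) (dep y0) * p))"
proof -
  have "w0 \<in> K2" using w0 by (simp add: K2_anc)
  then have "int (weight (pverts G)) = int (weight K2)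
    + int rest * (int (cost K2 w0) + 2 * int (card K2) + 1) + 2 * int rest * (int rest - 1)"
    unfolding rest_def using star by (intro weight_star[OF core_K2]) (auto simp: K2_anc)
  then have "real_of_int (int (weight (pverts G))) = real_of_int (int (weight K2)
    + int rest * (int (cost K2 w0) + 2 * int (card K2) + 1) + 2 * int rest * (int rest - 1))"
    by (simp only:)
  then have "real (weight (pverts G)) = star_weight (weight K2) (real p + q + xlen + ylen) rest (cost K2 w0)"
    unfolding star_weight_def card_K2 using m_eq by simp
  also have "\<dots> = star_weight (core_weight p q p xlen ylen) (real p + q + xlen + ylen) rest
      (cyc_cost p q xlen ylen (gdist G w0 foot) (gdist G w0 branch))"
    unfolding weight_K2_core[OF branch_C] cost_cyc[OF branch_C w0] sep_p by (rule refl)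
  also have "\<dots> = config_weight p q p (max xlen ylen) (min xlen ylen) rest
    + 2 * real rest * (real (xlen * gdist G w0 foot + ylen * gdist G w0 branch) - real (min xlen ylen * p))"
    by (rule cyc_total)
  finally show ?thesis
    unfolding xlen_dep ylen_dep[OF branch_C] foot_root branch_root[OF branch_C] .
qed

lemma card_antipodal: "card (pverts G) = m + dep x0 + dep y0 + rest"
  using card_verts xlen_dep ylen_dep[OF branch_C] by simp

lemma vertex_cases [consumes 1]:
  assumes "u \<in> pverts G"
  obtains (cyc) "u \<in> C" | (arm1) "u \<in> anc x0" | (arm2) "u \<in> anc y0"
    | (leaf) "dep u = 1" "root u = w0"
proof -
  have "dep u = 1 \<and> root u = w0" if "u \<in> pverts G - (C \<union> anc x0 \<union> anc y0)"
  proof -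
    have "par u = w0" "dep u = Suc (dep (par u))" "root (par u) = root u"
      using star[OF that] dep_par[of u] root_par[of u] off_cycle[of u] that by auto
    moreover have "dep w0 = 0" "root w0 = w0" using w0 by auto
    ultimately show ?thesis by simp
  qed
  then show ?thesis using that assms by blast
qed

lemma gdist_via_roots:
  assumes "u \<in> pverts G" "w \<in> pverts G"
  shows "gdist G u w \<le> dep u + gdist G (root u) (root w) + dep w"
proof -
  note r = root_in[OF assms(1)] root_in[OF assms(2)]
  have "gdist G u w \<le> gdist G u (root u) + (gdist G (root u) (root w) + gdist G (root w) w)"
    using gdist_triangle[OF assms(1) r(1) assms(2)] gdist_triangle[OF r assms(2)] by linarith
  then show ?thesis
    using gdist_dep_root[OF assms(1)] gdist_dep_root[OF assms(2)] gdist_sym[OF assms(1) r(1)] by simp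
qed

lemma gdist_same_anc:
  assumes "y \<in> pverts G" "u \<in> anc y" "w \<in> anc y"
  shows "gdist G u w \<le> dep y"
proof -
  have V: "u \<in> pverts G" "w \<in> pverts G" and l: "dep u \<le> dep y" "dep w \<le> dep y"
    using anc_subset[OF assms(1)] assms(2,3) by blast+
  have "u \<in> anc w \<or> w \<in> anc u" using assms
  proof (induction rule: dep_induct)
    case (step y)
    show ?case
    proof (cases "u = y \<or> w = y")
      case True
      then show ?thesis using step by blast
    next
      case False
      then show ?thesis using step anc_step[of y] by blast
    qed
  qed simp
  then show ?thesis
    using gdist_anc[OF V(2), of u] gdist_anc[OF V(1), of w] gdist_sym[OF V] l by fastforce
qed

text \<open>The assumption on \<open>w0\<close> keeps the leaves within the required distance of
  \<open>x0\<close>. For \<open>y0\<close> this follows from \<open>1 \<le> dep x0\<close>, and two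
  leaves are at distance at most 2.\<close>

lemma diameter:
  assumes le: "dep y0 \<le> dep x0" "1 \<le> dep x0" "3 \<le> dep x0 + dep y0 + p"
    and w: "gdist G w0 (root x0) + 1 \<le> p + dep y0"
  shows "u \<in> pverts G \<Longrightarrow> w \<in> pverts G \<Longrightarrow> gdist G u w \<le> dep x0 + dep y0 + p"
    and "gdist G x0 y0 = dep x0 + dep y0 + p"
proof -
  show d: "gdist G x0 y0 = dep x0 + dep y0 + p"
    using gdist_x0_y0[OF branch_C] sep_p xlen_dep ylen_dep[OF branch_C] by simp
  have C_root: "root u = u \<and> dep u = 0" if "u \<in> C" for u using that by auto
  have rC: "root u \<in> C" if "u \<in> pverts G" for u by (rule root_range[OF that])
  have w0V: "w0 \<in> pverts G" using w0 C_verts by blast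
  have g_p: "gdist G (root u) (root w) \<le> p" if "u \<in> pverts G" "w \<in> pverts G" for u w
    by (rule gdist_C_le[OF rC[OF that(1)] rC[OF that(2)]])
  have arm: "root u = root y" "dep u \<le> dep y" if "u \<in> anc y" "y \<in> pverts G" for u y
    using root_anc[OF that(2,1)] anc_subset[OF that(2,1)] by auto
  \<comment> \<open>\<open>o\<close> lists the combinations of vertex types in one order; the others
    follow by symmetry of the distance.\<close>
  have half: "gdist G u w \<le> dep x0 + dep y0 + p"
    if u: "u \<in> pverts G" and w: "w \<in> pverts G" and o: "u \<in> C \<or> u \<in> anc x0 \<and> w \<notin> C \<or>
       u \<in> anc y0 \<and> w \<notin> C \<and> w \<notin> anc x0 \<or> dep u = 1 \<and> root u = w0 \<and> dep w = 1 \<and> root w = w0" for u w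
  proof -
    note via = gdist_via_roots[OF u w] and gp = g_p[OF u w]
    consider (c) "u \<in> C" | (a) "u \<in> anc x0" "w \<notin> C" | (b) "u \<in> anc y0" "w \<notin> C" "w \<notin> anc x0"
      | (l) "dep u = 1" "root u = w0" "dep w = 1" "root w = w0"
      using o by blast
    then show ?thesis
    proof cases
      case c
      have "dep w \<le> dep x0" using w
      proof (cases rule: vertex_cases)
        case arm2
        then show ?thesis using arm[OF _ y0] le(1) by force
      qed (use C_root arm[OF _ x0] le(2) in auto)
      then show ?thesis using via gp C_root[OF c] by simp
    next
      case a
      note ax = arm[OF a(1) x0]
      show ?thesis using w
      proof (cases rule: vertex_cases)
        case arm1
        then show ?thesis using gdist_same_anc[OF x0 a(1)] by fastforce
      next
        case arm2
        then show ?thesis using via gp ax arm[OF arm2 y0] by simp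
      next
        case leaf
        have "gdist G (root x0) w0 = gdist G w0 (root x0)"
          using gdist_sym[OF root_in[OF x0] w0V] .
        then show ?thesis using via ax leaf \<open>gdist G w0 (root x0) + 1 \<le> p + dep y0\<close> by simp
      qed (use a in simp)
    next
      case b
      note bx = arm[OF b(1) y0]
      show ?thesis using w
      proof (cases rule: vertex_cases)
        case arm2
        then show ?thesis using gdist_same_anc[OF y0 b(1)] by fastforce
      next
        case leaf
        then show ?thesis using via bx gp le(2) by simp
      qed (use b in simp_all)
    next
      case l
      then show ?thesis using via w0V le(3) by simp
    qed
  qed
  show "gdist G u w \<le> dep x0 + dep y0 + p" if u: "u \<in> pverts G" and w: "w \<in> pverts G"
  proof -
    have "(u \<in> C \<or> u \<in> anc x0 \<and> w \<notin> C \<or>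
       u \<in> anc y0 \<and> w \<notin> C \<and> w \<notin> anc x0 \<or> dep u = 1 \<and> root u = w0 \<and> dep w = 1 \<and> root w = w0) \<or>
      (w \<in> C \<or> w \<in> anc x0 \<and> u \<notin> C \<or>
       w \<in> anc y0 \<and> u \<notin> C \<and> u \<notin> anc x0 \<or> dep w = 1 \<and> root w = w0 \<and> dep u = 1 \<and> root u = w0)"
      using u by (cases rule: vertex_cases; use w in \<open>cases rule: vertex_cases\<close>) blast+
    then show ?thesis using half[OF u w] half[OF w u] gdist_sym[OF u w] by metis
  qed
qed

end

context sun_diam
begin

lemma weight_eq_antipodal:
  assumes "weight (pverts G) = x"
  shows "gdist G (root x0) (root y0) = p" and "dep x0 + dep y0 = s"
    and "config_weight p q p (max (dep x0) (dep y0)) (min (dep x0) (dep y0)) H = x"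
    and "\<exists>w\<in>C. (\<forall>u\<in>pverts G - (C \<union> anc x0 \<union> anc y0). par u = w) \<and>
        (H = 0 \<or> dep x0 * gdist G w (root x0) + dep y0 * gdist G w (root y0) = min (dep x0) (dep y0) * p)"
    and "card (pverts G - (C \<union> anc x0 \<union> anc y0)) = H"
proof -
  note D = weight_eqD[OF assms]
  then have b: "branch \<in> C" by blast
  note tr = xlen_dep ylen_dep[OF b] foot_root branch_root[OF b] K2_anc rest_def
  show "gdist G (root x0) (root y0) = p" "dep x0 + dep y0 = s"
    "config_weight p q p (max (dep x0) (dep y0)) (min (dep x0) (dep y0)) H = x"
    "card (pverts G - (C \<union> anc x0 \<union> anc y0)) = H"
    using D unfolding tr by blast+
  show "\<exists>w\<in>C. (\<forall>u\<in>pverts G - (C \<union> anc x0 \<union> anc y0). par u = w) \<and>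
        (H = 0 \<or> dep x0 * gdist G w (root x0) + dep y0 * gdist G w (root y0) = min (dep x0) (dep y0) * p)"
    using D unfolding tr by blast
qed

end

section \<open>The graphs U\<close>

text \<open>A digraph isomorphism also carries a map of arcs, but in a pair digraph an arc is
  determined by its ends, so a vertex map suffices. It is directed from the standard graph to the
  copy, so that a copy is an image.\<close>

lemma iso_pair_iff:
  assumes "pair_wf_digraph U"
  shows "digraph_iso (with_proj G) (with_proj U) \<longleftrightarrow>
    (\<exists>f. inj_on f (pverts U) \<and> pverts G = f ` pverts U \<and> parcs G = map_prod f f ` parcs U)"
proof
  assume "digraph_iso (with_proj G) (with_proj U)"
  then obtain h where h: "pre_digraph.digraph_isomorphism (with_proj G) h"
    and U: "with_proj U = app_iso h (with_proj G)"
    by (auto simp: digraph_iso_def)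
  let ?g = "iso_verts h"
  have wf: "wf_digraph (with_proj G)" and inj: "inj_on ?g (pverts G)"
    and tl: "\<And>e. e \<in> parcs G \<Longrightarrow> ?g (fst e) = iso_tail h (iso_arcs h e) \<and> ?g (snd e) = iso_head h (iso_arcs h e)"
    using h by (auto simp: pre_digraph.digraph_isomorphism_def)
  have V: "pverts U = ?g ` pverts G" and A: "parcs U = iso_arcs h ` parcs G"
    using arg_cong[OF U, of verts] arg_cong[OF U, of arcs] by simp_all
  have th: "iso_tail h = fst" "iso_head h = snd"
    using arg_cong[OF U, of tail] arg_cong[OF U, of head] by simp_all
  have "iso_arcs h e = map_prod ?g ?g e" if "e \<in> parcs G" for e
    using tl[OF that] unfolding th by (simp add: prod_eq_iff)
  then have A: "parcs U = map_prod ?g ?g ` parcs G" using A by simp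
  let ?f = "the_inv_into (pverts G) ?g"
  have f: "?f (?g y) = y" if "y \<in> pverts G" for y by (rule the_inv_into_f_f[OF inj that])
  have ends: "fst e \<in> pverts G \<and> snd e \<in> pverts G" if "e \<in> parcs G" for e
    using wf that by (cases e) (fastforce simp: wf_digraph_def)
  have "inj_on ?f (pverts U)" unfolding V by (rule inj_on_the_inv_into[OF inj])
  moreover have "pverts G = ?f ` pverts U" unfolding V image_image using f by simp
  moreover have "parcs G = map_prod ?f ?f ` parcs U"
  proof -
    have "map_prod ?f ?f (map_prod ?g ?g e) = e" if "e \<in> parcs G" for e
      using ends[OF that] f by (simp add: prod_eq_iff)
    then show ?thesis unfolding A image_image by simp
  qed
  ultimately show "\<exists>f. inj_on f (pverts U) \<and> pverts G = f ` pverts U \<and> parcs G = map_prod f f ` parcs U"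
    by blast
next
  assume "\<exists>f. inj_on f (pverts U) \<and> pverts G = f ` pverts U \<and> parcs G = map_prod f f ` parcs U"
  then obtain f where inj: "inj_on f (pverts U)" and V: "pverts G = f ` pverts U"
    and A: "parcs G = map_prod f f ` parcs U" by blast
  interpret U: pair_wf_digraph U by fact
  let ?g = "the_inv_into (pverts U) f"
  let ?h = "\<lparr> iso_verts = ?g, iso_arcs = map_prod ?g ?g, iso_head = snd, iso_tail = fst \<rparr>"
  have g: "?g (f y) = y" if "y \<in> pverts U" for y by (rule the_inv_into_f_f[OF inj that])
  have ends: "fst e \<in> pverts U" "snd e \<in> pverts U" if "e \<in> parcs U" for e
    using U.arc_fst_in_verts U.arc_snd_in_verts that by blast+
  have ge: "map_prod ?g ?g (map_prod f f e) = e" if "e \<in> parcs U" for e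
    using ends[OF that] g by (simp add: prod_eq_iff)
  have wf: "wf_digraph (with_proj G)"
    using ends by (force simp: wf_digraph_def V A)
  have "inj_on ?g (pverts G)" unfolding V by (rule inj_on_the_inv_into[OF inj])
  moreover have "inj_on (map_prod ?g ?g) (parcs G)"
    unfolding A by (rule inj_onI) (use ge in auto)
  ultimately have "pre_digraph.digraph_isomorphism (with_proj G) ?h"
    using wf by (simp add: pre_digraph.digraph_isomorphism_def)
  moreover have "?g ` pverts G = pverts U" unfolding V image_image using g by simp
  moreover have "map_prod ?g ?g ` parcs G = parcs U"
    unfolding A image_image using ge by simp
  ultimately show "digraph_iso (with_proj G) (with_proj U)"
    unfolding digraph_iso_def by (intro exI[of _ ?h] conjI) (simp_all add: app_iso_def with_proj_def)
qed

text \<open>Parent and depth read off from the numbering in \<open>U_graph\<close>, for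
  \<open>m \<le> u\<close> in the case of the parent; with them \<open>U_copy_sun\<close> makes
  every copy a sun.\<close>

definition upar :: "nat \<Rightarrow> nat \<Rightarrow> nat \<Rightarrow> nat \<Rightarrow> nat \<Rightarrow> nat" where
  "upar m a b k u = (if u < m + a then (if u = m then 0 else u - 1)
    else if u < m + a + b then (if u = m + a then m div 2 else u - 1) else k)"

definition udep :: "nat \<Rightarrow> nat \<Rightarrow> nat \<Rightarrow> nat \<Rightarrow> nat" where
  "udep m a b u = (if u < m then 0 else if u < m + a then Suc (u - m)
    else if u < m + a + b then Suc (u - (m + a)) else 1)"

lemma upar_less: "3 \<le> m \<Longrightarrow> k < m \<Longrightarrow> m \<le> u \<Longrightarrow> upar m a b k u < u"
  by (auto simp: upar_def)

lemma udep_upar: "3 \<le> m \<Longrightarrow> k < m \<Longrightarrow> m \<le> u \<Longrightarrow> udep m a b u = Suc (udep m a b (upar m a b k u))"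
  by (auto simp: udep_def upar_def)

lemma udep_0: "udep m a b u = 0 \<longleftrightarrow> u < m"
  by (auto simp: udep_def)

lemma attached_path_upt:
  "attached_path w [c..<c + l] = (\<lambda>u. (if u = c then w else u - 1, u)) ` {c..<c + l}"
proof (induction l)
  case (Suc l)
  have z: "zip (w # xs @ [y]) (xs @ [y]) = zip (w # xs) xs @ [(last (w # xs), y)]" for w y :: nat and xs
    by (induction xs arbitrary: w) auto
  have "last (w # [c..<c + l]) = (if l = 0 then w else c + l - 1)" by simp
  then have "attached_path w [c..<c + Suc l] = insert (if l = 0 then w else c + l - 1, c + l) (attached_path w [c..<c + l])"
    using z[of w "[c..<c + l]" "c + l"] by (simp add: attached_path_def)
  moreover have "{c..<c + Suc l} = insert (c + l) {c..<c + l}" by auto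
  ultimately show ?case using Suc by simp
qed (simp add: attached_path_def)

lemma U_graph_sets:
  assumes "a + b + m div 2 = d" "d + (m + 1) div 2 \<le> n"
  shows "pverts (U_graph n m d k a b) = {..<n}"
    and "parcs (U_graph n m d k a b) =
      (\<lambda>i. (i, (i + 1) mod m)) ` {..<m} \<union> (\<lambda>i. ((i + 1) mod m, i)) ` {..<m}
      \<union> (\<lambda>u. (upar m a b k u, u)) ` {m..<n} \<union> (\<lambda>u. (u, upar m a b k u)) ` {m..<n}"
proof -
  have "m = m div 2 + (m + 1) div 2" by presburger
  then have n: "m + a + b + (n - d - (m + 1) div 2) = n" using assms by linarith
  then have le: "m + a + b \<le> n" by linarith
  show "pverts (U_graph n m d k a b) = {..<n}"
    unfolding U_graph_def Let_def n by simp
  have 1: "attached_path 0 [m..<m + a] = (\<lambda>u. (upar m a b k u, u)) ` {m..<m + a}"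
    unfolding attached_path_upt by (rule image_cong) (auto simp: upar_def)
  have 2: "attached_path (m div 2) [m + a..<m + a + b] = (\<lambda>u. (upar m a b k u, u)) ` {m + a..<m + a + b}"
    unfolding attached_path_upt by (rule image_cong) (auto simp: upar_def)
  have 3: "{k} \<times> {m + a + b..<n} = (\<lambda>u. (upar m a b k u, u)) ` {m + a + b..<n}"
    by (auto simp: upar_def)
  have "{m..<n} = {m..<m + a} \<union> {m + a..<m + a + b} \<union> {m + a + b..<n}" using le by auto
  then have E: "attached_path 0 [m..<m + a] \<union> attached_path (m div 2) [m + a..<m + a + b] \<union> {k} \<times> {m + a + b..<n}
      = (\<lambda>u. (upar m a b k u, u)) ` {m..<n}"
    unfolding 1 2 3 by (simp only: image_Un)
  have F: "{(i, (i + 1) mod m) | i. i < m} = (\<lambda>i. (i, (i + 1) mod m)) ` {..<m}" by auto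
  have "parcs (U_graph n m d k a b) =
      ((\<lambda>i. (i, (i + 1) mod m)) ` {..<m} \<union> (\<lambda>u. (upar m a b k u, u)) ` {m..<n})
      \<union> ((\<lambda>i. (i, (i + 1) mod m)) ` {..<m} \<union> (\<lambda>u. (upar m a b k u, u)) ` {m..<n})\<inverse>"
    unfolding E[symmetric] F[symmetric] U_graph_def Let_def n by (simp add: Un_assoc)
  also have "\<dots> = (\<lambda>i. (i, (i + 1) mod m)) ` {..<m} \<union> (\<lambda>i. ((i + 1) mod m, i)) ` {..<m}
      \<union> (\<lambda>u. (upar m a b k u, u)) ` {m..<n} \<union> (\<lambda>u. (u, upar m a b k u)) ` {m..<n}"
    unfolding converse_Un by (auto simp: image_iff)
  finally show "parcs (U_graph n m d k a b) =
      (\<lambda>i. (i, (i + 1) mod m)) ` {..<m} \<union> (\<lambda>i. ((i + 1) mod m, i)) ` {..<m}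
      \<union> (\<lambda>u. (upar m a b k u, u)) ` {m..<n} \<union> (\<lambda>u. (u, upar m a b k u)) ` {m..<n}" .
qed

lemma U_graph_wf:
  assumes "a + b + m div 2 = d" "d + (m + 1) div 2 \<le> n" "3 \<le> m" "k < m"
  shows "pair_wf_digraph (U_graph n m d k a b)"
proof -
  have "m \<le> n" using assms by linarith
  moreover have "upar m a b k u < n" if "m \<le> u" "u < n" for u
    using upar_less[OF assms(3,4) that(1), of a b] that by linarith
  ultimately have "fst e < n \<and> snd e < n" if "e \<in> parcs (U_graph n m d k a b)" for e
    using that assms(3) unfolding U_graph_sets[OF assms(1,2)]
    by (auto intro: less_le_trans[of _ m])
  then show ?thesis by unfold_locales (simp_all add: U_graph_sets[OF assms(1,2)])
qed

definition U_copy :: "nat \<Rightarrow> nat \<Rightarrow> nat \<Rightarrow> nat \<Rightarrow> nat \<Rightarrow> nat \<Rightarrow> (nat \<Rightarrow> 'a) \<Rightarrow> 'a pair_pre_digraph \<Rightarrow> bool" where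
  "U_copy n m d k a b f G \<longleftrightarrow> inj_on f {..<n} \<and> pverts G = f ` {..<n}
    \<and> parcs G = map_prod f f ` parcs (U_graph n m d k a b)"

lemma is_U_iff:
  assumes "d + (m + 1) div 2 \<le> n" "3 \<le> m"
  shows "is_U n m d k a b G \<longleftrightarrow>
    b \<le> a \<and> 1 \<le> a \<and> a + b + m div 2 = d \<and> k \<le> m div 4 \<and> (\<exists>f. U_copy n m d k a b f G)"
proof -
  have "digraph_iso (with_proj G) (with_proj (U_graph n m d k a b)) \<longleftrightarrow> (\<exists>f. U_copy n m d k a b f G)"
    if "a + b + m div 2 = d" "k \<le> m div 4"
  proof -
    have "k < m" using that assms(2) by linarith
    show ?thesis
      unfolding U_copy_def iso_pair_iff[OF U_graph_wf[OF that(1) assms \<open>k < m\<close>]]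
        U_graph_sets(1)[OF that(1) assms(1)] by (rule refl)
  qed
  then show ?thesis unfolding is_U_def by blast
qed

lemma mod_Suc_int:
  assumes "0 < m"
  shows "(nat (i mod int m) + 1) mod m = nat ((i + 1) mod int m)"
proof -
  have "int ((nat (i mod int m) + 1) mod m) = (i mod int m + 1) mod int m"
    using assms by (simp add: zmod_int add.commute)
  also have "\<dots> = (i + 1) mod int m" by (rule mod_add_left_eq)
  finally show ?thesis by linarith
qed

lemma U_copy_sun:
  assumes f: "U_copy n m d k a b f G"
    and par: "a + b + m div 2 = d" "d + (m + 1) div 2 \<le> n" "3 \<le> m" "k < m"
  defines "g \<equiv> the_inv_into {..<n} f"
  shows "sun G m (\<lambda>i. f (nat (i mod int m))) (\<lambda>x. f (upar m a b k (g x))) (\<lambda>x. udep m a b (g x))"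
proof -
  have inj: "inj_on f {..<n}" and V: "pverts G = f ` {..<n}"
    and A: "parcs G = map_prod f f ` parcs (U_graph n m d k a b)"
    using f by (auto simp: U_copy_def)
  have mn: "m \<le> n" using par by linarith
  have m0: "0 < m" using par by linarith
  have idx: "nat (i mod int m) < m" "nat (i mod int m) < n" for i
    using m0 mn by (simp_all add: nat_less_iff) (smt (verit) pos_mod_bound of_nat_0_less_iff of_nat_mono)
  have g: "g (f u) = u" if "u < n" for u
    unfolding g_def using the_inv_into_f_f[OF inj] that by simp
  have f_eq: "f u = f w \<longleftrightarrow> u = w" if "u < n" "w < n" for u w
    using inj_on_eq_iff[OF inj] that by simp
  let ?v = "\<lambda>i. f (nat (i mod int m))"
  have range_v: "range ?v = f ` {..<m}"
  proof -
    have "f u \<in> range ?v" if "u < m" for u using that by (intro range_eqI[of _ _ "int u"]) simp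
    then show ?thesis using idx by auto
  qed
  have upar_n: "upar m a b k u < n" if "m \<le> u" "u < n" for u
    using upar_less[OF par(3,4) that(1), of a b] that by linarith
  show ?thesis
  proof
    show "finite (pverts G)" unfolding V by simp
    show "3 \<le> m" by (rule par)
    show "?v i = ?v j \<longleftrightarrow> i mod int m = j mod int m" for i j
      using f_eq[OF idx(2) idx(2)] m0 by (simp add: eq_nat_nat_iff)
    show "?v i \<in> pverts G" for i unfolding V using idx by blast
    show "udep m a b (g x) = 0 \<longleftrightarrow> x \<in> range ?v" if x: "x \<in> pverts G" for x
    proof -
      obtain u where u: "u < n" "x = f u" using x V by auto
      have "f u \<in> f ` {..<m} \<longleftrightarrow> u < m" using f_eq u mn by (auto simp: image_iff)
      then show ?thesis unfolding range_v udep_0 u(2) g[OF u(1)] by simp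
    qed
    show "f (upar m a b k (g x)) \<in> pverts G" if x: "x \<in> pverts G" "0 < udep m a b (g x)" for x
    proof -
      obtain u where u: "u < n" "x = f u" using x V by auto
      then have "m \<le> u" using x(2) g udep_0[of m a b u] by simp
      then show ?thesis unfolding V u(2) g[OF u(1)] using upar_n u by blast
    qed
    show "udep m a b (g x) = Suc (udep m a b (g (f (upar m a b k (g x)))))"
      if x: "x \<in> pverts G" "0 < udep m a b (g x)" for x
    proof -
      obtain u where u: "u < n" "x = f u" using x V by auto
      then have mu: "m \<le> u" using x(2) g udep_0[of m a b u] by simp
      show ?thesis unfolding u(2) g[OF u(1)] g[OF upar_n[OF mu u(1)]]
        by (rule udep_upar[OF par(3,4) mu])
    qed
    have cyc: "{(?v i, ?v (i + 1)) | i. True} = (\<lambda>i. (f i, f ((i + 1) mod m))) ` {..<m}"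
    proof (intro equalityI subsetI)
      fix e assume "e \<in> {(?v i, ?v (i + 1)) | i. True}"
      then obtain i where "e = (?v i, ?v (i + 1))" by blast
      then have "e = (\<lambda>i. (f i, f ((i + 1) mod m))) (nat (i mod int m))"
        using mod_Suc_int[OF m0, of i] by simp
      then show "e \<in> (\<lambda>i. (f i, f ((i + 1) mod m))) ` {..<m}" using idx by blast
    next
      fix e assume "e \<in> (\<lambda>i. (f i, f ((i + 1) mod m))) ` {..<m}"
      then obtain i where i: "i < m" "e = (f i, f ((i + 1) mod m))" by blast
      have "e = (?v (int i), ?v (int i + 1))"
        unfolding i(2) using i(1) mod_Suc_int[OF m0, of "int i"] by simp
      then show "e \<in> {(?v i, ?v (i + 1)) | i. True}" by blast
    qed
    have tree: "{(x, f (upar m a b k (g x))) | x. x \<in> pverts G \<and> 0 < udep m a b (g x)}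
        = (\<lambda>u. (f u, f (upar m a b k u))) ` {m..<n}"
    proof (intro equalityI subsetI)
      fix e assume "e \<in> {(x, f (upar m a b k (g x))) | x. x \<in> pverts G \<and> 0 < udep m a b (g x)}"
      then obtain x where x: "e = (x, f (upar m a b k (g x)))" "x \<in> pverts G" "0 < udep m a b (g x)"
        by blast
      obtain u where u: "u < n" "x = f u" using x V by auto
      then have mu: "u \<in> {m..<n}" using x(3) g udep_0[of m a b u] by simp
      have "e = (\<lambda>u. (f u, f (upar m a b k u))) u" unfolding x(1) u(2) g[OF u(1)] ..
      then show "e \<in> (\<lambda>u. (f u, f (upar m a b k u))) ` {m..<n}" using mu by blast
    next
      fix e assume "e \<in> (\<lambda>u. (f u, f (upar m a b k u))) ` {m..<n}"
      then obtain u where u: "m \<le> u" "u < n" "e = (f u, f (upar m a b k u))" by auto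
      have "f u \<in> pverts G" "0 < udep m a b (g (f u))"
        using V u udep_0[of m a b u] g[OF u(2)] by auto
      moreover have "e = (f u, f (upar m a b k (g (f u))))" using u g by simp
      ultimately show "e \<in> {(x, f (upar m a b k (g x))) | x. x \<in> pverts G \<and> 0 < udep m a b (g x)}"
        by blast
    qed
    have cyc': "{(?v (i + 1), ?v i) | i. True} = (\<lambda>i. (f ((i + 1) mod m), f i)) ` {..<m}"
    proof -
      have "{(?v (i + 1), ?v i) | i. True} = {(?v i, ?v (i + 1)) | i. True}\<inverse>" by auto
      then show ?thesis unfolding cyc by (auto simp: image_iff)
    qed
    have tree': "{(f (upar m a b k (g x)), x) | x. x \<in> pverts G \<and> 0 < udep m a b (g x)}
        = (\<lambda>u. (f (upar m a b k u), f u)) ` {m..<n}"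
    proof -
      have "{(f (upar m a b k (g x)), x) | x. x \<in> pverts G \<and> 0 < udep m a b (g x)}
        = {(x, f (upar m a b k (g x))) | x. x \<in> pverts G \<and> 0 < udep m a b (g x)}\<inverse>" by auto
      then show ?thesis unfolding tree by (auto simp: image_iff)
    qed
    show "parcs G = {(?v i, ?v (i + 1)) | i. True} \<union> {(?v (i + 1), ?v i) | i. True}
      \<union> {(x, f (upar m a b k (g x))) | x. x \<in> pverts G \<and> 0 < udep m a b (g x)}
      \<union> {(f (upar m a b k (g x)), x) | x. x \<in> pverts G \<and> 0 < udep m a b (g x)}"
      unfolding cyc cyc' tree tree' A U_graph_sets(2)[OF par(1,2)] image_Un image_image map_prod_simp
      by (rule Un_assoc[THEN trans, OF _] | simp add: Un_commute Un_left_commute)+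
  qed
qed

text \<open>\<open>r\<close> and \<open>\<epsilon>\<close> allow the numbering to start at any cycle
  vertex and to run in either direction.\<close>

lemma (in sun) U_copyI:
  assumes inj: "inj_on f {..<n}" and V: "f ` {..<n} = pverts G"
    and \<epsilon>: "\<epsilon> = 1 \<or> \<epsilon> = (-1::int)"
    and fv: "\<And>i. i < m \<Longrightarrow> f i = v (r + \<epsilon> * int i)"
    and fpar: "\<And>u. m \<le> u \<Longrightarrow> u < n \<Longrightarrow> par (f u) = f (upar m a b k u)"
    and par: "a + b + m div 2 = d" "d + (m + 1) div 2 \<le> n"
  shows "U_copy n m d k a b f G"
proof -
  have m0: "0 < m" and mn: "m \<le> n" using m3 par by linarith+
  have v_cong: "v i = v j" if "i mod int m = j mod int m" for i j using that by (simp add: v_eq)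
  have step: "f ((i + 1) mod m) = v (r + \<epsilon> * (int i + 1))" for i
  proof -
    have "f ((i + 1) mod m) = v (r + \<epsilon> * (int (i + 1) mod int m))"
      using fv[of "(i + 1) mod m"] m0 by (simp add: zmod_int)
    also have "\<dots> = v (r + \<epsilon> * int (i + 1))"
      by (rule v_cong) (metis mod_add_right_eq mod_mult_right_eq)
    finally show ?thesis by (simp add: add.commute)
  qed
  have idx: "nat (i mod int m) < m" for i using m0 by (simp add: nat_less_iff)
  have fv': "f (nat (i mod int m)) = v (r + \<epsilon> * i)" for i
    using fv[OF idx] m0 by (simp add: v_eq) (metis mod_add_right_eq mod_mult_right_eq)
  have range_f: "f ` {..<m} = range v"
  proof (intro equalityI subsetI)
    fix y assume "y \<in> range v"
    then obtain j where "y = v j" by blast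
    then have "y = f (nat ((\<epsilon> * (j - r)) mod int m))" using fv'[of "\<epsilon> * (j - r)"] \<epsilon> by auto
    then show "y \<in> f ` {..<m}" using idx by blast
  qed (use fv in auto)
  let ?A = "(\<lambda>i. (f i, f ((i + 1) mod m))) ` {..<m} \<union> (\<lambda>i. (f ((i + 1) mod m), f i)) ` {..<m}"
  let ?B = "{(v i, v (i + 1)) | i. True} \<union> {(v (i + 1), v i) | i. True}"
  have cyc: "?A = ?B"
  proof (intro equalityI subsetI)
    fix e assume "e \<in> ?A"
    then obtain i where "i < m" "e = (f i, f ((i + 1) mod m)) \<or> e = (f ((i + 1) mod m), f i)" by blast
    then have e: "e = (v (r + \<epsilon> * int i), v (r + \<epsilon> * (int i + 1))) \<or> e = (v (r + \<epsilon> * (int i + 1)), v (r + \<epsilon> * int i))"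
      using fv step by simp
    show "e \<in> ?B" using \<epsilon>
    proof
      assume "\<epsilon> = 1"
      then have "e = (v (r + int i), v (r + int i + 1)) \<or> e = (v (r + int i + 1), v (r + int i))"
        using e by (simp add: add.assoc)
      then show ?thesis by blast
    next
      assume "\<epsilon> = -1"
      then have "e = (v (r - int i - 1 + 1), v (r - int i - 1)) \<or> e = (v (r - int i - 1), v (r - int i - 1 + 1))"
        using e by (simp add: algebra_simps)
      then show ?thesis by blast
    qed
  next
    fix e assume "e \<in> ?B"
    then obtain j where j: "e = (v j, v (j + 1)) \<or> e = (v (j + 1), v j)" by blast
    \<comment> \<open>Against the direction of \<open>v\<close> the edge is entered at
      \<open>v (j + 1)\<close>, hence the shift by one.\<close>
    define t where "t = (if \<epsilon> = 1 then j - r else r - j - 1)"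
    define i where "i = nat (t mod int m)"
    have i: "i \<in> {..<m}" using idx by (simp add: i_def)
    have "f i = v (r + \<epsilon> * t)" unfolding i_def by (rule fv')
    moreover have "f ((i + 1) mod m) = v (r + \<epsilon> * (t + 1))"
      unfolding i_def mod_Suc_int[OF m0] by (rule fv')
    moreover have "\<epsilon> = 1 \<and> r + \<epsilon> * t = j \<and> r + \<epsilon> * (t + 1) = j + 1 \<or>
      r + \<epsilon> * t = j + 1 \<and> r + \<epsilon> * (t + 1) = j"
      using \<epsilon> by (auto simp: t_def)
    ultimately have "e = (f i, f ((i + 1) mod m)) \<or> e = (f ((i + 1) mod m), f i)"
      using j by metis
    then show "e \<in> ?A" using i by blast
  qed
  have off: "{x. x \<in> pverts G \<and> 0 < dep x} = f ` {m..<n}"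
  proof -
    have "{x. x \<in> pverts G \<and> 0 < dep x} = f ` {..<n} - f ` {..<m}"
      unfolding V range_f using off_cycle by blast
    also have "\<dots> = f ` ({..<n} - {..<m})"
      by (rule inj_on_image_set_diff[OF inj, symmetric]) (use mn in auto)
    also have "{..<n} - {..<m} = {m..<n}" by auto
    finally show ?thesis .
  qed
  have tree: "{(x, par x) | x. x \<in> pverts G \<and> 0 < dep x} = (\<lambda>u. (f u, f (upar m a b k u))) ` {m..<n}"
  proof -
    have "{(x, par x) | x. x \<in> pverts G \<and> 0 < dep x} = (\<lambda>x. (x, par x)) ` {x. x \<in> pverts G \<and> 0 < dep x}" by blast
    also have "\<dots> = (\<lambda>u. (f u, par (f u))) ` {m..<n}" unfolding off image_image by (rule refl)
    also have "\<dots> = (\<lambda>u. (f u, f (upar m a b k u))) ` {m..<n}" by (rule image_cong) (simp_all add: fpar)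
    finally show ?thesis .
  qed
  have tree': "{(par x, x) | x. x \<in> pverts G \<and> 0 < dep x} = (\<lambda>u. (f (upar m a b k u), f u)) ` {m..<n}"
  proof -
    have "{(par x, x) | x. x \<in> pverts G \<and> 0 < dep x} = {(x, par x) | x. x \<in> pverts G \<and> 0 < dep x}\<inverse>" by auto
    then show ?thesis unfolding tree by (auto simp: image_iff)
  qed
  have "parcs G = map_prod f f ` parcs (U_graph n m d k a b)"
    unfolding arcs_eq cyc[symmetric] tree tree' U_graph_sets(2)[OF par] image_Un image_image map_prod_simp
    by (simp add: Un_commute Un_left_commute)
  then show ?thesis using inj V by (simp add: U_copy_def)
qed

lemma (in connected_graph) graph_diameter_eq:
  assumes "x0 \<in> pverts G" "y0 \<in> pverts G"
    and "\<And>u w. u \<in> pverts G \<Longrightarrow> w \<in> pverts G \<Longrightarrow> gdist G u w \<le> gdist G x0 y0"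
  shows "graph_diameter G = gdist G x0 y0"
proof -
  let ?D = "{gdist G x y | x y. x \<in> pverts G \<and> y \<in> pverts G}"
  have "?D = (\<lambda>(x, y). gdist G x y) ` (pverts G \<times> pverts G)" by auto
  then have "finite ?D" using pair_finite_verts by simp
  then show ?thesis unfolding graph_diameter_def
    by (rule Max_eqI) (use assms in blast)+
qed

lemma (in connected_graph) graph_diameter_attained:
  assumes "pverts G \<noteq> {}"
  obtains x0 y0 where "x0 \<in> pverts G" "y0 \<in> pverts G" "graph_diameter G = gdist G x0 y0"
    and "\<forall>u\<in>pverts G. \<forall>w\<in>pverts G. gdist G u w \<le> gdist G x0 y0"
proof -
  let ?D = "{gdist G x y | x y. x \<in> pverts G \<and> y \<in> pverts G}"
  have "?D = (\<lambda>(x, y). gdist G x y) ` (pverts G \<times> pverts G)" by auto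
  then have fin: "finite ?D" using pair_finite_verts by simp
  have ne: "?D \<noteq> {}" using assms by blast
  have "Max ?D \<in> ?D" by (rule Max_in[OF fin ne])
  then obtain x0 y0 where xy: "x0 \<in> pverts G" "y0 \<in> pverts G" "Max ?D = gdist G x0 y0" by blast
  have "\<forall>u\<in>pverts G. \<forall>w\<in>pverts G. gdist G u w \<le> gdist G x0 y0"
  proof (intro ballI)
    fix u w assume "u \<in> pverts G" "w \<in> pverts G"
    then have "gdist G u w \<in> ?D" by blast
    then have "gdist G u w \<le> Max ?D" by (rule Max_ge[OF fin])
    then show "gdist G u w \<le> gdist G x0 y0" using xy(3) by simp
  qed
  then show ?thesis using that[OF xy(1,2)] xy(3) unfolding graph_diameter_def by simp
qed

section \<open>Copies of U\<close>

lemma U_copy_class: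
  fixes G :: "'a pair_pre_digraph"
  assumes f: "U_copy n m d k a b f G"
    and par: "a + b + m div 2 = d" "d + (m + 1) div 2 \<le> n" "3 \<le> m" "3 \<le> d"
    and ab: "b \<le> a" "1 \<le> a" and k: "k \<le> m div 4" "k = 0 \<or> a = b"
  shows "G \<in> unicyclic_class n m d"
    and "real (degree_distance G) =
      2 * config_weight (real (m div 2)) (real ((m + 1) div 2)) (real (m div 2)) a b (real (n - (m + a + b))) - real n * (real n - real m)"
proof -
  define g where "g = the_inv_into {..<n} f"
  define v where "v i = f (nat (i mod int m))" for i
  define pa where "pa x = f (upar m a b k (g x))" for x
  define dp where "dp x = udep m a b (g x)" for x
  have km: "k < m" using k par by linarith
  interpret S: sun G m v pa dp
    unfolding v_def pa_def dp_def g_def by (rule U_copy_sun[OF f par(1-3) km])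
  have inj: "inj_on f {..<n}" and V: "pverts G = f ` {..<n}"
    using f by (auto simp: U_copy_def)
  have m_eq: "m = m div 2 + (m + 1) div 2" by presburger
  have n_ge: "m + a + b \<le> n" using m_eq par by linarith
  have gf: "g (f u) = u" if "u < n" for u
    unfolding g_def using the_inv_into_f_f[OF inj] that by simp
  have paf: "pa (f u) = f (upar m a b k u)" and dpf: "dp (f u) = udep m a b u" if "u < n" for u
    using gf[OF that] by (simp_all add: pa_def dp_def)
  have fV: "f u \<in> pverts G" if "u < n" for u using V that by blast
  have fv: "f i = v (int i)" if "i < m" for i using that by (simp add: v_def)
  have range_v: "range v = f ` {..<m}"
  proof -
    have "v i \<in> f ` {..<m}" for i
    proof -
      have "nat (i mod int m) < m" using par(3) by (simp add: nat_less_iff)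
      then show ?thesis unfolding v_def by blast
    qed
    then show ?thesis using fv by auto
  qed
  have arm1: "S.anc (f (m + t)) = f ` {m..m + t} \<and> S.root (f (m + t)) = f 0" if "t < a" for t
    using that
  proof (induction t)
    case 0
    then have u: "m < n" using n_ge by simp
    have "upar m a b k m = 0" "udep m a b m = 1" using 0 by (simp_all add: upar_def udep_def)
    then have p: "pa (f m) = v 0" and d: "0 < dp (f m)"
      using paf[OF u] dpf[OF u] fv[of 0] par(3) by simp_all
    show ?case using S.anc_step[OF fV[OF u] d] S.root_par[OF fV[OF u] d] fv[of 0] par(3) unfolding p by simp
  next
    case (Suc t)
    then have u: "m + Suc t < n" using n_ge by simp
    have "upar m a b k (m + Suc t) = m + t" "0 < udep m a b (m + Suc t)"
      using Suc by (simp_all add: upar_def udep_def)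
    then have p: "pa (f (m + Suc t)) = f (m + t)" and d: "0 < dp (f (m + Suc t))"
      using paf[OF u] dpf[OF u] by simp_all
    have "{m..m + Suc t} = insert (m + Suc t) {m..m + t}" by auto
    then show ?case
      using S.anc_step[OF fV[OF u] d] S.root_par[OF fV[OF u] d] Suc unfolding p by simp
  qed
  have arm2: "S.anc (f (m + a + t)) = f ` {m + a..m + a + t} \<and> S.root (f (m + a + t)) = f (m div 2)" if "t < b" for t
    using that
  proof (induction t)
    case 0
    then have u: "m + a < n" using n_ge by simp
    have "upar m a b k (m + a) = m div 2" "udep m a b (m + a) = 1" using 0 by (simp_all add: upar_def udep_def)
    moreover have "f (m div 2) = v (int (m div 2))" using fv[of "m div 2"] par(3) by simp
    ultimately have p: "pa (f (m + a)) = v (int (m div 2))" and d: "0 < dp (f (m + a))"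
      using paf[OF u] dpf[OF u] by simp_all
    show ?case using S.anc_step[OF fV[OF u] d] S.root_par[OF fV[OF u] d] \<open>f (m div 2) = _\<close> unfolding p by simp
  next
    case (Suc t)
    then have u: "m + a + Suc t < n" using n_ge by simp
    have "upar m a b k (m + a + Suc t) = m + a + t" "0 < udep m a b (m + a + Suc t)"
      using Suc by (simp_all add: upar_def udep_def)
    then have p: "pa (f (m + a + Suc t)) = f (m + a + t)" and d: "0 < dp (f (m + a + Suc t))"
      using paf[OF u] dpf[OF u] by simp_all
    have "{m + a..m + a + Suc t} = insert (m + a + Suc t) {m + a..m + a + t}" by auto
    then show ?case
      using S.anc_step[OF fV[OF u] d] S.root_par[OF fV[OF u] d] Suc unfolding p by simp
  qed
  define x0 where "x0 = f (m + (a - 1))"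
  \<comment> \<open>Without a second path its end is replaced by the cycle vertex opposite to
    \<open>0\<close>, which is then one end of a diametral pair.\<close>
  define y0 where "y0 = (if b = 0 then f (m div 2) else f (m + a + (b - 1)))"
  have x0: "x0 \<in> pverts G" "dp x0 = a" "S.anc x0 = f ` {m..<m + a}" "S.root x0 = v 0"
  proof -
    have u: "m + (a - 1) < n" "{m..m + (a - 1)} = {m..<m + a}" using n_ge ab by auto
    show "x0 \<in> pverts G" "S.anc x0 = f ` {m..<m + a}" "S.root x0 = v 0"
      unfolding x0_def using fV[OF u(1)] arm1[of "a - 1"] ab(2) u(2) fv[of 0] par(3) by simp_all
    show "dp x0 = a" unfolding x0_def dpf[OF u(1)] using ab(2) by (simp add: udep_def)
  qed
  have y0: "y0 \<in> pverts G \<and> dp y0 = b \<and> S.anc y0 = f ` {m + a..<m + a + b} \<and> S.root y0 = v (int (m div 2))"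
  proof (cases "b = 0")
    case True
    then have "y0 = v (int (m div 2))" using fv[of "m div 2"] par(3) by (simp add: y0_def)
    then show ?thesis using True S.v_in by simp
  next
    case False
    have u: "m + a + (b - 1) < n" "{m + a..m + a + (b - 1)} = {m + a..<m + a + b}"
      using n_ge False by auto
    have "dp (f (m + a + (b - 1))) = b" unfolding dpf[OF u(1)] using False by (cases b) (simp_all add: udep_def)
    then show ?thesis
      unfolding y0_def using fV[OF u(1)] arm2[of "b - 1"] False u(2) fv[of "m div 2"] par(3) by simp
  qed
  have K: "range v \<union> S.anc x0 \<union> S.anc y0 = f ` {..<m + a + b}"
  proof -
    have "{..<m + a + b} = {..<m} \<union> {m..<m + a} \<union> {m + a..<m + a + b}" by auto
    then show ?thesis using range_v x0(3) y0 by (simp only: image_Un)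
  qed
  have cd: "int (gdist G (v i) (v j)) = cyc_dist m (j - i)" for i j by (rule S.gdist_v)
  have c: "cyc_dist m (int j) = int j" if "j \<le> m div 2" for j
  proof -
    have "cyc_dist m (int j) = min (int j) (int m - int j)"
      using cyc_dist_eq[of "int j" m] that par(3) by simp
    then show ?thesis using that by linarith
  qed
  have kp: "k \<le> m div 2" using k(1) by linarith
  have g0p: "gdist G (v 0) (v (int (m div 2))) = m div 2"
    using cd[of 0 "int (m div 2)"] c[of "m div 2"] by simp
  have gk0: "gdist G (v (int k)) (v 0) = k"
    using cd[of "int k" 0] cyc_dist_minus[of m "int k"] c[OF kp] by simp
  have gkp: "gdist G (v (int k)) (v (int (m div 2))) = m div 2 - k"
  proof -
    have e: "int (m div 2) - int k = int (m div 2 - k)" using kp by linarith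
    have "int (gdist G (v (int k)) (v (int (m div 2)))) = int (m div 2 - k)"
      unfolding cd e by (rule c) simp
    then show ?thesis by (simp only: of_nat_eq_iff)
  qed
  interpret A: antipodal G m v pa dp x0 y0 "v (int k)"
  proof
    show "x0 \<in> pverts G" by (rule x0(1))
    show "y0 \<in> pverts G" using y0 by blast
    show "v (int k) \<in> range v" by (rule rangeI)
    show "gdist G (S.root x0) (S.root y0) = m div 2" using g0p x0(4) y0 by simp
    show "pa u = v (int k)" if u: "u \<in> pverts G - (range v \<union> S.anc x0 \<union> S.anc y0)" for u
    proof -
      obtain j where j: "u = f j" "j < n" using u V by auto
      have "f j \<in> f ` {..<m + a + b}" if "j < m + a + b" using that by simp
      then have "\<not> j < m + a + b" using u j(1) unfolding K by blast
      then show ?thesis using paf[OF j(2)] fv[OF km] j(1) by (simp add: upar_def)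
    qed
  qed
  have card_n: "card (pverts G) = n" unfolding V by (simp add: card_image[OF inj])
  have rest: "A.rest = n - (m + a + b)" using A.card_antipodal card_n x0(2) y0 by simp
  have gw: "gdist G (v (int k)) (S.root x0) + 1 \<le> m div 2 + dp y0"
    using gk0 x0(4) y0 k ab par by (cases "k = 0") auto
  have le: "dp y0 \<le> dp x0" "1 \<le> dp x0" "3 \<le> dp x0 + dp y0 + m div 2"
    using x0(2) y0 ab par by simp_all
  have "graph_diameter G = gdist G x0 y0"
    by (rule S.graph_diameter_eq) (use A.diameter[OF le gw] x0 y0 in auto)
  also have "\<dots> = d" using A.diameter(2)[OF le gw] x0(2) y0 par(1) by simp
  finally show "G \<in> unicyclic_class n m d"
    using S.unicyclic S.girth card_n by (simp add: unicyclic_class_def)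
  \<comment> \<open>This makes the surplus term in \<open>weight_antipodal_eq\<close> vanish. For
    \<open>k = 0\<close> the leaves sit at the foot of the longer path; for \<open>a = b\<close>
    every position between the feet is as good.\<close>
  have "a * k + b * (m div 2 - k) = b * (m div 2)"
    using k(2) add_mult_distrib2[of b k "m div 2 - k"] le_add_diff_inverse[OF kp] by auto
  then have "real (weight) = config_weight (real (m div 2)) (real ((m + 1) div 2)) (real (m div 2)) a b (real (n - (m + a + b)))"
    if "weight = S.weight (pverts G)" for weight
    unfolding that using A.weight_antipodal_eq x0 y0 rest gk0 gkp ab(1) by (simp add: max_def min_def)
  then have w: "real (S.weight (pverts G)) = config_weight (real (m div 2)) (real ((m + 1) div 2)) (real (m div 2)) a b (real (n - (m + a + b)))"
    by blast
  have "real_of_int (int (degree_distance G)) =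
      real_of_int (2 * int (S.weight (pverts G)) - int (card (pverts G)) * (int (card (pverts G)) - int m))"
    unfolding S.degree_distance_weight by (rule refl)
  then show "real (degree_distance G) =
      2 * config_weight (real (m div 2)) (real ((m + 1) div 2)) (real (m div 2)) a b (real (n - (m + a + b))) - real n * (real n - real m)"
    unfolding card_n using w by simp
qed

text \<open>The type \<open>'a\<close> may be finite, so a copy is built on a prescribed set of
  \<open>n\<close> elements, later the vertex set of a graph in the class.\<close>

lemma U_copy_exists:
  assumes "card V = n" "0 < n" "a + b + m div 2 = d" "d + (m + 1) div 2 \<le> n"
  shows "\<exists>f (G :: 'a pair_pre_digraph). U_copy n m d k a b f G \<and> pverts G = (V :: 'a set)"
proof -
  have "finite V" using assms card.infinite by fastforce
  then obtain f where "bij_betw f {0..<n} V" using ex_bij_betw_nat_finite assms(1) by metis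
  then have "inj_on f {..<n}" "f ` {..<n} = V" by (auto simp: bij_betw_def atLeast0LessThan)
  then show ?thesis
    by (intro exI[of _ f] exI[of _ "\<lparr> pverts = V, parcs = map_prod f f ` parcs (U_graph n m d k a b) \<rparr>"])
      (simp add: U_copy_def)
qed

section \<open>Recognising a copy of U inside a sun\<close>

context sun
begin

text \<open>Seen from \<open>rx\<close>, the vertices \<open>ry\<close> and \<open>w\<close> lie at
  \<open>p\<close> and \<open>k\<close> steps in directions that may differ. If they do, the
  distance of \<open>w\<close> and \<open>ry\<close> is that of \<open>p + k\<close> steps, which
  equals \<open>p - k\<close> only for \<open>k = 0\<close> or even \<open>m\<close>. In the first
  case the direction of \<open>w\<close> is arbitrary, in the second that of
  \<open>ry\<close>.\<close>

lemma antipodal_position: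
  assumes rx: "rx \<in> range v" and ry: "ry \<in> range v" and w: "w \<in> range v"
    and anti: "gdist G rx ry = m div 2" and k: "gdist G w rx = k" "k + gdist G w ry = m div 2" "k \<le> m div 4"
  obtains r \<epsilon> where "\<epsilon> = 1 \<or> \<epsilon> = (-1::int)" "rx = v r" "ry = v (r + \<epsilon> * int (m div 2))" "w = v (r + \<epsilon> * int k)"
proof -
  have m0: "0 < m" using m3 by simp
  obtain r where r: "rx = v r" using rx by blast
  have pos: "\<exists>t. 0 \<le> t \<and> t < int m \<and> y = v (r + t)" if y: "y \<in> range v" for y
  proof -
    obtain j where j: "y = v j" using y by blast
    have "y = v (r + (j - r) mod int m)" unfolding j by (simp add: v_eq mod_add_right_eq)
    then show ?thesis using m0 by (intro exI[of _ "(j - r) mod int m"]) simp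
  qed
  obtain t where t: "0 \<le> t" "t < int m" "ry = v (r + t)" using pos[OF ry] by blast
  obtain u where u: "0 \<le> u" "u < int m" "w = v (r + u)" using pos[OF w] by blast
  have per: "v (i + int m) = v i" for i by (simp add: v_eq)
  have cd: "int (gdist G (v i) (v j)) = cyc_dist m (j - i)" for i j by (rule gdist_v)
  have t': "min t (int m - t) = int (m div 2)"
    using cd[of r "r + t"] cyc_dist_eq[of t m] t m0 anti r by simp
  have u': "min u (int m - u) = int k"
    using cd[of "r + u" r] cyc_dist_minus[of m u] cyc_dist_eq[of u m] u m0 k(1) r by simp
  have ty: "ry = v (r + int (m div 2)) \<or> ry = v (r - int (m div 2))"
  proof (cases "t = int (m div 2)")
    case False
    then have "r + t = r - int (m div 2) + int m" using t' by linarith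
    then show ?thesis using t(3) per by metis
  qed (use t in simp)
  have uw: "w = v (r + int k) \<or> w = v (r - int k)"
  proof (cases "u = int k")
    case False
    then have "r + u = r - int k + int m" using u' by linarith
    then show ?thesis using u(3) per by metis
  qed (use u in simp)
  have kp: "int (m div 2) + int k \<le> int m" "2 * int k \<le> int (m div 2)" using k(3) by linarith+
  have far: "k = 0 \<or> m = 2 * (m div 2)"
    if "ry = v (r + \<epsilon> * int (m div 2))" "w = v (r - \<epsilon> * int k)" "\<epsilon> = 1 \<or> \<epsilon> = (-1::int)" for \<epsilon>
  proof -
    have "int (gdist G w ry) = cyc_dist m (int (m div 2) + int k)"
    proof -
      have "r + \<epsilon> * int (m div 2) - (r - \<epsilon> * int k) = \<epsilon> * (int (m div 2) + int k)"
        by (simp add: algebra_simps)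
      then have "int (gdist G w ry) = cyc_dist m (\<epsilon> * (int (m div 2) + int k))"
        unfolding that(1,2) cd by simp
      then show ?thesis using that(3) cyc_dist_minus[of m "int (m div 2) + int k"] by auto
    qed
    also have "\<dots> = min (int (m div 2) + int k) (int m - (int (m div 2) + int k))"
      using cyc_dist_eq[of "int (m div 2) + int k" m] kp m0 by simp
    finally have "min (int (m div 2) + int k) (int m - (int (m div 2) + int k)) = int (m div 2) - int k"
      using k(2) by linarith
    then show ?thesis by linarith
  qed
  have even: "v (r + int (m div 2)) = v (r - int (m div 2))" if "m = 2 * (m div 2)"
  proof -
    have "r + int (m div 2) = r - int (m div 2) + int m" using that by linarith
    then show ?thesis using per by metis
  qed
  show ?thesis
  proof (cases "ry = v (r + int (m div 2))")
    case True
    show ?thesis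
    proof (cases "w = v (r + int k)")
      case True
      then show ?thesis using that[of 1 r] r \<open>ry = v (r + int (m div 2))\<close> by simp
    next
      case False
      then have w: "w = v (r - int k)" using uw by blast
      then have "k = 0 \<or> m = 2 * (m div 2)" using far[of 1] True by simp
      then have "m = 2 * (m div 2)" using w False by auto
      then show ?thesis using that[of "-1" r] r True w even by simp
    qed
  next
    case False
    then have ry: "ry = v (r - int (m div 2))" using ty by blast
    show ?thesis
    proof (cases "w = v (r - int k)")
      case True
      then show ?thesis using that[of "-1" r] r ry by simp
    next
      case F: False
      then have w: "w = v (r + int k)" using uw by blast
      then have "k = 0 \<or> m = 2 * (m div 2)" using far[of "-1"] ry by simp
      then have "m = 2 * (m div 2)" using w F by auto
      then show ?thesis using False ry even by simp
    qed
  qed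
qed

lemma antipodal_U_copy:
  assumes x0: "x0 \<in> pverts G" and y0: "y0 \<in> pverts G" and w: "w \<in> range v"
    and anti: "gdist G (root x0) (root y0) = m div 2"
    and star: "\<forall>u\<in>pverts G - (range v \<union> anc x0 \<union> anc y0). par u = w"
    and H: "card (pverts G - (range v \<union> anc x0 \<union> anc y0)) = H"
    and n: "card (pverts G) = n" "n = m + dep x0 + dep y0 + H"
    and k: "gdist G w (root x0) = k" "k + gdist G w (root y0) = m div 2" "k \<le> m div 4"
    and d: "dep x0 + dep y0 + m div 2 = d" "d + (m + 1) div 2 \<le> n"
  shows "\<exists>f. U_copy n m d k (dep x0) (dep y0) f G"
proof -
  let ?a = "dep x0" and ?b = "dep y0" and ?L = "pverts G - (range v \<union> anc x0 \<union> anc y0)"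
  obtain r \<epsilon> where \<epsilon>: "\<epsilon> = 1 \<or> \<epsilon> = (-1::int)" and r: "root x0 = v r" "root y0 = v (r + \<epsilon> * int (m div 2))"
    "w = v (r + \<epsilon> * int k)"
    using antipodal_position[OF root_range[OF x0] root_range[OF y0] w anti k] by blast
  have "finite ?L" using fin by simp
  then obtain h where h: "bij_betw h {0..<H} ?L" using ex_bij_betw_nat_finite H by blast
  \<comment> \<open>Numbers on a path grow from the foot to the end, while parents are iterated from
    the end: so the parent of \<open>f u\<close> is \<open>f (u - 1)\<close> except at the
    foot.\<close>
  define f where "f u = (if u < m then v (r + \<epsilon> * int u)
    else if u < m + ?a then (par ^^ (m + ?a - 1 - u)) x0
    else if u < m + ?a + ?b then (par ^^ (m + ?a + ?b - 1 - u)) y0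
    else h (u - (m + ?a + ?b)))" for u
  have m0: "0 < m" using m3 by simp
  have im0: "f ` {..<m} = range v"
  proof (intro equalityI subsetI)
    fix y assume "y \<in> range v"
    then obtain j where j: "y = v j" by blast
    define i where "i = nat ((\<epsilon> * (j - r)) mod int m)"
    have i: "i < m" using m0 by (simp add: i_def nat_less_iff)
    have "(r + \<epsilon> * ((\<epsilon> * (j - r)) mod int m)) mod int m = (r + \<epsilon> * (\<epsilon> * (j - r))) mod int m"
      by (metis mod_add_right_eq mod_mult_right_eq)
    also have "r + \<epsilon> * (\<epsilon> * (j - r)) = j" using \<epsilon> by auto
    finally have "f i = y" using i m0 unfolding f_def j by (simp add: v_eq i_def)
    then show "y \<in> f ` {..<m}" using i by blast
  qed (auto simp: f_def)
  have im1: "f ` {m..<m + ?a} = anc x0"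
  proof -
    have "f ` {m..<m + ?a} = (\<lambda>j. (par ^^ j) x0) ` ((\<lambda>u. m + ?a - 1 - u) ` {m..<m + ?a})"
      unfolding image_image by (rule image_cong) (auto simp: f_def)
    also have "(\<lambda>u. m + ?a - 1 - u) ` {m..<m + ?a} = {..<?a}"
    proof (intro equalityI subsetI)
      fix j assume "j \<in> {..<?a}"
      then have "j = m + ?a - 1 - (m + ?a - 1 - j)" "m + ?a - 1 - j \<in> {m..<m + ?a}" by auto
      then show "j \<in> (\<lambda>u. m + ?a - 1 - u) ` {m..<m + ?a}" by (rule image_eqI)
    qed auto
    finally show ?thesis by (simp add: anc_def)
  qed
  have im2: "f ` {m + ?a..<m + ?a + ?b} = anc y0"
  proof -
    have "f ` {m + ?a..<m + ?a + ?b} = (\<lambda>j. (par ^^ j) y0) ` ((\<lambda>u. m + ?a + ?b - 1 - u) ` {m + ?a..<m + ?a + ?b})"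
      unfolding image_image by (rule image_cong) (auto simp: f_def)
    also have "(\<lambda>u. m + ?a + ?b - 1 - u) ` {m + ?a..<m + ?a + ?b} = {..<?b}"
    proof (intro equalityI subsetI)
      fix j assume "j \<in> {..<?b}"
      then have "j = m + ?a + ?b - 1 - (m + ?a + ?b - 1 - j)" "m + ?a + ?b - 1 - j \<in> {m + ?a..<m + ?a + ?b}" by auto
      then show "j \<in> (\<lambda>u. m + ?a + ?b - 1 - u) ` {m + ?a..<m + ?a + ?b}" by (rule image_eqI)
    qed auto
    finally show ?thesis by (simp add: anc_def)
  qed
  have im3: "f ` {m + ?a + ?b..<n} = ?L"
  proof -
    have "f ` {m + ?a + ?b..<n} = h ` ((\<lambda>u. u - (m + ?a + ?b)) ` {m + ?a + ?b..<n})"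
      unfolding image_image by (rule image_cong) (auto simp: f_def)
    also have "(\<lambda>u. u - (m + ?a + ?b)) ` {m + ?a + ?b..<n} = {0..<H}"
    proof (intro equalityI subsetI)
      fix j assume "j \<in> {0..<H}"
      then have "j = j + (m + ?a + ?b) - (m + ?a + ?b)" "j + (m + ?a + ?b) \<in> {m + ?a + ?b..<n}" using n by auto
      then show "j \<in> (\<lambda>u. u - (m + ?a + ?b)) ` {m + ?a + ?b..<n}" by (rule image_eqI)
    qed (use n in auto)
    finally show ?thesis using h by (simp add: bij_betw_def)
  qed
  have "{..<n} = {..<m} \<union> {m..<m + ?a} \<union> {m + ?a..<m + ?a + ?b} \<union> {m + ?a + ?b..<n}" using n by auto
  then have "f ` {..<n} = range v \<union> anc x0 \<union> anc y0 \<union> ?L" by (simp only: image_Un im0 im1 im2 im3)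
  moreover have "range v \<union> anc x0 \<union> anc y0 \<subseteq> pverts G"
    using range_v_subset anc_subset[OF x0] anc_subset[OF y0] by blast
  ultimately have V: "f ` {..<n} = pverts G" by blast
  \<comment> \<open>A map from \<open>n\<close> numbers onto \<open>n\<close> vertices is
    injective.\<close>
  then have inj: "inj_on f {..<n}" using n(1) by (intro eq_card_imp_inj_on) simp_all
  have "U_copy n m d k ?a ?b f G"
  proof (rule U_copyI[OF inj V \<epsilon> _ _ d])
    show "f i = v (r + \<epsilon> * int i)" if "i < m" for i using that by (simp add: f_def)
    have km: "k < m" using k(3) m0 by linarith
    have p: "m div 2 < m" using m0 by simp
    fix u assume u: "m \<le> u" "u < n"
    consider "u = m" "u < m + ?a" | "m < u" "u < m + ?a" | "u = m + ?a" "u < m + ?a + ?b"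
      | "m + ?a < u" "u < m + ?a + ?b" | "m + ?a + ?b \<le> u"
      using u by linarith
    then show "par (f u) = f (upar m ?a ?b k u)"
    proof cases
      case 1
      then obtain a' where a': "?a = Suc a'" by (cases ?a) auto
      then have "par (f u) = (par ^^ ?a) x0" using 1 by (simp add: f_def)
      then show ?thesis using 1 r(1) m0 by (simp add: f_def upar_def root_def)
    next
      case 2
      then obtain u' where u': "u = Suc u'" "m \<le> u'" "u' < m + ?a" by (cases u) auto
      have e: "m + ?a - 1 - u' = Suc (m + ?a - 1 - u)" using u'(1) 2 by arith
      have "f u' = (par ^^ (m + ?a - 1 - u')) x0" using u' by (simp add: f_def)
      also have "\<dots> = par ((par ^^ (m + ?a - 1 - u)) x0)" unfolding e by simp
      also have "(par ^^ (m + ?a - 1 - u)) x0 = f u" using 2 by (simp add: f_def)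
      finally show ?thesis using 2 u'(1) by (simp add: upar_def)
    next
      case 3
      then obtain b' where b': "?b = Suc b'" by (cases ?b) auto
      then have "par (f u) = (par ^^ ?b) y0" using 3 by (simp add: f_def)
      then show ?thesis using 3 r(2) p by (simp add: f_def upar_def root_def)
    next
      case 4
      then obtain u' where u': "u = Suc u'" "m + ?a \<le> u'" "u' < m + ?a + ?b" by (cases u) auto
      have e: "m + ?a + ?b - 1 - u' = Suc (m + ?a + ?b - 1 - u)" using u'(1) 4 by arith
      have "f u' = (par ^^ (m + ?a + ?b - 1 - u')) y0" using u' by (simp add: f_def)
      also have "\<dots> = par ((par ^^ (m + ?a + ?b - 1 - u)) y0)" unfolding e by simp
      also have "(par ^^ (m + ?a + ?b - 1 - u)) y0 = f u" using 4 by (simp add: f_def)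
      finally show ?thesis using 4 u'(1) by (simp add: upar_def)
    next
      case 5
      then have "f u \<in> f ` {m + ?a + ?b..<n}" using u by simp
      then have "f u \<in> ?L" unfolding im3 .
      then show ?thesis using star 5 r(3) km by (simp add: f_def upar_def)
    qed
  qed
  then show ?thesis by blast
qed

end

section \<open>The minimum over the class\<close>

text \<open>Combines the representation as a sun with the bound for a diametral pair whose deeper
  end is \<open>X\<close>. In the equality case the position of the leaves is recovered from their
  distances \<open>i\<close> and \<open>j\<close> to the two roots.\<close>

lemma class_lower:
  fixes G :: "'a pair_pre_digraph"
  assumes G: "G \<in> unicyclic_class n m d"
    and d: "d = m div 2 + s" "3 \<le> d" and n: "n = m + s + H" "m + 2 \<le> n"
    and x: "lower_value (m div 2) ((m + 1) div 2) s H x"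
  shows "1 \<le> s" and "2 * x - real n * (real n - real m) \<le> degree_distance G"
    and "degree_distance G = 2 * x - real n * (real n - real m) \<Longrightarrow>
      \<exists>k a b. is_U n m d k a b G \<and> (k = 0 \<or> a = b \<and> 1 \<le> H)
        \<and> config_weight (real (m div 2)) (real ((m + 1) div 2)) (real (m div 2)) a b H = x"
proof -
  have uni: "unicyclic G" and card_n: "card (pverts G) = n" and girth: "unicyclic_girth G = m"
    and diam: "graph_diameter G = d"
    using G by (auto simp: unicyclic_class_def)
  obtain v par dep where "sun G m v par dep" using unicyclic_sun[OF uni] girth by metis
  then interpret S: sun G m v par dep .
  let ?p = "m div 2" and ?q = "(m + 1) div 2"
  have ne: "pverts G \<noteq> {}" using S.v_in by blast
  obtain x0 y0 where xy: "x0 \<in> pverts G" "y0 \<in> pverts G" "gdist G x0 y0 = d"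
    and far: "\<forall>u\<in>pverts G. \<forall>w\<in>pverts G. gdist G u w \<le> d"
    using S.graph_diameter_attained[OF ne] diam by metis
  \<comment> \<open>Some vertex is off the cycle, and its distance to the cycle vertex opposite to
    its root exceeds \<open>p\<close>.\<close>
  show s1: "1 \<le> s"
  proof -
    have "card (range v) < card (pverts G)" using S.card_range_v card_n n by linarith
    then have "\<not> pverts G \<subseteq> range v"
      using card_mono[OF S.finite_range_v, of "pverts G"] linorder_not_less by blast
    then obtain u where u: "u \<in> pverts G" "u \<notin> range v" by blast
    interpret U: sun_pair G m v par dep u u by unfold_locales (rule u)+
    obtain z where z: "z \<in> range v" "gdist G z U.foot = ?p"
      using U.antipode_ex[OF U.foot_in] by blast
    have "gdist G z u = ?p + dep u" using U.gdist_foot[OF z(1)] z(2) U.xlen_dep by simp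
    moreover have "gdist G z u \<le> d" using far z(1) S.v_in u(1) by blast
    moreover have "0 < dep u" using S.dep_0[OF u(1)] u(2) by simp
    ultimately show ?thesis using d by simp
  qed
  obtain X Y where XY: "X \<in> pverts G" "Y \<in> pverts G" "gdist G X Y = d" "dep Y \<le> dep X"
    using xy S.gdist_sym by (metis nat_le_linear)
  interpret P: sun_diam G m v par dep X Y s H x
    by unfold_locales (use XY far d n card_n x in auto)
  have dd: "real (degree_distance G) = 2 * real (S.weight (pverts G)) - real n * (real n - real m)"
  proof -
    have "real_of_int (int (degree_distance G)) =
      real_of_int (2 * int (S.weight (pverts G)) - int (card (pverts G)) * (int (card (pverts G)) - int m))"
      unfolding S.degree_distance_weight by (rule refl)
    then show ?thesis unfolding card_n by simp
  qed
  show "2 * x - real n * (real n - real m) \<le> degree_distance G"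
    using P.weight_ge dd by simp
  assume "degree_distance G = 2 * x - real n * (real n - real m)"
  then have wx: "S.weight (pverts G) = x" using dd by simp
  note E = P.weight_eq_antipodal[OF wx]
  let ?a = "dep X" and ?b = "dep Y"
  have RX: "S.root X \<in> range v" and RY: "S.root Y \<in> range v"
    using S.root_range XY by blast+
  have RV: "S.root X \<in> pverts G" "S.root Y \<in> pverts G" using S.root_in XY by blast+
  have a1: "1 \<le> ?a" using E(2) XY(4) s1 by linarith
  have mm: "max ?a ?b = ?a" "min ?a ?b = ?b" using XY(4) by simp_all
  have Rab: "config_weight ?p ?q ?p ?a ?b H = x" using E(3) unfolding mm .
  have m: "?p + ?q = m" by presburger
  have dq: "d + ?q \<le> n" using d n m by simp
  have nn: "n = m + ?a + ?b + H" using n E(2) by simp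
  have dab: "?a + ?b + ?p = d" using d E(2) by simp
  have iff: "is_U n m d k a b G \<longleftrightarrow> b \<le> a \<and> 1 \<le> a \<and> a + b + ?p = d \<and> k \<le> m div 4 \<and> (\<exists>f. U_copy n m d k a b f G)"
    for k a b by (rule is_U_iff[OF dq S.m3])
  obtain w where w: "w \<in> range v" "\<forall>u\<in>pverts G - (range v \<union> S.anc X \<union> S.anc Y). par u = w"
    "H = 0 \<or> ?a * gdist G w (S.root X) + ?b * gdist G w (S.root Y) = ?b * ?p"
    using E(4) unfolding mm by blast
  have wV: "w \<in> pverts G" using w(1) S.v_in by blast
  let ?i = "gdist G w (S.root X)" and ?j = "gdist G w (S.root Y)"
  have tri: "?p \<le> ?i + ?j"
    using S.gdist_triangle[OF RV(1) wV RV(2)] S.gdist_sym[OF RV(1) wV] E(1) by simp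
  have at_foot: "\<exists>k a b. is_U n m d k a b G \<and> (k = 0 \<or> a = b \<and> 1 \<le> H) \<and> config_weight ?p ?q ?p a b H = x"
    if star: "\<forall>u\<in>pverts G - (range v \<union> S.anc X \<union> S.anc Y). par u = S.root X"
  proof -
    have "\<exists>f. U_copy n m d 0 ?a ?b f G"
      by (rule S.antipodal_U_copy[OF XY(1,2) RX E(1) star E(5) card_n nn _ _ _ dab dq])
        (use RV E(1) in simp_all)
    then have "is_U n m d 0 ?a ?b G" unfolding iff using XY(4) a1 dab by simp
    then show ?thesis using Rab by blast
  qed
  show "\<exists>k a b. is_U n m d k a b G \<and> (k = 0 \<or> a = b \<and> 1 \<le> H) \<and> config_weight ?p ?q ?p a b H = x"
  proof (cases "H = 0")
    case True
    have "finite (pverts G - (range v \<union> S.anc X \<union> S.anc Y))" using S.fin by simp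
    then have "pverts G - (range v \<union> S.anc X \<union> S.anc Y) = {}" using E(5) True by simp
    then show ?thesis using at_foot by blast
  next
    case H: False
    then have eq: "?a * ?i + ?b * ?j = ?b * ?p" using w(3) by blast
    show ?thesis
    proof (cases "?a = ?b")
      case False
      then obtain c where c: "?a = ?b + Suc c" using XY(4) less_imp_Suc_add[of ?b ?a] by force
      have "?b * ?p \<le> ?b * (?i + ?j)" using tri by (rule mult_le_mono2)
      then have "?i = 0" using eq unfolding c by (simp add: distrib_left distrib_right)
      then have "w = S.root X" using S.gdist_eq_0[OF wV RV(1)] by blast
      then show ?thesis using at_foot w(2) by blast
    next
      case True
      then have "?b * (?i + ?j) = ?b * ?p" using eq by (simp add: distrib_left)
      then have ij: "?i + ?j = ?p" using True a1 by simp
      have H1: "1 \<le> H" using H by simp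
      show ?thesis
      \<comment> \<open>For equal lengths the two ends may be exchanged, so the position is counted
        from the nearer foot. As \<open>i + j = p\<close>, the smaller distance is at most
        \<open>m div 4\<close>, the range allowed for \<open>k\<close>.\<close>
      proof (cases "?i \<le> ?j")
        case le: True
        then have k: "?i \<le> m div 4" using ij by linarith
        have "\<exists>f. U_copy n m d ?i ?a ?b f G"
          by (rule S.antipodal_U_copy[OF XY(1,2) w(1) E(1) w(2) E(5) card_n nn refl ij k dab dq])
        then have "is_U n m d ?i ?a ?b G" unfolding iff using XY(4) a1 dab k by simp
        then show ?thesis using Rab True H1 by blast
      next
        case False
        then have k: "?j \<le> m div 4" using ij by linarith
        have sets: "range v \<union> S.anc X \<union> S.anc Y = range v \<union> S.anc Y \<union> S.anc X" by blast
        have "gdist G (S.root Y) (S.root X) = ?p" using E(1) S.gdist_sym[OF RV] by simp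
        then have "\<exists>f. U_copy n m d ?j ?b ?a f G"
          by (rule S.antipodal_U_copy[OF XY(2,1) w(1) _ w(2)[unfolded sets] E(5)[unfolded sets] card_n _ refl _ k _ dq])
            (use nn ij dab in simp_all)
        then have "is_U n m d ?j ?b ?a G" unfolding iff using True a1 dab k by simp
        then show ?thesis using Rab True H1 by metis
      qed
    qed
  qed
qed

text \<open>All differences \<open>a - b\<close> have the parity of \<open>s\<close>. The chosen one
  is the largest not above \<open>\<alpha> + 1\<close>; smaller ones are at least two below it, and
  larger ones exceed \<open>\<alpha> + 1\<close>. A tie needs two neighbouring values at distance 1
  on either side of \<alpha>.\<close>

lemma optimum:
  fixes p q H s \<gamma> \<theta> :: nat and \<alpha> :: real
  assumes q: "1 \<le> q" and \<alpha>: "\<alpha> * (2 * (real q + H) - 1) = 2 * real H * p"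
    and gt: "\<gamma> + \<theta> = s" "real \<gamma> - real \<theta> \<le> \<alpha> + 1"
    and best: "\<And>g t :: nat. g + t = s \<Longrightarrow> real g - real t \<le> \<alpha> + 1 \<Longrightarrow> real g - real t \<le> real \<gamma> - real \<theta>"
  shows "lower_value p q s H (config_weight p q p \<gamma> \<theta> H)"
    and "\<theta> \<le> \<gamma>"
    and "a + b = s \<Longrightarrow> config_weight p q p a b H = config_weight p q p \<gamma> \<theta> H \<longleftrightarrow>
      a = \<gamma> \<and> b = \<theta> \<or> real \<gamma> - real \<theta> = \<alpha> + 1 \<and> a + 1 = \<gamma> \<and> b = \<theta> + 1"
proof -
  define N where "N = 2 * (real q + H) - 1"
  have N: "0 < N" using q by (simp add: N_def)
  have N\<alpha>: "N * \<alpha> = 2 * real H * p" using \<alpha> by (simp add: N_def mult.commute)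
  have \<alpha>0: "0 \<le> \<alpha>"
  proof (rule ccontr)
    assume "\<not> 0 \<le> \<alpha>"
    then have "N * \<alpha> < 0" using N by (simp add: mult_pos_neg)
    moreover have "0 \<le> 2 * real H * p" by simp
    ultimately show False using N\<alpha> by linarith
  qed
  define D0 where "D0 = real \<gamma> - real \<theta>"
  \<comment> \<open>With \<open>D = a - b\<close> the right side is
    \<open>N * ((D - \<alpha>)^2 - (D0 - \<alpha>)^2)\<close>.\<close>
  have diff: "4 * (config_weight p q p a b H - config_weight p q p \<gamma> \<theta> H) = N * ((real a - b - D0) * (real a - b + D0 - 2 * \<alpha>))"
    if ab: "a + b = s" for a b :: nat
  proof -
    have e: "real a + real b = real \<gamma> + real \<theta>" using ab gt(1) by (metis of_nat_add)
    have a: "real a = real \<gamma> + real \<theta> - real b" using e by simp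
    have "4 * (config_weight p q p a b H - config_weight p q p \<gamma> \<theta> H) = 4 * (N * (real \<gamma> * \<theta> - real a * b) + N * \<alpha> * (real b - \<theta>))"
      unfolding config_weight_antipodal_diff[OF e] N\<alpha> by (simp add: N_def)
    also have "\<dots> = N * (4 * (real \<gamma> * \<theta> - real a * b) + 4 * \<alpha> * (real b - \<theta>))"
      by (simp add: algebra_simps)
    also have "4 * (real \<gamma> * \<theta> - real a * b) + 4 * \<alpha> * (real b - \<theta>) = (real a - b - D0) * (real a - b + D0 - 2 * \<alpha>)"
      unfolding D0_def a by (simp add: algebra_simps)
    finally show ?thesis .
  qed
  have D0: "D0 \<le> \<alpha> + 1" using gt(2) by (simp add: D0_def)
  \<comment> \<open>Lowering a difference above \<open>\<alpha> + 1\<close> in steps of two must hit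
    the interval from \<open>\<alpha> - 1\<close> (excluded) to \<open>\<alpha> + 1\<close>
    (included); \<open>j\<close> is the number of steps. If no difference is that large,
    \<open>D0\<close> may lie far below \<alpha>.\<close>
  have lt: "\<alpha> - 1 < D0" if ab: "a + b = s" and big: "\<alpha> + 1 < real a - b" for a b :: nat
  proof -
    define j where "j = (LEAST j. real a - b - 2 * real j \<le> \<alpha> + 1)"
    have "real a - b - 2 * real a \<le> \<alpha> + 1" using \<alpha>0 by simp
    then have j: "real a - b - 2 * real j \<le> \<alpha> + 1" "j \<le> a"
      unfolding j_def by (rule LeastI, rule Least_le)
    have "j \<noteq> 0" using j(1) big by auto
    then obtain i where i: "j = Suc i" by (cases j) auto
    have "\<not> real a - b - 2 * real i \<le> \<alpha> + 1"
      by (rule not_less_Least) (use i in \<open>simp add: j_def[symmetric]\<close>)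
    then have "\<alpha> - 1 < real a - b - 2 * real j" unfolding i by simp
    moreover have "real (a - j) - real (b + j) \<le> D0"
      unfolding D0_def by (rule best) (use ab j in \<open>auto simp: of_nat_diff\<close>)
    ultimately show ?thesis using j(2) by (simp add: of_nat_diff)
  qed
  have cases: "a = \<gamma> \<and> b = \<theta> \<or> real a - b \<le> D0 - 2 \<or> \<alpha> + 1 < real a - b" if ab: "a + b = s" for a b :: nat
  proof (cases "\<alpha> + 1 < real a - b")
    case False
    then have "real a - b \<le> D0" unfolding D0_def using best[OF ab] by simp
    then have "int a - int b \<le> int \<gamma> - int \<theta>" unfolding D0_def by linarith
    then have "a = \<gamma> \<or> int a - int b \<le> int \<gamma> - int \<theta> - 2" using ab gt(1) by linarith
    then show ?thesis
    proof
      assume "int a - int b \<le> int \<gamma> - int \<theta> - 2"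
      then show ?thesis unfolding D0_def by linarith
    qed (use ab gt(1) in simp)
  qed simp
  have ge: "config_weight p q p \<gamma> \<theta> H \<le> config_weight p q p a b H" if ab: "a + b = s" for a b :: nat
  proof -
    have "0 \<le> (real a - b - D0) * (real a - b + D0 - 2 * \<alpha>)"
      using cases[OF ab]
    proof (elim disjE)
      assume "real a - b \<le> D0 - 2"
      then show ?thesis using D0 by (intro mult_nonpos_nonpos) linarith+
    next
      assume "\<alpha> + 1 < real a - b"
      then show ?thesis using D0 lt[OF ab] by (intro mult_nonneg_nonneg) linarith+
    qed (simp add: D0_def)
    then have "0 \<le> 4 * (config_weight p q p a b H - config_weight p q p \<gamma> \<theta> H)" unfolding diff[OF ab] using N by simp
    then show ?thesis by simp
  qed
  show "lower_value p q s H (config_weight p q p \<gamma> \<theta> H)" using ge by (simp add: lower_value_def)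
  show "\<theta> \<le> \<gamma>"
  proof (rule ccontr)
    assume "\<not> \<theta> \<le> \<gamma>"
    then have l: "\<gamma> + 1 \<le> \<theta>" by simp
    \<comment> \<open>The most balanced lengths have difference 0 or 1, which is admissible because
      \<alpha> is nonnegative; a negative maximum is therefore impossible.\<close>
    have "real (s - s div 2) - real (s div 2) \<le> real \<gamma> - real \<theta>"
    proof (rule best)
      have "s - s div 2 \<le> s div 2 + 1" by linarith
      then have "real (s - s div 2) \<le> real (s div 2) + 1" by linarith
      then show "real (s - s div 2) - real (s div 2) \<le> \<alpha> + 1" using \<alpha>0 by linarith
    qed simp
    moreover have "real (s div 2) \<le> real (s - s div 2)" by linarith
    ultimately show False using l by linarith
  qed
  show "config_weight p q p a b H = config_weight p q p \<gamma> \<theta> H \<longleftrightarrow>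
      a = \<gamma> \<and> b = \<theta> \<or> real \<gamma> - real \<theta> = \<alpha> + 1 \<and> a + 1 = \<gamma> \<and> b = \<theta> + 1" if ab: "a + b = s"
  proof -
    have "config_weight p q p a b H = config_weight p q p \<gamma> \<theta> H \<longleftrightarrow> N * ((real a - b - D0) * (real a - b + D0 - 2 * \<alpha>)) = 0"
      using diff[OF ab] by auto
    also have "\<dots> \<longleftrightarrow> real a - b = D0 \<or> real a - b + D0 = 2 * \<alpha>" using N by auto
    also have "\<dots> \<longleftrightarrow> a = \<gamma> \<and> b = \<theta> \<or> real \<gamma> - real \<theta> = \<alpha> + 1 \<and> a + 1 = \<gamma> \<and> b = \<theta> + 1"
    proof
      assume o: "real a - b = D0 \<or> real a - b + D0 = 2 * \<alpha>"
      show "a = \<gamma> \<and> b = \<theta> \<or> real \<gamma> - real \<theta> = \<alpha> + 1 \<and> a + 1 = \<gamma> \<and> b = \<theta> + 1"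
        using cases[OF ab]
      proof (elim disjE)
        assume l: "real a - b \<le> D0 - 2"
        then have e: "D0 = \<alpha> + 1" "real a - b = D0 - 2" using o D0 by linarith+
        then have "int a - int b = int \<gamma> - int \<theta> - 2" unfolding D0_def by linarith
        then show ?thesis using e ab gt(1) unfolding D0_def by linarith
      next
        assume "\<alpha> + 1 < real a - b"
        then show ?thesis using o D0 lt[OF ab] by linarith
      qed simp
    next
      assume "a = \<gamma> \<and> b = \<theta> \<or> real \<gamma> - real \<theta> = \<alpha> + 1 \<and> a + 1 = \<gamma> \<and> b = \<theta> + 1"
      then show "real a - b = D0 \<or> real a - b + D0 = 2 * \<alpha>" unfolding D0_def by auto
    qed
    finally show ?thesis .
  qed
qed

text \<open>Both kinds of ties in one statement: a second pair of lengths if two consecutive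
  differences lie symmetrically about \<alpha>, and further positions of the leaves if the lengths
  agree. The latter asks for \<open>1 \<le> H\<close>, since without leaves \<open>U_graph\<close>
  is the same for all \<open>k\<close>.\<close>

theorem minimal_graphs:
  fixes n m d s H \<gamma> \<theta> :: nat and \<alpha> :: real and G :: "'a pair_pre_digraph"
  assumes m: "3 \<le> m" and d: "d = m div 2 + s" "3 \<le> d" and n: "n = m + s + H" "m + 2 \<le> n"
    and \<alpha>: "\<alpha> * (2 * (real ((m + 1) div 2) + H) - 1) = 2 * real H * real (m div 2)"
    and gt: "\<gamma> + \<theta> = s" "real \<gamma> - real \<theta> \<le> \<alpha> + 1"
    and best: "\<And>g t :: nat. g + t = s \<Longrightarrow> real g - real t \<le> \<alpha> + 1 \<Longrightarrow> real g - real t \<le> real \<gamma> - real \<theta>"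
  shows "min_degree_distance n m d G \<longleftrightarrow> (\<exists>k a b. is_U n m d k a b G \<and> (k = 0 \<or> a = b \<and> 1 \<le> H) \<and>
     (a = \<gamma> \<and> b = \<theta> \<or> real \<gamma> - real \<theta> = \<alpha> + 1 \<and> a + 1 = \<gamma> \<and> b = \<theta> + 1))"
proof -
  let ?p = "m div 2" and ?q = "(m + 1) div 2"
  define x where "x = config_weight ?p ?q ?p \<gamma> \<theta> H"
  define F where "F = 2 * x - real n * (real n - real m)"
  have q: "1 \<le> ?q" using m by simp
  note opt = optimum[OF q \<alpha> gt best]
  have opt3: "config_weight ?p ?q ?p a b H = x \<longleftrightarrow> a = \<gamma> \<and> b = \<theta> \<or> real \<gamma> - real \<theta> = \<alpha> + 1 \<and> a + 1 = \<gamma> \<and> b = \<theta> + 1"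
    if "a + b = s" for a b :: nat
    unfolding x_def by (rule opt(3)) (use that in auto)
  have low: "lower_value ?p ?q s H x" unfolding x_def by (rule opt(1))
  have pq: "?p + ?q = m" by presburger
  have dq: "d + ?q \<le> n" using d n pq by simp
  note cl = class_lower[OF _ d n low]
  have copy: "G' \<in> unicyclic_class n m d \<and> degree_distance G' = F"
    if "U_copy n m d k a b f G'" "b \<le> a" "1 \<le> a" "a + b = s" "k \<le> m div 4" "k = 0 \<or> a = b"
      "config_weight ?p ?q ?p a b H = x" for k a b f and G' :: "'a pair_pre_digraph"
  proof -
    have dab: "a + b + ?p = d" using that(4) d by simp
    have "n - (m + a + b) = H" using n that(4) by simp
    then show ?thesis
      using U_copy_class[OF that(1) dab dq m d(2) that(2,3,5,6)] that(7) by (simp add: F_def)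
  qed
  show ?thesis
  proof
    assume "min_degree_distance n m d G"
    then have G: "G \<in> unicyclic_class n m d"
      and min: "\<And>G' :: 'a pair_pre_digraph. G' \<in> unicyclic_class n m d \<Longrightarrow> degree_distance G \<le> degree_distance G'"
      by (auto simp: min_degree_distance_def is_arg_min_def not_less)
    have s: "1 \<le> s" by (rule cl(1)[OF G])
    then have \<gamma>: "1 \<le> \<gamma>" using opt(2) gt(1) by linarith
    have "card (pverts G) = n" using G by (simp add: unicyclic_class_def)
    \<comment> \<open>The vertex set of the given minimiser carries a copy of U, so the bound
      \<open>F\<close> is attained over the type \<open>'a\<close>.\<close>
    then obtain f and G' :: "'a pair_pre_digraph" where G': "U_copy n m d 0 \<gamma> \<theta> f G'"
    proof -
      have "0 < n" "\<gamma> + \<theta> + ?p = d" using m n d gt(1) by linarith+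
      then show ?thesis
        using that U_copy_exists[OF \<open>card (pverts G) = n\<close> _ _ dq, of \<gamma> \<theta> 0] by blast
    qed
    have "G' \<in> unicyclic_class n m d \<and> degree_distance G' = F"
      by (rule copy[OF G']) (use opt(2) \<gamma> gt(1) x_def in simp_all)
    then have "degree_distance G \<le> F" using min[of G'] by linarith
    moreover have "F \<le> degree_distance G" unfolding F_def by (rule cl(2)[OF G])
    ultimately have "degree_distance G = 2 * x - real n * (real n - real m)" by (simp add: F_def)
    then obtain k a b where kab: "is_U n m d k a b G" "k = 0 \<or> a = b \<and> 1 \<le> H" "config_weight ?p ?q ?p a b H = x"
      using cl(3)[OF G] by blast
    have "a + b = s" using kab(1) d by (simp add: is_U_def)
    then show "\<exists>k a b. is_U n m d k a b G \<and> (k = 0 \<or> a = b \<and> 1 \<le> H) \<and>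
     (a = \<gamma> \<and> b = \<theta> \<or> real \<gamma> - real \<theta> = \<alpha> + 1 \<and> a + 1 = \<gamma> \<and> b = \<theta> + 1)"
      using kab opt3 by blast
  next
    assume "\<exists>k a b. is_U n m d k a b G \<and> (k = 0 \<or> a = b \<and> 1 \<le> H) \<and>
     (a = \<gamma> \<and> b = \<theta> \<or> real \<gamma> - real \<theta> = \<alpha> + 1 \<and> a + 1 = \<gamma> \<and> b = \<theta> + 1)"
    then obtain k a b where kab: "is_U n m d k a b G" "k = 0 \<or> a = b \<and> 1 \<le> H"
     "a = \<gamma> \<and> b = \<theta> \<or> real \<gamma> - real \<theta> = \<alpha> + 1 \<and> a + 1 = \<gamma> \<and> b = \<theta> + 1" by blast
    then obtain f where f: "U_copy n m d k a b f G" "b \<le> a" "1 \<le> a" "a + b + ?p = d" "k \<le> m div 4"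
      unfolding is_U_iff[OF dq m] by blast
    then have ab: "a + b = s" using d by simp
    have "config_weight ?p ?q ?p a b H = x" using opt3[OF ab] kab(3) by blast
    then have "G \<in> unicyclic_class n m d \<and> degree_distance G = F"
      using copy[OF f(1-3) ab f(5)] kab(2) by blast
    then show "min_degree_distance n m d G"
      using cl(2) unfolding min_degree_distance_def is_arg_min_def F_def
      by (metis of_nat_less_iff not_le)
  qed
qed

text \<open>In the third case both graphs are minimal only if the difference
  \<open>\<alpha> + 1\<close> is realised by lengths with sum \<open>s = d - m div 2\<close>, that
  is if \<open>\<alpha> + 1 \<le> s\<close>. For smaller \<open>s\<close> the maximum is reached at
  \<open>\<gamma> = s\<close> and \<open>\<theta> = 0\<close>, without a tie; hence the side
  condition on the second graph.\<close>

theorem theorem1: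
  fixes n m d \<beta> \<gamma> \<theta> :: nat and \<alpha> :: real
  assumes "6 \<le> n"
    and "3 \<le> m" and "m + 2 \<le> n"
    and "3 \<le> d" and "d + (m + 1) div 2 \<le> n"
    and "\<alpha> = (real n - real d - real ((m + 1) div 2)) * real (m div 2) / (real n - real d - 1/2)"
    and "\<beta> = (d - m div 2) div 2"
    and "\<gamma> + \<theta> + m div 2 = d" and "real \<gamma> - real \<theta> \<le> \<alpha> + 1"
    and "\<And>g t :: nat. g + t + m div 2 = d \<Longrightarrow> real g - real t \<le> \<alpha> + 1
           \<Longrightarrow> real g - real t \<le> real \<gamma> - real \<theta>"
  shows "(0 < \<alpha> \<and> \<alpha> < 1 \<and> even (d - m div 2) \<longrightarrow>
            (\<forall>G :: 'a pair_pre_digraph. min_degree_distance n m d G \<longleftrightarrow>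
              (\<exists>k \<le> m div 4. is_U n m d k \<beta> \<beta> G)))
       \<and> (\<alpha> = 1 \<and> even (d - m div 2) \<longrightarrow>
            \<gamma> = \<beta> + 1 \<and> \<beta> = \<theta> + 1 \<and>
            (\<forall>G :: 'a pair_pre_digraph. min_degree_distance n m d G \<longleftrightarrow>
              is_U n m d 0 \<gamma> \<theta> G \<or> (\<exists>k \<le> m div 4. is_U n m d k \<beta> \<beta> G)))
       \<and> (1 < \<alpha> \<and> (\<exists>j :: nat. \<alpha> = real j \<and> even j \<noteq> even (d - m div 2)) \<longrightarrow>
            (\<forall>G :: 'a pair_pre_digraph. min_degree_distance n m d G \<longleftrightarrow>
              is_U n m d 0 \<gamma> \<theta> G \<or>
              (\<alpha> + 1 \<le> real (d - m div 2) \<and> is_U n m d 0 (\<gamma> - 1) (\<theta> + 1) G)))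
       \<and> (\<alpha> = 0
          \<or> (0 < \<alpha> \<and> \<alpha> \<le> 1 \<and> odd (d - m div 2))
          \<or> (1 < \<alpha> \<and> (\<alpha> \<notin> \<int> \<or> (\<exists>j :: nat. \<alpha> = real j \<and> even j = even (d - m div 2)))) \<longrightarrow>
            (\<forall>G :: 'a pair_pre_digraph. min_degree_distance n m d G \<longleftrightarrow>
              is_U n m d 0 \<gamma> \<theta> G))"
proof -
  let ?p = "m div 2" and ?q = "(m + 1) div 2"
  define s where "s = d - ?p"
  define H where "H = n - d - ?q"
  have gt: "\<gamma> + \<theta> = s" and d_eq: "d = ?p + s" using assms(8) by (simp_all add: s_def)
  have n_eq: "n = m + s + H"
  proof -
    have "?p + ?q = m" by presburger
    then show ?thesis using assms(5) d_eq by (simp add: H_def)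
  qed
  have q1: "1 \<le> ?q" using assms(2) by simp
  have nd: "real n - real d - real ?q = H" using assms(5) by (simp add: H_def of_nat_diff)
  have pos: "0 < real ?q + H - 1 / 2" using q1 by (simp add: field_simps)
  have \<alpha>_eq: "\<alpha> = real H * ?p / (real ?q + H - 1 / 2)"
    using assms(6) nd by (simp add: algebra_simps)
  then have "\<alpha> * (real ?q + H - 1 / 2) = real H * ?p" using pos by simp
  then have \<alpha>: "\<alpha> * (2 * (real ?q + H) - 1) = 2 * real H * real ?p" by (simp add: algebra_simps)
  have best: "real g - real t \<le> real \<gamma> - real \<theta>" if "g + t = s" "real g - real t \<le> \<alpha> + 1" for g t :: nat
    using assms(10)[of g t] that d_eq by simp
  have \<theta>\<gamma>: "\<theta> \<le> \<gamma>" by (rule optimum(2)[OF q1 \<alpha> gt assms(9)]) (rule best)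
  have min: "min_degree_distance n m d G \<longleftrightarrow> (\<exists>k a b. is_U n m d k a b G \<and> (k = 0 \<or> a = b \<and> 1 \<le> H) \<and>
     (a = \<gamma> \<and> b = \<theta> \<or> real \<gamma> - real \<theta> = \<alpha> + 1 \<and> a + 1 = \<gamma> \<and> b = \<theta> + 1))"
    for G :: "'a pair_pre_digraph"
    by (rule minimal_graphs[OF assms(2) d_eq assms(4) n_eq assms(3) \<alpha> gt assms(9)]) (rule best)
  have is_U: "is_U n m d k a b G \<Longrightarrow> b \<le> a \<and> 1 \<le> a \<and> a + b = s \<and> k \<le> m div 4"
    for k a b and G :: "'a pair_pre_digraph"
    unfolding is_U_def using d_eq by simp
  \<comment> \<open>\<alpha> times the odd number \<open>2 * (q + H) - 1\<close> is the even number
    \<open>2 * H * p\<close>.\<close>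
  have \<alpha>_even: "even j" if "\<alpha> = real j" for j
  proof -
    have "j * (2 * (?q + H) - 1) = 2 * (H * ?p)"
    proof -
      have "real (j * (2 * (?q + H) - 1)) = real (2 * (H * ?p))"
        using \<alpha> that q1 by (simp add: of_nat_diff)
      then show ?thesis by (simp only: of_nat_eq_iff)
    qed
    then have "even (j * (2 * (?q + H) - 1))" by simp
    then show ?thesis using q1 by auto
  qed
  have H0: "H = 0" if "\<alpha> = 0"
  proof -
    have "?p \<noteq> 0" using assms(2) by linarith
    then show ?thesis using \<alpha> that by simp
  qed
  have \<alpha>0: "0 \<le> \<alpha>"
    using \<alpha>_eq pos by simp
  have even_sub: "even (d - ?p) \<longleftrightarrow> even s" by (simp add: s_def)
  have balanced: "\<gamma> = \<beta> \<and> \<theta> = \<beta>" if "\<alpha> < 1" "even s"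
  proof -
    have "real \<gamma> < real \<theta> + 2" using assms(9) that(1) by linarith
    then have "\<gamma> \<le> \<theta> + 1" by linarith
    then have "\<gamma> = \<theta>" using \<theta>\<gamma> gt that(2) by presburger
    then show ?thesis using gt assms(7) by (simp add: s_def)
  qed
  have part1: "min_degree_distance n m d G \<longleftrightarrow> (\<exists>k \<le> m div 4. is_U n m d k \<beta> \<beta> G)"
    if "0 < \<alpha>" "\<alpha> < 1" "even s" for G :: "'a pair_pre_digraph"
  proof -
    have b: "\<gamma> = \<beta>" "\<theta> = \<beta>" using balanced that by blast+
    have "1 \<le> H" using \<alpha>_eq that(1) by (cases "H = 0") simp_all
    moreover have "real \<gamma> - real \<theta> \<noteq> \<alpha> + 1" using b that(1) by simp
    ultimately show ?thesis unfolding min b using is_U by blast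
  qed
  have unique: "min_degree_distance n m d G \<longleftrightarrow> is_U n m d 0 \<gamma> \<theta> G"
    if no: "\<not> (real \<gamma> - real \<theta> = \<alpha> + 1 \<and> \<theta> + 2 \<le> \<gamma>)" and z: "s = 0 \<or> \<gamma> \<noteq> \<theta> \<or> H = 0"
    for G :: "'a pair_pre_digraph"
  proof
    assume "min_degree_distance n m d G"
    then obtain k a b where U: "is_U n m d k a b G" "k = 0 \<or> a = b \<and> 1 \<le> H"
      "a = \<gamma> \<and> b = \<theta> \<or> real \<gamma> - real \<theta> = \<alpha> + 1 \<and> a + 1 = \<gamma> \<and> b = \<theta> + 1"
      unfolding min by blast
    then have "a = \<gamma> \<and> b = \<theta>" using is_U[OF U(1)] no by auto
    moreover have "k = 0" using U(2) z is_U[OF U(1)] calculation by auto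
    ultimately show "is_U n m d 0 \<gamma> \<theta> G" using U(1) by simp
  qed (use min in blast)
  have part3: "min_degree_distance n m d G \<longleftrightarrow> is_U n m d 0 \<gamma> \<theta> G \<or>
      (\<alpha> + 1 \<le> real s \<and> is_U n m d 0 (\<gamma> - 1) (\<theta> + 1) G)"
    if "1 < \<alpha>" and j: "\<alpha> = real j" "even j \<noteq> even s" for j and G :: "'a pair_pre_digraph"
  proof -
    have odd: "odd s" using \<alpha>_even[OF j(1)] j(2) by blast
    \<comment> \<open>As \<open>s\<close> and \<open>\<alpha> + 1\<close> are both odd, lengths with
      difference \<open>\<alpha> + 1\<close> exist as soon as \<open>s\<close> is large enough;
      \<open>g\<close> is the longer one.\<close>
    have iff: "real \<gamma> - real \<theta> = \<alpha> + 1 \<longleftrightarrow> \<alpha> + 1 \<le> real s"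
    proof
      assume "\<alpha> + 1 \<le> real s"
      then have le: "j + 1 \<le> s" using j(1) by linarith
      have "even (s + (j + 1))" using odd \<alpha>_even[OF j(1)] by simp
      then obtain g where g: "s + (j + 1) = 2 * g" by (elim evenE)
      then have gl: "g \<le> s" using le by linarith
      then have "real g - real (s - g) = \<alpha> + 1"
        using arg_cong[OF g, of real] j(1) by (simp add: of_nat_diff)
      then have "\<alpha> + 1 \<le> real \<gamma> - real \<theta>" using best[of g "s - g"] gl by simp
      then show "real \<gamma> - real \<theta> = \<alpha> + 1" using assms(9) by linarith
    qed (use gt in linarith)
    have ne: "a \<noteq> b" if "a + b = s" for a b using odd that by auto
    show ?thesis
    proof
      assume "min_degree_distance n m d G"
      then obtain k a b where U: "is_U n m d k a b G" "k = 0 \<or> a = b \<and> 1 \<le> H"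
        "a = \<gamma> \<and> b = \<theta> \<or> real \<gamma> - real \<theta> = \<alpha> + 1 \<and> a + 1 = \<gamma> \<and> b = \<theta> + 1"
        unfolding min by blast
      have "k = 0" using U(2) ne is_U[OF U(1)] by blast
      then show "is_U n m d 0 \<gamma> \<theta> G \<or> (\<alpha> + 1 \<le> real s \<and> is_U n m d 0 (\<gamma> - 1) (\<theta> + 1) G)"
        using U(1,3) iff by auto
    next
      assume "is_U n m d 0 \<gamma> \<theta> G \<or> (\<alpha> + 1 \<le> real s \<and> is_U n m d 0 (\<gamma> - 1) (\<theta> + 1) G)"
      then show "min_degree_distance n m d G"
      proof
        assume "\<alpha> + 1 \<le> real s \<and> is_U n m d 0 (\<gamma> - 1) (\<theta> + 1) G"
        then have U: "is_U n m d 0 (\<gamma> - 1) (\<theta> + 1) G" and e: "real \<gamma> - real \<theta> = \<alpha> + 1" using iff by blast+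
        have "\<gamma> - 1 + 1 = \<gamma>" using e \<alpha>0 by linarith
        then show ?thesis unfolding min using U e by blast
      qed (use min in blast)
    qed
  qed
  have part4: "min_degree_distance n m d G \<longleftrightarrow> is_U n m d 0 \<gamma> \<theta> G"
    if c: "\<alpha> = 0 \<or> (0 < \<alpha> \<and> \<alpha> \<le> 1 \<and> odd s) \<or>
      (1 < \<alpha> \<and> (\<alpha> \<notin> \<int> \<or> (\<exists>j :: nat. \<alpha> = real j \<and> even j = even s)))"
    for G :: "'a pair_pre_digraph"
  proof (rule unique)
    show "\<not> (real \<gamma> - real \<theta> = \<alpha> + 1 \<and> \<theta> + 2 \<le> \<gamma>)"
    proof
      assume e: "real \<gamma> - real \<theta> = \<alpha> + 1 \<and> \<theta> + 2 \<le> \<gamma>"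
      \<comment> \<open>A tie makes \<alpha> the natural number
        \<open>\<gamma> - \<theta> - 1\<close>. It is then even and positive, so \<open>s\<close> is
        odd, and every alternative of \<open>c\<close> fails.\<close>
      define i where "i = \<gamma> - \<theta> - 1"
      have \<gamma>: "\<gamma> = \<theta> + i + 1" "1 \<le> i" using e by (auto simp: i_def)
      then have i: "\<alpha> = real i" using e by simp
      have "even i" by (rule \<alpha>_even[OF i])
      then have "odd s" using gt \<gamma>(1) by auto
      moreover have "\<alpha> \<in> \<int>" "\<alpha> \<noteq> 0" using i \<gamma>(2) by simp_all
      moreover have "\<alpha> \<noteq> 1" using \<open>even i\<close> i by auto
      ultimately have "0 < \<alpha> \<and> \<alpha> \<le> 1 \<or> (\<exists>j :: nat. \<alpha> = real j \<and> even j = even s)" using c by blast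
      then show False
      proof
        assume "0 < \<alpha> \<and> \<alpha> \<le> 1"
        then show False using i \<open>\<alpha> \<noteq> 1\<close> by auto
      next
        assume "\<exists>j :: nat. \<alpha> = real j \<and> even j = even s"
        then show False using \<alpha>_even \<open>odd s\<close> by blast
      qed
    qed
    show "s = 0 \<or> \<gamma> \<noteq> \<theta> \<or> H = 0"
    proof (rule ccontr)
      assume "\<not> ?thesis"
      then have s: "0 < s" "\<gamma> = \<theta>" "H \<noteq> 0" by auto
      then have ev: "even s" using gt by auto
      then have "1 < \<alpha>" using c H0 s(3) by auto
      \<comment> \<open>For \<open>1 < \<alpha>\<close> equal lengths are not optimal: the
        difference 2 is admissible as well, against the maximality of
        \<open>\<gamma> - \<theta>\<close>.\<close>
      moreover have "\<gamma> + 1 + (\<theta> - 1) = s" "1 \<le> \<theta>" using s gt by auto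
      ultimately have "real (\<gamma> + 1) - real (\<theta> - 1) \<le> real \<gamma> - real \<theta>"
        by (intro best) (use s in \<open>auto simp: of_nat_diff\<close>)
      then show False using \<open>1 \<le> \<theta>\<close> by (simp add: of_nat_diff)
    qed
  qed
  \<comment> \<open>An integral \<alpha> is even, so the second case of the theorem never
    arises.\<close>
  have no1: "\<alpha> \<noteq> 1" using \<alpha>_even[of 1] by auto
  show ?thesis
    unfolding s_def[symmetric] using part1 no1 part3 part4 by blast
qed

end
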